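(* The set $\{h_E(X) : X \subseteq \mathcal{A}^{\mathbb{Z}} \text{ is an effective } \mathbb{Z}\text{-subshift over some finite alphabet } \mathcal{A}\}$ is exactly $\Pi_3 \cap [0,+\infty)$.
   Context: Let $\mathcal{A}$ be a finite alphabet and $d\ge 1$. A pattern is a map $w\in\mathcal{A}^P$ for a finite $P\subseteq\mathbb{Z}^d$ (its support). A pattern $w$ appears in $x\in\mathcal{A}^{\mathbb{Z}^d}$ if some translate of $w$ coincides with $x$ on the translated support. For a family $\mathcal{F}$ of finite patterns, $X_{\mathcal{F}}$ is the set of configurations $x\in\mathcal{A}^{\mathbb{Z}^d}$ in which no pattern of $\mathcal{F}$ appears; a subshift is a set of the form $X_{\mathcal{F}}$. A subshift is effective if it equals $X_{\mathcal{F}}$ for some computably enumerable $\mathcal{F}$. For finite $P$, $\mathcal{L}_P(X)$ is the set of patterns with support $P$ appearing in some configuration of $X$, and $\mathcal{L}_n(X)=\mathcal{L}_{\{0,\dots,n-1\}^d}(X)$. The extender set of a pattern $w$ with support $P$ is $E_X(w)=\{x\in\mathcal{A}^{\mathbb{Z}^d\setminus P} : x\sqcup w\in X\}$, where $x\sqcup w$ equals $w$ on $P$ and $x$ elsewhere. Let $E_X(n)=\{E_X(w): w\in\mathcal{L}_n(X)\}$. The extender entropy is $h_E(X)=\lim_{n\to\infty}\frac{\log_2 |E_X(n)|}{n^d}$ (this limit exists). A real $\alpha$ is in $\Pi_3$ if there is a computable sequence of rationals $(\beta_{k_1,k_2,k_3})_{k_1,k_2,k_3\in\mathbb{N}}$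 with $\alpha=\inf_{k_1}\sup_{k_2}\inf_{k_3}\beta_{k_1,k_2,k_3}$. *)

theory Defs
  imports "HOL-Library.Nat_Bijection" "HOL-Library.Extended_Real" Complex_Main
begin

text \<open>Codes for the partial recursive functions, evaluated on lists of arguments.  Primitive
  recursion runs over the first argument; its step function receives the previous value, the
  recursion counter and the parameters, in that order.\<close>

datatype recf =
    Zero
  | Succ
  | Proj nat
  | Comp recf "recf list"
  | PrimRec recf recf
  | Mu recf

primrec recf_eval :: "recf \<Rightarrow> nat list \<Rightarrow> nat option" where
  "recf_eval Zero xs = Some 0"
| "recf_eval Succ xs = (case xs of [] \<Rightarrow> None | x # _ \<Rightarrow> Some (Suc x))"
| "recf_eval (Proj i) xs = (if i < length xs then Some (xs ! i) else None)"
| "recf_eval (Comp f gs) xs =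
     Option.bind (those (map (\<lambda>e. e xs) (map recf_eval gs))) (recf_eval f)"
| "recf_eval (PrimRec f g) xs =
     (case xs of
        [] \<Rightarrow> None
      | n # ys \<Rightarrow>
          rec_nat (recf_eval f ys)
            (\<lambda>m prev. Option.bind prev (\<lambda>y. recf_eval g (y # m # ys))) n)"
| "recf_eval (Mu f) xs =
     (if \<exists>n. recf_eval f (n # xs) = Some 0 \<and> (\<forall>m<n. recf_eval f (m # xs) \<noteq> None)
      then Some (LEAST n. recf_eval f (n # xs) = Some 0)
      else None)"

definition computable3 :: "(nat \<Rightarrow> nat \<Rightarrow> nat \<Rightarrow> nat) \<Rightarrow> bool" where
  "computable3 f \<longleftrightarrow> (\<exists>r. \<forall>a b c. recf_eval r [a, b, c] = Some (f a b c))"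

definition comp_enum :: "nat set \<Rightarrow> bool" where
  "comp_enum S \<longleftrightarrow> (\<exists>r. S = {n. recf_eval r [n] \<noteq> None})"

definition computable_rat_seq :: "(nat \<Rightarrow> nat \<Rightarrow> nat \<Rightarrow> rat) \<Rightarrow> bool" where
  "computable_rat_seq \<beta> \<longleftrightarrow>
     (\<exists>p q. computable3 p \<and> computable3 q \<and>
        (\<forall>a b c. \<beta> a b c = of_int (int_decode (p a b c)) / of_nat (Suc (q a b c))))"

text \<open>Infima and suprema are taken in the extended reals, so that no boundedness conditions on
  the sequence are needed; only the final value has to be a real number.\<close>

definition Pi3 :: "real set" where
  "Pi3 = {\<alpha>. \<exists>\<beta>. computable_rat_seq \<beta> \<and>
            ereal \<alpha> = (INF k1. SUP k2. INF k3. ereal (of_rat (\<beta> k1 k2 k3)))}"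

text \<open>Patterns, configurations and their restrictions are all partial maps on the integers;
  the domain of the map is the support, and \<open>maps_on A P\<close> is the set usually written
  $A^P$.  A configuration is a map with full support.  Symbols are natural numbers, and an
  alphabet is a finite set of them.\<close>

definition maps_on :: "nat set \<Rightarrow> int set \<Rightarrow> (int \<rightharpoonup> nat) set" where
  "maps_on A P = {w. dom w = P \<and> ran w \<subseteq> A}"

definition patterns :: "nat set \<Rightarrow> (int \<rightharpoonup> nat) set" where
  "patterns A = (\<Union>P\<in>{P. finite P}. maps_on A P)"

definition appears_in :: "(int \<rightharpoonup> nat) \<Rightarrow> (int \<rightharpoonup> nat) \<Rightarrow> bool" where
  "appears_in w x \<longleftrightarrow> (\<exists>t. \<forall>p\<in>dom w. x (p + t) = w p)"

definition subshift_of :: "nat set \<Rightarrow> (int \<rightharpoonup> nat) set \<Rightarrow> (int \<rightharpoonup> nat) set" where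
  "subshift_of A F = {x \<in> maps_on A UNIV. \<forall>w\<in>F. \<not> appears_in w x}"

text \<open>A number codes a finite list of pairs (position, symbol), read as a finite partial map.
  Codes are not unique; a family of patterns is computably enumerable
  if the set of all codes of its members is.\<close>

definition pattern_decode :: "nat \<Rightarrow> (int \<rightharpoonup> nat)" where
  "pattern_decode n = map_of (map (map_prod int_decode id \<circ> prod_decode) (list_decode n))"

definition comp_enum_patterns :: "(int \<rightharpoonup> nat) set \<Rightarrow> bool" where
  "comp_enum_patterns F \<longleftrightarrow> comp_enum {n. pattern_decode n \<in> F}"

definition effective_subshift :: "nat set \<Rightarrow> (int \<rightharpoonup> nat) set \<Rightarrow> bool" where
  "effective_subshift A X \<longleftrightarrow>
     (\<exists>F. F \<subseteq> patterns A \<and> comp_enum_patterns F \<and> X = subshift_of A F)"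

definition language_on :: "nat set \<Rightarrow> (int \<rightharpoonup> nat) set \<Rightarrow> int set \<Rightarrow> (int \<rightharpoonup> nat) set" where
  "language_on A X P = {w \<in> maps_on A P. \<exists>x\<in>X. appears_in w x}"

definition language :: "nat set \<Rightarrow> (int \<rightharpoonup> nat) set \<Rightarrow> nat \<Rightarrow> (int \<rightharpoonup> nat) set" where
  "language A X n = language_on A X {0..<int n}"

definition extender_set ::
    "nat set \<Rightarrow> (int \<rightharpoonup> nat) set \<Rightarrow> (int \<rightharpoonup> nat) \<Rightarrow> (int \<rightharpoonup> nat) set" where
  "extender_set A X w = {x \<in> maps_on A (- dom w). x ++ w \<in> X}"

definition extender_sets ::
    "nat set \<Rightarrow> (int \<rightharpoonup> nat) set \<Rightarrow> nat \<Rightarrow> (int \<rightharpoonup> nat) set set" where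
  "extender_sets A X n = extender_set A X ` language A X n"

definition extender_entropy :: "nat set \<Rightarrow> (int \<rightharpoonup> nat) set \<Rightarrow> real" where
  "extender_entropy A X =
     lim (\<lambda>n. log 2 (real (card (extender_sets A X n))) / real n)"

end

theory Submission
  imports Defs "HOL-Real_Asymp.Real_Asymp" "HOL-Library.Diagonal_Subsequence" "HOL-Library.FuncSet"
begin

text \<open>By Fekete's lemma the extender entropy is the infimum of $\log_2 |E_X(n)| / n$.  Two words have
  different extender sets if and only if there is a window around them that can be completed to a
  configuration of $X$ with one word, which is a $\Pi_1$ condition by compactness, and in which a
  forbidden pattern appears with the other, which is a $\Sigma_1$ condition.  So $|E_X(n)| \ge j$ is
  $\Sigma_2$ in $n$ and $j$, and the infimum is a $\Pi_3$ real.

  Conversely, let $\alpha = \inf_i \sup_j \inf_k \beta_{ijk}$.  A configuration of the subshift to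
  be constructed either has an interval as its set of nonzero symbols, or repeats a single block
  periodically, with gaps of zeros between the copies.  The length of the gaps codes a level $l$, a
  density $c / 2^l$ and witnesses $j_0, \dots, j_l$ for the claim $c K / 2^l \le \beta_{i j_i k}$ for
  all $i \le l$ and all $k$; the gap is allowed unless the claim is refuted.  The block has length
  $2^{l^2}$ and carries $K$ free bits at each $t$ whose bit reversal modulo $2^l$ is less than $c$, so
  that words of length $n$ carry about $n c K / 2^l$ free bits, and these sets of positions are nested
  for all levels.  Only repeated blocks contribute many extender sets, since a single block may
  be exchanged for any other one.  Words of length $n = 2^{l^2}$ thus have about $2^{\gamma n}$ extender
  sets, where $\gamma$ is the largest value $c K / 2^{l'}$ claimed at levels $l' \ge l$, because the
  blocks of lower levels are too short to matter.\<close>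

subsection \<open>Computable functions and decidable predicates\<close>

text \<open>Forbidden patterns can only enforce what a finite window can refute. So the sup over
  \<open>j\<close> is absorbed by letting the configuration choose its witnesses, the inf over
  \<open>k\<close> is what refutation handles, and the inf over \<open>i\<close> is reached in the
  limit: level \<open>l\<close> commits to \<open>i \<le> l\<close> only, but the levels that matter
  grow with the window. There are infinitely many codes for one claim. Gaps are at least as long as
  blocks, so a window no longer than the block meets at most one copy, and the number of possible
  contents does not grow with the number of codes. Bit reversal puts the free set of a level above
  \<open>i\<close> inside a level-\<open>i\<close> set whose density is larger by at most 2^-i; one
  family with 2^i phases thus bounds all higher levels at once. The square in the exponent makes 2^l
  divide the block length and bounds all blocks of lower levels by n / 2^l symbols.\<close>

abbreviation fs :: "nat \<Rightarrow> nat" where "fs z \<equiv> fst (prod_decode z)"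
abbreviation sn :: "nat \<Rightarrow> nat" where "sn z \<equiv> snd (prod_decode z)"
abbreviation pr :: "nat \<Rightarrow> nat \<Rightarrow> nat" where "pr a b \<equiv> prod_encode (a, b)"

definition computable :: "(nat \<Rightarrow> nat) \<Rightarrow> bool" where
  "computable f \<longleftrightarrow> (\<exists>r. \<forall>x. recf_eval r [x] = Some (f x))"

definition decidable :: "(nat \<Rightarrow> bool) \<Rightarrow> bool" where
  "decidable P \<longleftrightarrow> computable (\<lambda>x. of_bool (P x))"

named_theorems comp_intros

definition "r_add = PrimRec (Proj 0) (Comp Succ [Proj 0])"
definition "r_pred = PrimRec Zero (Proj 1)"
definition "r_sub = PrimRec (Proj 0) (Comp r_pred [Proj 0])"
definition "r_tri = PrimRec Zero (Comp r_add [Proj 0, Comp Succ [Proj 1]])"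
definition "r_pair = Comp r_add [Comp r_tri [Comp r_add [Proj 0, Proj 1]], Proj 0]"
text \<open>Inverts the Cantor pairing \<open>pr a b = triangle (a + b) + a\<close>: the sum
  \<open>a + b\<close> is the first \<open>k\<close> with \<open>pr a b < triangle (k + 1)\<close>,
  and both components follow from it by subtraction.\<close>

definition "r_root = Mu (Comp r_sub [Comp r_tri [Comp Succ [Proj 0]], Comp Succ [Proj 1]])"

lemma r_add: "recf_eval r_add [a, b] = Some (a + b)"
  unfolding r_add_def by (induction a) auto

lemma r_pred: "recf_eval r_pred [a] = Some (a - 1)"
  unfolding r_pred_def by (induction a) auto

lemma r_sub: "recf_eval r_sub [a, b] = Some (b - a)"
  unfolding r_sub_def by (induction a) (auto simp: r_pred)

lemma r_tri: "recf_eval r_tri [a] = Some (triangle a)"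
  unfolding r_tri_def by (induction a) (auto simp: r_add)

lemma r_pair: "recf_eval r_pair (a # b # xs) = Some (pr a b)"
  unfolding r_pair_def by (simp add: r_add r_tri prod_encode_def)

lemma triangle_mono: "a \<le> b \<Longrightarrow> triangle a \<le> triangle b"
  by (induction b) (auto simp: le_Suc_eq)

lemma r_root: "recf_eval r_root [pr a b] = Some (a + b)"
proof -
  let ?f = "Comp r_sub [Comp r_tri [Comp Succ [Proj 0]], Comp Succ [Proj 1]]"
  have ev: "recf_eval ?f [k, pr a b] = Some (Suc (pr a b) - triangle (Suc k))" for k
    by (simp add: r_sub r_tri)
  have zero: "recf_eval ?f [k, pr a b] = Some 0 \<longleftrightarrow> a + b \<le> k" for k
  proof (cases "a + b \<le> k")
    case True
    then have "triangle (Suc (a + b)) \<le> triangle (Suc k)" by (intro triangle_mono) auto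
    moreover have "Suc (pr a b) \<le> triangle (Suc (a + b))" by (simp add: prod_encode_def)
    ultimately show ?thesis using True unfolding ev by simp
  next
    case False
    then have "triangle (Suc k) \<le> triangle (a + b)" by (intro triangle_mono) auto
    moreover have "triangle (a + b) < Suc (pr a b)" by (simp add: prod_encode_def)
    ultimately show ?thesis using False unfolding ev by simp
  qed
  have "(LEAST n. recf_eval ?f [n, pr a b] = Some 0) = a + b"
    unfolding zero by (rule Least_equality) auto
  moreover have "\<exists>n. recf_eval ?f [n, pr a b] = Some 0 \<and>
      (\<forall>m<n. recf_eval ?f [m, pr a b] \<noteq> None)"
    by (rule exI[of _ "a + b"]) (metis zero ev option.distinct(1) order_refl)
  ultimately show ?thesis
    unfolding r_root_def recf_eval.simps(6) by (simp del: recf_eval.simps)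
qed

lemma computableI: "(\<And>x. recf_eval r [x] = Some (f x)) \<Longrightarrow> computable f"
  unfolding computable_def by blast

lemma computable_id [comp_intros]: "computable (\<lambda>x. x)"
  by (rule computableI[of "Proj 0"]) simp

lemma computable_comp: "computable f \<Longrightarrow> computable g \<Longrightarrow> computable (\<lambda>x. f (g x))"
  unfolding computable_def
proof (elim exE)
  fix r s assume "\<forall>x. recf_eval r [x] = Some (f x)" "\<forall>x. recf_eval s [x] = Some (g x)"
  then show "\<exists>r. \<forall>x. recf_eval r [x] = Some (f (g x))"
    by (intro exI[of _ "Comp r [s]"]) simp
qed

lemma computable_comp2:
  assumes "\<And>a b. recf_eval r [a, b] = Some (h a b)" "computable f" "computable g"
  shows "computable (\<lambda>x. h (f x) (g x))"
proof -
  obtain s t where "\<And>x. recf_eval s [x] = Some (f x)" "\<And>x. recf_eval t [x] = Some (g x)"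
    using assms unfolding computable_def by blast
  then show ?thesis using assms(1)
    by (intro computableI[of "Comp r [s, t]"]) simp
qed

lemma computable_Suc [comp_intros]: "computable f \<Longrightarrow> computable (\<lambda>x. Suc (f x))"
  by (rule computable_comp[of Suc]) (auto intro: computableI[of Succ])

lemma computable_const [comp_intros]: "computable (\<lambda>x. n)"
  by (induction n) (auto intro: computableI[of Zero] computable_Suc)

lemma computable_add [comp_intros]:
  "computable f \<Longrightarrow> computable g \<Longrightarrow> computable (\<lambda>x. f x + g x)"
  by (rule computable_comp2[OF r_add])

lemma computable_diff [comp_intros]:
  "computable f \<Longrightarrow> computable g \<Longrightarrow> computable (\<lambda>x. f x - g x)"
  by (rule computable_comp2[OF r_sub])

lemma computable_pair [comp_intros]:
  "computable f \<Longrightarrow> computable g \<Longrightarrow> computable (\<lambda>x. pr (f x) (g x))"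
  by (rule computable_comp2[OF r_pair])

lemma pair_cases: obtains a b where "z = pr a b"
  by (metis prod.collapse prod_decode_inverse)

lemma computable_root: "computable (\<lambda>z. fs z + sn z)"
proof (rule computableI[of r_root])
  fix x show "recf_eval r_root [x] = Some (fs x + sn x)"
    by (cases x rule: pair_cases) (simp add: r_root)
qed

lemma computable_triangle: "computable triangle"
  by (rule computableI[of r_tri]) (rule r_tri)

lemma computable_fs [comp_intros]: "computable f \<Longrightarrow> computable (\<lambda>x. fs (f x))"
proof (erule computable_comp[rotated])
  have "computable (\<lambda>z. z - triangle (fs z + sn z))"
    by (intro comp_intros computable_comp[OF computable_triangle] computable_root)
  moreover have "z - triangle (fs z + sn z) = fs z" for z
  proof (cases z rule: pair_cases)
    case (1 a b)
    have "pr a b - triangle (a + b) = a" by (simp add: prod_encode_def)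
    then show ?thesis by (simp add: 1)
  qed
  ultimately show "computable fs" by simp
qed

lemma computable_sn [comp_intros]: "computable f \<Longrightarrow> computable (\<lambda>x. sn (f x))"
proof (erule computable_comp[rotated])
  have "computable (\<lambda>z. (fs z + sn z) - fs z)"
    by (rule computable_diff[OF computable_root]) (intro comp_intros)
  then show "computable sn" by simp
qed

text \<open>As \<open>computable\<close> speaks of unary functions, the step takes a coded triple
  (counter, previous value, parameter). Arithmetic, bounded quantifiers and list access below are
  all brought into \<open>rec_nat\<close> form in order to apply this rule.\<close>

lemma computable_rec [comp_intros]:
  assumes "computable b" "computable n"
    "computable (\<lambda>z. s (fs z) (fs (sn z)) (sn (sn z)))"
  shows "computable (\<lambda>x. rec_nat (b x) (\<lambda>m y. s m y x) (n x))"
proof -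
  obtain rb rn rs where rb: "\<And>x. recf_eval rb [x] = Some (b x)"
    and rn: "\<And>x. recf_eval rn [x] = Some (n x)"
    and rs: "\<And>z. recf_eval rs [z] = Some (s (fs z) (fs (sn z)) (sn (sn z)))"
    using assms unfolding computable_def by blast
  let ?s = "Comp rs [Comp r_pair [Proj 1, Comp r_pair [Proj 0, Proj 2]]]"
  have "recf_eval (PrimRec rb ?s) [k, x] = Some (rec_nat (b x) (\<lambda>m y. s m y x) k)" for k x
    by (induction k) (simp_all add: rb rs r_pair)
  then show ?thesis
    by (intro computableI[of "Comp (PrimRec rb ?s) [rn, Proj 0]"]) (simp add: rn del: recf_eval.simps(5))
qed

lemma computable_mult [comp_intros]:
  assumes "computable f" "computable g" shows "computable (\<lambda>x. f x * g x)"
proof -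
  have "a * b = rec_nat 0 (\<lambda>m y. y + b) a" for a b :: nat by (induction a) auto
  then show ?thesis by (simp only:) (intro comp_intros assms computable_comp[OF assms(2)])
qed

lemma computable_power [comp_intros]:
  assumes "computable f" "computable g" shows "computable (\<lambda>x. f x ^ g x)"
proof -
  have "b ^ a = rec_nat 1 (\<lambda>m y. y * b) a" for a b :: nat by (induction a) auto
  then show ?thesis by (simp only:) (intro comp_intros assms computable_comp[OF assms(1)])
qed

lemma computable_of_bool_le:
  assumes "computable f" "computable g" shows "computable (\<lambda>x. of_bool (f x \<le> g x))"
proof -
  have "of_bool (a \<le> b) = 1 - (a - b)" for a b :: nat by auto
  then show ?thesis by (simp only:) (intro comp_intros assms)
qed

lemma decidable_le [comp_intros]:
  "computable f \<Longrightarrow> computable g \<Longrightarrow> decidable (\<lambda>x. f x \<le> g x)"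
  unfolding decidable_def by (rule computable_of_bool_le)

lemma decidable_not [comp_intros]: "decidable P \<Longrightarrow> decidable (\<lambda>x. \<not> P x)"
proof -
  have "of_bool (\<not> p) = 1 - (of_bool p :: nat)" for p by auto
  then show "decidable P \<Longrightarrow> ?thesis"
    unfolding decidable_def by (simp only:) (intro comp_intros)
qed

lemma decidable_conj [comp_intros]:
  "decidable P \<Longrightarrow> decidable Q \<Longrightarrow> decidable (\<lambda>x. P x \<and> Q x)"
proof -
  have "of_bool (p \<and> q) = of_bool p * (of_bool q :: nat)" for p q by auto
  then show "decidable P \<Longrightarrow> decidable Q \<Longrightarrow> ?thesis"
    unfolding decidable_def by (simp only:) (intro comp_intros)
qed

lemma decidable_cong: "decidable P \<Longrightarrow> (\<And>x. P x \<longleftrightarrow> Q x) \<Longrightarrow> decidable Q"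
  by (rule back_subst[of decidable P]) auto

lemma decidable_disj [comp_intros]:
  "decidable P \<Longrightarrow> decidable Q \<Longrightarrow> decidable (\<lambda>x. P x \<or> Q x)"
  by (rule decidable_cong[of "\<lambda>x. \<not> (\<not> P x \<and> \<not> Q x)"]) (intro comp_intros, auto)

lemma decidable_imp [comp_intros]:
  "decidable P \<Longrightarrow> decidable Q \<Longrightarrow> decidable (\<lambda>x. P x \<longrightarrow> Q x)"
  by (rule decidable_cong[of "\<lambda>x. \<not> P x \<or> Q x"]) (intro comp_intros, auto)

lemma decidable_const [comp_intros]: "decidable (\<lambda>x. b)"
  unfolding decidable_def by (intro comp_intros)

lemma decidable_less [comp_intros]:
  "computable f \<Longrightarrow> computable g \<Longrightarrow> decidable (\<lambda>x. f x < g x)"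
  by (rule decidable_cong[of "\<lambda>x. Suc (f x) \<le> g x"]) (intro comp_intros, auto)

lemma decidable_eq [comp_intros]:
  "computable f \<Longrightarrow> computable g \<Longrightarrow> decidable (\<lambda>x. f x = g x)"
  by (rule decidable_cong[of "\<lambda>x. f x \<le> g x \<and> g x \<le> f x"]) (intro comp_intros, auto)

lemma decidable_comp: "decidable P \<Longrightarrow> computable f \<Longrightarrow> decidable (\<lambda>x. P (f x))"
  unfolding decidable_def by (rule computable_comp)

lemma computable_if [comp_intros]:
  assumes "decidable P" "computable f" "computable g"
  shows "computable (\<lambda>x. if P x then f x else g x)"
proof -
  have "(if p then a else b) = of_bool p * a + (1 - of_bool p) * b" for p and a b :: nat by auto
  then show ?thesis using assms unfolding decidable_def by (simp only:) (intro comp_intros)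
qed

lemma decidable_all_less [comp_intros]:
  assumes "computable n" "decidable (\<lambda>z. P (fs z) (sn z))"
  shows "decidable (\<lambda>x. \<forall>i<n x. P i x)"
proof -
  have *: "of_bool (\<forall>i<k. P i x) = rec_nat (1 :: nat) (\<lambda>i y. if P i x then y else 0) k" for k x
    by (induction k) (auto simp: less_Suc_eq)
  \<comment> \<open>The step of the recursion sees (counter, previous value, parameter), so the
    parameter sits one pairing deeper than in the assumption.\<close>
  have "decidable (\<lambda>z. P (fs z) (sn (sn z)))"
  proof -
    have "decidable (\<lambda>z. P (fs (pr (fs z) (sn (sn z)))) (sn (pr (fs z) (sn (sn z)))))"
      by (rule decidable_comp[OF assms(2)]) (intro comp_intros)
    then show ?thesis by simp
  qed
  then show ?thesis unfolding decidable_def[of "\<lambda>x. \<forall>i<n x. P i x"] *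
    by (intro comp_intros assms)
qed

lemma decidable_ex_less [comp_intros]:
  assumes "computable n" "decidable (\<lambda>z. P (fs z) (sn z))"
  shows "decidable (\<lambda>x. \<exists>i<n x. P i x)"
  by (rule decidable_cong[of "\<lambda>x. \<not> (\<forall>i<n x. \<not> P i x)"]) (intro comp_intros assms, auto)

lemma decidable_finite:
  assumes "finite A" "computable f" shows "decidable (\<lambda>x. f x \<in> A)"
  using assms(1)
proof induction
  case (insert a A)
  show ?case
    by (rule decidable_cong[of "\<lambda>x. f x = a \<or> f x \<in> A"]) (intro comp_intros assms insert, auto)
qed (simp add: decidable_const)

lemma computable_mod [comp_intros]:
  assumes "computable f" "computable g" shows "computable (\<lambda>x. f x mod g x)"
proof -
  have "a mod b = rec_nat 0 (\<lambda>m y. if Suc y = b then 0 else Suc y) a" for a b :: nat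
    by (induction a) (auto simp: mod_Suc)
  then show ?thesis by (simp only:) (intro comp_intros assms computable_comp[OF assms(2)])
qed

lemma computable_div [comp_intros]:
  assumes "computable f" "computable g" shows "computable (\<lambda>x. f x div g x)"
proof -
  have "a div b = rec_nat 0 (\<lambda>m y. if Suc m mod b = 0 then Suc y else y) a" for a b :: nat
    by (induction a) (auto simp: div_Suc)
  then show ?thesis by (simp only:) (intro comp_intros assms computable_comp[OF assms(2)])
qed

lemma decidable_even [comp_intros]: "computable f \<Longrightarrow> decidable (\<lambda>x. even (f x))"
  unfolding even_iff_mod_2_eq_zero by (intro comp_intros)

lemma computable3_comp:
  assumes "computable3 h" "computable f" "computable g" "computable k"
  shows "computable (\<lambda>x. h (f x) (g x) (k x))"
proof -
  obtain r rf rg rk where "\<And>a b c. recf_eval r [a, b, c] = Some (h a b c)"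
    "\<And>x. recf_eval rf [x] = Some (f x)" "\<And>x. recf_eval rg [x] = Some (g x)"
    "\<And>x. recf_eval rk [x] = Some (k x)"
    using assms unfolding computable_def computable3_def by metis
  then show ?thesis by (intro computableI[of "Comp r [rf, rg, rk]"]) simp
qed

lemma computable3I:
  assumes "computable f" shows "computable3 (\<lambda>a b c. f (pr a (pr b c)))"
proof -
  obtain r where "\<And>x. recf_eval r [x] = Some (f x)" using assms unfolding computable_def by blast
  then have "recf_eval (Comp r [Comp r_pair [Proj 0, Comp r_pair [Proj 1, Proj 2]]]) [a, b, c]
      = Some (f (pr a (pr b c)))" for a b c
    by (simp add: r_pair)
  then show ?thesis unfolding computable3_def by blast
qed

subsection \<open>Coded lists\<close>

text \<open>A code is 0 for the empty list and \<open>Suc (pr x c)\<close> for a cons, so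
  \<open>sn (y - 1)\<close> is the tail. Since \<open>prod_decode 0 = (0, 0)\<close>, the code 0 is
  a fixed point, which makes 0 the test for having run off the end.\<close>

definition dropc :: "nat \<Rightarrow> nat \<Rightarrow> nat" where
  "dropc c i = rec_nat c (\<lambda>m y. sn (y - 1)) i"

definition nthc :: "nat \<Rightarrow> nat \<Rightarrow> nat" where
  "nthc c i = fs (dropc c i - 1)"

lemma computable_dropc [comp_intros]:
  assumes "computable f" "computable g" shows "computable (\<lambda>x. dropc (f x) (g x))"
  unfolding dropc_def by (intro comp_intros assms)

lemma computable_nthc [comp_intros]:
  assumes "computable f" "computable g" shows "computable (\<lambda>x. nthc (f x) (g x))"
  unfolding nthc_def by (intro comp_intros assms)

lemma prod_decode_0: "prod_decode 0 = (0, 0)"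
  by (simp add: prod_decode_def prod_decode_aux.simps)

lemma list_decode_tl: "list_decode (sn (c - 1)) = tl (list_decode c)"
  by (cases c) (simp_all add: prod_decode_0 split: prod.split)

lemma list_decode_dropc: "list_decode (dropc c i) = drop i (list_decode c)"
  unfolding dropc_def
proof (induction i)
  case (Suc i)
  then show ?case using list_decode_tl by (simp add: tl_drop drop_Suc)
qed simp

lemma list_decode_eq_Nil: "list_decode c = [] \<longleftrightarrow> c = 0"
  by (cases c) (simp_all split: prod.split)

lemma dropc_eq_0: "dropc c i = 0 \<longleftrightarrow> length (list_decode c) \<le> i"
  by (metis drop_eq_Nil list_decode_dropc list_decode_eq_Nil)

lemma fs_eq_hd: "c \<noteq> 0 \<Longrightarrow> fs (c - 1) = hd (list_decode c)"
  by (cases c) (simp_all split: prod.split)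

lemma nthc_eq: "i < length (list_decode c) \<Longrightarrow> nthc c i = list_decode c ! i"
  unfolding nthc_def using fs_eq_hd[of "dropc c i"] dropc_eq_0[of c i]
  by (simp add: list_decode_dropc hd_drop_conv_nth)

lemma length_list_decode_le: "length (list_decode c) \<le> c"
proof -
  have "length xs \<le> list_encode xs" for xs
  proof (induction xs)
    case (Cons x xs) then show ?case using le_prod_encode_2[of "list_encode xs" x] by simp
  qed simp
  from this[of "list_decode c"] show ?thesis by simp
qed

text \<open>Plays the role of Goedel's beta function: a quantifier over finite sequences becomes a
  quantifier over one number.\<close>

lemma ex_nthc: "\<exists>c. \<forall>i<n. nthc c i = f i"
  by (rule exI[of _ "list_encode (map f [0..<n])"]) (simp add: nthc_eq)

subsection \<open>Low levels of the arithmetical hierarchy\<close>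

text \<open>Projection along one existential number quantifier. Being generic in the class, the
  closure rules are proved once and then used for Sigma_1 (over \<open>decidable\<close>) and
  Sigma_2 (over \<open>pi1\<close>).\<close>

definition ex_class :: "((nat \<Rightarrow> bool) \<Rightarrow> bool) \<Rightarrow> (nat \<Rightarrow> bool) \<Rightarrow> bool" where
  "ex_class C P \<longleftrightarrow> (\<exists>Q. C Q \<and> (\<forall>x. P x \<longleftrightarrow> (\<exists>k. Q (pr x k))))"

definition admissible_class :: "((nat \<Rightarrow> bool) \<Rightarrow> bool) \<Rightarrow> bool" where
  "admissible_class C \<longleftrightarrow>
     (\<forall>P f. C P \<longrightarrow> computable f \<longrightarrow> C (\<lambda>x. P (f x))) \<and>
     (\<forall>P. decidable P \<longrightarrow> C P) \<and>
     (\<forall>P Q. C P \<longrightarrow> C Q \<longrightarrow> C (\<lambda>x. P x \<and> Q x)) \<and>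
     (\<forall>P n. C P \<longrightarrow> computable n \<longrightarrow> C (\<lambda>x. \<forall>i<n x. P (pr i x)))"

lemma admissible_decidable: "admissible_class decidable"
  unfolding admissible_class_def
proof (intro conjI allI impI)
  fix P n assume "decidable P" "computable n"
  then show "decidable (\<lambda>x. \<forall>i<n x. P (pr i x))"
    by (intro decidable_all_less) simp_all
qed (auto intro: decidable_comp decidable_conj)

context
  fixes C assumes C: "admissible_class C"
begin

lemma C_subst: "C P \<Longrightarrow> computable f \<Longrightarrow> C (\<lambda>x. P (f x))"
  and C_decidable: "decidable P \<Longrightarrow> C P"
  and C_conj: "C P \<Longrightarrow> C Q \<Longrightarrow> C (\<lambda>x. P x \<and> Q x)"
  and C_all: "C P \<Longrightarrow> computable n \<Longrightarrow> C (\<lambda>x. \<forall>i<n x. P (pr i x))"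
  using C unfolding admissible_class_def by blast+

lemma ex_class_base: assumes "C P" shows "ex_class C P"
proof -
  have "C (\<lambda>z. P (fs z))" by (rule C_subst[OF assms]) (intro comp_intros)
  then show ?thesis unfolding ex_class_def by (intro exI[of _ "\<lambda>z. P (fs z)"]) auto
qed

lemma ex_class_subst:
  assumes "ex_class C P" "computable f" shows "ex_class C (\<lambda>x. P (f x))"
proof -
  obtain Q where Q: "C Q" "\<And>x. P x \<longleftrightarrow> (\<exists>k. Q (pr x k))"
    using assms unfolding ex_class_def by blast
  have "C (\<lambda>z. Q (pr (f (fs z)) (sn z)))"
    by (rule C_subst[OF Q(1)]) (intro comp_intros computable_comp[OF assms(2)])
  then show ?thesis unfolding ex_class_def using Q(2)
    by (intro exI[of _ "\<lambda>z. Q (pr (f (fs z)) (sn z))"]) auto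
qed

lemma ex_class_ex:
  assumes "ex_class C (\<lambda>z. P (fs z) (sn z))" shows "ex_class C (\<lambda>x. \<exists>k. P k x)"
proof -
  obtain Q where Q: "C Q" "\<And>x. P (fs x) (sn x) \<longleftrightarrow> (\<exists>k. Q (pr x k))"
    using assms unfolding ex_class_def by blast
  let ?f = "\<lambda>z. pr (pr (fs (sn z)) (fs z)) (sn (sn z))"
  have "C (\<lambda>z. Q (?f z))" by (rule C_subst[OF Q(1)]) (intro comp_intros)
  moreover have "(\<exists>k. P k x) \<longleftrightarrow> (\<exists>k. Q (?f (pr x k)))" for x
  proof -
    have "P k x \<longleftrightarrow> (\<exists>l. Q (pr (pr k x) l))" for k using Q(2)[of "pr k x"] by simp
    then show ?thesis by (simp, metis fst_conv snd_conv prod_encode_inverse)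
  qed
  ultimately show ?thesis unfolding ex_class_def by blast
qed

lemma ex_class_conj:
  assumes "ex_class C P" "ex_class C P'" shows "ex_class C (\<lambda>x. P x \<and> P' x)"
proof -
  obtain Q Q' where Q: "C Q" "\<And>x. P x \<longleftrightarrow> (\<exists>k. Q (pr x k))"
    "C Q'" "\<And>x. P' x \<longleftrightarrow> (\<exists>k. Q' (pr x k))"
    using assms unfolding ex_class_def by blast
  let ?R = "\<lambda>z. Q (pr (fs z) (fs (sn z))) \<and> Q' (pr (fs z) (sn (sn z)))"
  have "C ?R" by (intro C_conj C_subst[OF Q(1)] C_subst[OF Q(3)] comp_intros)
  moreover have "P x \<and> P' x \<longleftrightarrow> (\<exists>k. ?R (pr x k))" for x
    unfolding Q(2) Q(4) by (simp, metis fst_conv snd_conv prod_encode_inverse)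
  ultimately show ?thesis unfolding ex_class_def by blast
qed

text \<open>The collection principle: the finitely many witnesses, one for each \<open>i\<close>,
  are packed into one list code, so that the existential quantifier moves in front of the bounded
  one.\<close>

lemma ex_class_all_less:
  assumes n: "computable n" and P: "ex_class C (\<lambda>z. P (fs z) (sn z))"
  shows "ex_class C (\<lambda>x. \<forall>i<n x. P i x)"
proof -
  obtain Q where Q: "C Q" "\<And>x. P (fs x) (sn x) \<longleftrightarrow> (\<exists>k. Q (pr x k))"
    using P unfolding ex_class_def by blast
  then have Q2: "P i x \<longleftrightarrow> (\<exists>k. Q (pr (pr i x) k))" for i x using Q(2)[of "pr i x"] by simp
  let ?f = "\<lambda>y. pr (pr (fs y) (fs (sn y))) (nthc (sn (sn y)) (fs y))"
  let ?R = "\<lambda>z. \<forall>i<n (fs z). Q (?f (pr i z))"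
  have "C (\<lambda>y. Q (?f y))" by (rule C_subst[OF Q(1)]) (intro comp_intros)
  then have "C ?R"
    by (rule C_all[where n = "\<lambda>z. n (fs z)"]) (intro comp_intros computable_comp[OF n])
  moreover have "(\<forall>i<n x. P i x) \<longleftrightarrow> (\<exists>k. ?R (pr x k))" for x
  proof
    assume "\<forall>i<n x. P i x"
    then obtain g where g: "\<And>i. i < n x \<Longrightarrow> Q (pr (pr i x) (g i))" unfolding Q2 by metis
    obtain c where "\<And>i. i < n x \<Longrightarrow> nthc c i = g i" using ex_nthc[of "n x" g] by blast
    with g show "\<exists>k. ?R (pr x k)" by (intro exI[of _ c]) simp
  next
    assume "\<exists>k. ?R (pr x k)" then show "\<forall>i<n x. P i x" unfolding Q2 by auto
  qed
  ultimately show ?thesis unfolding ex_class_def by blast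
qed

lemma ex_class_cong: "ex_class C P \<Longrightarrow> (\<And>x. P x \<longleftrightarrow> Q x) \<Longrightarrow> ex_class C Q"
  by (rule back_subst[of "ex_class C" P]) auto

end

abbreviation "sigma1 \<equiv> ex_class decidable"
definition "pi1 P \<longleftrightarrow> sigma1 (\<lambda>x. \<not> P x)"
abbreviation "sigma2 \<equiv> ex_class pi1"

lemmas sigma1_rules = ex_class_base[OF admissible_decidable] ex_class_ex[OF admissible_decidable]
  ex_class_conj[OF admissible_decidable] ex_class_all_less[OF admissible_decidable]
lemmas sigma1_subst = ex_class_subst[OF admissible_decidable]

lemma sigma1_disj:
  assumes "sigma1 P" "sigma1 P'" shows "sigma1 (\<lambda>x. P x \<or> P' x)"
proof -
  obtain Q Q' where Q: "decidable Q" "\<And>x. P x \<longleftrightarrow> (\<exists>k. Q (pr x k))"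
    "decidable Q'" "\<And>x. P' x \<longleftrightarrow> (\<exists>k. Q' (pr x k))"
    using assms unfolding ex_class_def by blast
  then show ?thesis
    unfolding ex_class_def by (intro exI[of _ "\<lambda>z. Q z \<or> Q' z"]) (auto intro: comp_intros)
qed

lemma admissible_pi1: "admissible_class pi1"
  unfolding admissible_class_def pi1_def
proof (intro conjI allI impI)
  fix P n assume "sigma1 (\<lambda>x. \<not> P x)" "computable n"
  then have "sigma1 (\<lambda>x. \<exists>i. i < n x \<and> \<not> P (pr i x))"
    by (intro sigma1_rules(2,3)) (auto intro!: sigma1_rules(1) comp_intros elim: computable_comp)
  then show "sigma1 (\<lambda>x. \<not> (\<forall>i<n x. P (pr i x)))" by simp
next
  fix P f assume "sigma1 (\<lambda>x. \<not> P x)" "computable f"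
  then show "sigma1 (\<lambda>x. \<not> P (f x))" by (rule sigma1_subst)
next
  fix P assume "decidable P"
  then show "sigma1 (\<lambda>x. \<not> P x)" by (intro sigma1_rules(1) decidable_not)
next
  fix P Q assume "sigma1 (\<lambda>x. \<not> P x)" "sigma1 (\<lambda>x. \<not> Q x)"
  then show "sigma1 (\<lambda>x. \<not> (P x \<and> Q x))" by (simp only: de_Morgan_conj) (rule sigma1_disj)
qed

lemmas sigma2_rules = ex_class_base[OF admissible_pi1] ex_class_ex[OF admissible_pi1]
  ex_class_conj[OF admissible_pi1] ex_class_all_less[OF admissible_pi1]

lemma pi1_decidable: "decidable P \<Longrightarrow> pi1 P"
  using admissible_pi1 unfolding admissible_class_def by blast

lemma sigma1_imp_sigma2: "sigma1 P \<Longrightarrow> sigma2 P"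
  unfolding ex_class_def using pi1_decidable by blast

text \<open>Unbounded search for a witness. The code \<open>r\<close> computes the negation of
  \<open>Q\<close> because \<open>Mu\<close> looks for the value 0.\<close>

lemma comp_enum_sigma1: assumes "sigma1 P" shows "comp_enum {n. P n}"
proof -
  obtain Q where Q: "decidable Q" "\<And>x. P x \<longleftrightarrow> (\<exists>k. Q (pr x k))"
    using assms unfolding ex_class_def by blast
  then obtain r where r: "\<And>x. recf_eval r [x] = Some (of_bool (\<not> Q x))"
    using decidable_not[OF Q(1)] unfolding decidable_def computable_def by blast
  let ?f = "Comp r [Comp r_pair [Proj 1, Proj 0]]"
  have "recf_eval ?f [k, x] = Some (of_bool (\<not> Q (pr x k)))" for k x by (simp add: r r_pair)
  then have "recf_eval (Mu ?f) [x] \<noteq> None \<longleftrightarrow> P x" for x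
    unfolding Q(2) recf_eval.simps(6) by (simp del: recf_eval.simps)
  then show ?thesis unfolding comp_enum_def by blast
qed

section \<open>Graphs of partial recursive functions are Sigma_1\<close>

abbreviation graph :: "recf \<Rightarrow> nat \<Rightarrow> bool" where
  "graph r \<equiv> \<lambda>z. recf_eval r (list_decode (fs z)) = Some (sn z)"

lemma list_decode_cases:
  obtains "c = 0" "list_decode c = []"
  | "c \<noteq> 0" "list_decode c = fs (c - 1) # list_decode (sn (c - 1))"
  by (cases c) (auto split: prod.split)

lemma those_graph_sigma1:
  assumes "\<And>g. g \<in> set gs \<Longrightarrow> sigma1 (graph g)"
  shows "sigma1 (\<lambda>z. those (map (\<lambda>g. recf_eval g (list_decode (fs z))) gs) = Some (list_decode (sn z)))"
  using assms
proof (induction gs)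
  case Nil
  have "those (map (\<lambda>g. recf_eval g (list_decode (fs z))) []) = Some (list_decode (sn z)) \<longleftrightarrow> sn z = 0" for z
    using list_decode_eq_Nil[of "sn z"] by auto
  then show ?case by (simp only:) (intro sigma1_rules(1) comp_intros)
next
  case (Cons g gs)
  let ?R = "\<lambda>z. those (map (\<lambda>g. recf_eval g (list_decode (fs z))) gs) = Some (list_decode (sn z))"
  have g: "sigma1 (graph g)" and R: "sigma1 ?R" using Cons by auto
  have "sigma1 (\<lambda>z. sn z \<noteq> 0 \<and> graph g (pr (fs z) (fs (sn z - 1))) \<and> ?R (pr (fs z) (sn (sn z - 1))))"
    by (intro sigma1_rules(3) sigma1_subst[OF g] sigma1_subst[OF R] sigma1_rules(1) comp_intros)
  then show ?case
  proof (rule ex_class_cong[OF admissible_decidable])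
    fix z
    show "(sn z \<noteq> 0 \<and> graph g (pr (fs z) (fs (sn z - 1))) \<and> ?R (pr (fs z) (sn (sn z - 1)))) \<longleftrightarrow>
      those (map (\<lambda>g. recf_eval g (list_decode (fs z))) (g # gs)) = Some (list_decode (sn z))"
      by (cases "sn z" rule: list_decode_cases) (auto split: option.split)
  qed
qed

text \<open>Structural induction replaces a universal machine. Each constructor needs a finite
  certificate: the list of inner values for \<open>Comp\<close>, the list of intermediate values for
  \<open>PrimRec\<close>, and a nonzero value at each smaller argument for
  \<open>Mu\<close>.\<close>

lemma graph_sigma1: "sigma1 (graph r)"
proof (induction r)
  case Zero
  show ?case
    by (rule ex_class_cong[OF admissible_decidable, of "\<lambda>z. 0 = sn z"])
      (intro sigma1_rules(1) comp_intros, simp)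
next
  case Succ
  have "graph Succ z \<longleftrightarrow> fs z \<noteq> 0 \<and> Suc (fs (fs z - 1)) = sn z" for z
    by (cases "fs z" rule: list_decode_cases) auto
  then show ?case by (simp only:) (intro sigma1_rules(1) comp_intros)
next
  case (Proj i)
  have "graph (Proj i) z \<longleftrightarrow> dropc (fs z) i \<noteq> 0 \<and> nthc (fs z) i = sn z" for z
    using dropc_eq_0[of "fs z" i] nthc_eq[of i "fs z"] by (auto split: if_splits)
  then show ?case by (simp only:) (intro sigma1_rules(1) comp_intros)
next
  case (Comp f gs)
  let ?R = "\<lambda>z. those (map (\<lambda>g. recf_eval g (list_decode (fs z))) gs) = Some (list_decode (sn z))"
  have "graph (Comp f gs) z \<longleftrightarrow> (\<exists>v. ?R (pr (fs z) v) \<and> graph f (pr v (sn z)))" for z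
  proof -
    have "graph (Comp f gs) z \<longleftrightarrow> (\<exists>xs. those (map (\<lambda>g. recf_eval g (list_decode (fs z))) gs) = Some xs \<and>
        recf_eval f xs = Some (sn z))"
      by (simp add: comp_def Option.bind_eq_Some_conv)
    also have "\<dots> \<longleftrightarrow> (\<exists>v. those (map (\<lambda>g. recf_eval g (list_decode (fs z))) gs) = Some (list_decode v) \<and>
        recf_eval f (list_decode v) = Some (sn z))"
      by (rule iffI; elim exE) (metis list_encode_inverse, blast)
    finally show ?thesis by (simp only: prod_encode_inverse fst_conv snd_conv)
  qed
  moreover have "sigma1 (\<lambda>z. \<exists>v. ?R (pr (fs z) v) \<and> graph f (pr v (sn z)))"
    by (intro sigma1_rules(2,3) sigma1_subst[OF Comp(1)] sigma1_subst[OF those_graph_sigma1[OF Comp(2)]]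
        comp_intros)
  ultimately show ?case by (simp only:)
next
  case (PrimRec f g)
  \<comment> \<open>Here \<open>s\<close> codes the values of the recursion at 0, ..., n; the nested
    \<open>Suc (pr ...)\<close> in \<open>?B\<close> is the code of the argument list (previous
    value, counter, parameters).\<close>
  let ?A = "\<lambda>z s. graph f (pr (sn (fs z - 1)) (nthc s 0))"
  let ?B = "\<lambda>z s m. graph g (pr (Suc (pr (nthc s m) (Suc (pr m (sn (fs z - 1)))))) (nthc s (Suc m)))"
  let ?R = "\<lambda>z. fs z \<noteq> 0 \<and> (\<exists>s. ?A z s \<and> (\<forall>m<fs (fs z - 1). ?B z s m) \<and> nthc s (fs (fs z - 1)) = sn z)"
  have "graph (PrimRec f g) z \<longleftrightarrow> ?R z" for z
  proof (cases "fs z" rule: list_decode_cases)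
    case 2
    define n ys where "n = fs (fs z - 1)" and "ys = sn (fs z - 1)"
    define h where "h = rec_nat (recf_eval f (list_decode ys))
            (\<lambda>m prev. Option.bind prev (\<lambda>y. recf_eval g (y # m # list_decode ys)))"
    have h0: "h 0 = recf_eval f (list_decode ys)"
      and hS: "h (Suc m) = Option.bind (h m) (\<lambda>y. recf_eval g (y # m # list_decode ys))" for m
      by (simp_all add: h_def)
    have "graph (PrimRec f g) z \<longleftrightarrow> h n = Some (sn z)" by (simp add: 2(2) h_def n_def ys_def)
    also have "\<dots> \<longleftrightarrow> (\<exists>s. h 0 = Some (nthc s 0) \<and>
       (\<forall>m<n. recf_eval g (nthc s m # m # list_decode ys) = Some (nthc s (Suc m))) \<and> nthc s n = sn z)"
    proof
      assume hn: "h n = Some (sn z)"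
      \<comment> \<open>Definedness propagates downwards from \<open>n\<close>, because a
        \<open>bind\<close> is undefined whenever its first argument is.\<close>
      have hN: "h (n - m) \<noteq> None" for m
      proof (induction m)
        case (Suc m)
        show ?case
        proof (cases "n - m")
          case 0 then show ?thesis using Suc by simp
        next
          case (Suc k) with \<open>h (n - m) \<noteq> None\<close> show ?thesis
            using hS[of k]
            by (metis Option.bind.simps(1) Suc_diff_Suc diff_Suc_Suc nat.inject zero_less_Suc zero_less_diff)
        qed
      qed (simp add: hn)
      have h_Some: "h m \<noteq> None" if "m \<le> n" for m
        using hN[of "n - m"] that by simp
      obtain s where s: "\<And>i. i < Suc n \<Longrightarrow> nthc s i = the (h i)"
        using ex_nthc[of "Suc n" "\<lambda>i. the (h i)"] by blast
      have hs: "h m = Some (nthc s m)" if "m \<le> n" for m using h_Some[OF that] s[of m] that by auto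
      have "recf_eval g (nthc s m # m # list_decode ys) = Some (nthc s (Suc m))" if "m < n" for m
        using hS[of m] hs[of m] hs[of "Suc m"] that by simp
      with hs[of 0] hs[of n] hn show "\<exists>s. h 0 = Some (nthc s 0) \<and>
       (\<forall>m<n. recf_eval g (nthc s m # m # list_decode ys) = Some (nthc s (Suc m))) \<and> nthc s n = sn z"
        by (intro exI[of _ s]) simp
    next
      assume "\<exists>s. h 0 = Some (nthc s 0) \<and>
       (\<forall>m<n. recf_eval g (nthc s m # m # list_decode ys) = Some (nthc s (Suc m))) \<and> nthc s n = sn z"
      then obtain s where s: "h 0 = Some (nthc s 0)" "nthc s n = sn z"
       "\<And>m. m < n \<Longrightarrow> recf_eval g (nthc s m # m # list_decode ys) = Some (nthc s (Suc m))"
        by blast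
      have "m \<le> n \<Longrightarrow> h m = Some (nthc s m)" for m
        by (induction m) (auto simp: s hS)
      then show "h n = Some (sn z)" using s by simp
    qed
    finally show ?thesis using 2(1) unfolding h0 by (simp add: n_def ys_def)
  qed simp
  moreover have "sigma1 ?R"
    by (intro sigma1_rules(2,3,4) comp_intros sigma1_subst[OF PrimRec(1)] sigma1_subst[OF PrimRec(2)]
        sigma1_rules(1))
  ultimately show ?case by (simp only:)
next
  case (Mu f)
  let ?R = "\<lambda>z. graph f (pr (Suc (pr (sn z) (fs z))) 0) \<and>
     (\<forall>m<sn z. \<exists>v. graph f (pr (Suc (pr m (fs z))) (Suc v)))"
  have "graph (Mu f) z \<longleftrightarrow> ?R z" for z
  proof -
    define h where "h m = recf_eval f (m # list_decode (fs z))" for m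
    have "graph (Mu f) z \<longleftrightarrow> h (sn z) = Some 0 \<and> (\<forall>m<sn z. \<exists>v. h m = Some (Suc v))"
    proof
      assume "graph (Mu f) z"
      then have ex: "\<exists>n. h n = Some 0 \<and> (\<forall>m<n. h m \<noteq> None)" and l: "sn z = (LEAST n. h n = Some 0)"
        by (auto simp: h_def split: if_splits)
      then obtain n where n: "h n = Some 0" "\<And>m. m < n \<Longrightarrow> h m \<noteq> None" by blast
      have "h (sn z) = Some 0" unfolding l by (rule LeastI[of _ n]) (rule n)
      moreover have "sn z \<le> n" unfolding l by (rule Least_le) (rule n)
      moreover have "h m \<noteq> Some 0" if "m < sn z" for m
        using that unfolding l by (rule not_less_Least)
      ultimately show "h (sn z) = Some 0 \<and> (\<forall>m<sn z. \<exists>v. h m = Some (Suc v))"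
        using n(2) by (metis less_le_trans not0_implies_Suc option.exhaust)
    next
      assume R: "h (sn z) = Some 0 \<and> (\<forall>m<sn z. \<exists>v. h m = Some (Suc v))"
      then have "(LEAST n. h n = Some 0) = sn z"
        by (intro Least_equality) (auto intro: leI)
      moreover have "\<exists>n. h n = Some 0 \<and> (\<forall>m<n. h m \<noteq> None)" using R by fastforce
      ultimately show "graph (Mu f) z" by (simp add: h_def)
    qed
    then show ?thesis by (simp add: h_def)
  qed
  moreover have "sigma1 ?R"
    by (intro sigma1_rules(2,3,4) comp_intros sigma1_subst[OF Mu])
  ultimately show ?case by (simp only:)
qed

lemma sigma1_comp_enum: assumes "comp_enum S" shows "sigma1 (\<lambda>n. n \<in> S)"
proof -
  obtain r where r: "S = {n. recf_eval r [n] \<noteq> None}" using assms unfolding comp_enum_def by blast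
  have "n \<in> S \<longleftrightarrow> (\<exists>y. graph r (pr (Suc (pr n 0)) y))" for n unfolding r by simp
  moreover have "sigma1 (\<lambda>n. \<exists>y. graph r (pr (Suc (pr n 0)) y))"
    by (intro sigma1_rules(2) sigma1_subst[OF graph_sigma1] comp_intros)
  ultimately show ?thesis by (simp only:)
qed

subsection \<open>Subadditive sequences\<close>

text \<open>Divide \<open>n\<close> by a fixed \<open>m\<close> at which the infimum is almost
  attained. The remainder contributes at most a constant \<open>C\<close>, which disappears after
  division by \<open>n\<close>.\<close>

lemma fekete:
  fixes a :: "nat \<Rightarrow> real"
  assumes nonneg: "\<And>n. 0 \<le> a n" and sub: "\<And>m n. a (m + n) \<le> a m + a n"
  shows "\<exists>L. (\<lambda>n. a n / real n) \<longlonglongrightarrow> L \<and> (\<forall>n\<ge>1. L \<le> a n / real n)"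
proof -
  define L where "L = (INF n\<in>{1..}. a n / real n)"
  have bdd: "bdd_below ((\<lambda>n. a n / real n) ` {1..})"
    by (rule bdd_belowI[of _ 0]) (auto simp: nonneg)
  have L: "L \<le> a n / real n" if "n \<ge> 1" for n
    unfolding L_def by (rule cINF_lower[OF bdd]) (use that in auto)
  have mult: "a (q * m + r) \<le> real q * a m + a r" for q m r
  proof (induction q)
    case (Suc q)
    have "a (Suc q * m + r) \<le> a m + a (q * m + r)" using sub[of m "q * m + r"] by (simp add: ac_simps)
    with Suc show ?case by (simp add: algebra_simps)
  qed simp
  have "(\<lambda>n. a n / real n) \<longlonglongrightarrow> L"
  proof (rule LIMSEQ_I)
    fix e :: real assume e: "e > 0"
    have "\<exists>m\<in>{1..}. a m / real m < L + e / 2"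
      using cINF_less_iff[OF _ bdd, of "L + e / 2"] e unfolding L_def by auto
    then obtain m where m: "m \<ge> 1" "a m / real m < L + e / 2" by auto
    define C where "C = Max (a ` {..<m})"
    have C: "a r \<le> C" if "r < m" for r unfolding C_def using that by (intro Max_ge) auto
    obtain n0 :: nat where n0: "real n0 > 2 * C / e" using reals_Archimedean2 by blast
    have "\<bar>a n / real n - L\<bar> < e" if n: "n \<ge> max 1 n0" for n
    proof -
      have npos: "real n > 0" using n by simp
      have "a n \<le> real (n div m) * a m + a (n mod m)" using mult[of "n div m" m "n mod m"] by simp
      also have "real (n div m) * a m = real (n div m * m) * (a m / real m)" using m by simp
      also have "\<dots> \<le> real n * (a m / real m)"
        by (intro mult_right_mono) (simp_all add: nonneg div_times_less_eq_dividend del: of_nat_mult)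
      also have "a (n mod m) \<le> C" using m by (intro C) simp
      finally have "a n / real n \<le> a m / real m + C / real n" using npos by (simp add: field_simps)
      moreover have "C / real n < e / 2"
      proof -
        have "2 * C / e < real n" using n0 n by linarith
        then show ?thesis using npos e by (simp add: field_simps)
      qed
      ultimately have "a n / real n < L + e" using m by linarith
      then show ?thesis using L[of n] n by auto
    qed
    then show "\<exists>no. \<forall>n\<ge>no. norm (a n / real n - L) < e" by (intro exI[of _ "max 1 n0"]) auto
  qed
  with L show ?thesis by blast
qed

subsection \<open>Configurations as total functions\<close>

definition conf :: "(int \<Rightarrow> nat) \<Rightarrow> (int \<rightharpoonup> nat)" where
  "conf f = (\<lambda>t. Some (f t))"

definition word :: "nat \<Rightarrow> (nat \<Rightarrow> nat) \<Rightarrow> (int \<rightharpoonup> nat)" where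
  "word n u = (\<lambda>t. if 0 \<le> t \<and> t < int n then Some (u (nat t)) else None)"

text \<open>Total counterpart of \<open>++\<close> with a word at the origin. What \<open>f\<close>
  does inside the window is overwritten, so members of extender sets can be represented by total
  functions.\<close>

definition glue :: "(int \<Rightarrow> nat) \<Rightarrow> nat \<Rightarrow> (nat \<Rightarrow> nat) \<Rightarrow> int \<Rightarrow> nat" where
  "glue f n u = (\<lambda>t. if 0 \<le> t \<and> t < int n then u (nat t) else f t)"

lemma maps_on_UNIV: "x \<in> maps_on A UNIV \<longleftrightarrow> (\<exists>f. x = conf f \<and> (\<forall>t. f t \<in> A))"
proof
  assume x: "x \<in> maps_on A UNIV"
  then have "x = conf (\<lambda>t. the (x t))"
    unfolding maps_on_def conf_def by (auto intro!: ext) (metis UNIV_I domIff option.collapse)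
  moreover have "the (x t) \<in> A" for t
    using x unfolding maps_on_def by (auto simp: ran_def)
      (metis (mono_tags, lifting) UNIV_I domIff mem_Collect_eq option.exhaust_sel subset_iff)
  ultimately show "\<exists>f. x = conf f \<and> (\<forall>t. f t \<in> A)" by blast
qed (auto simp: maps_on_def conf_def ran_def)

lemma dom_word: "dom (word n u) = {0..<int n}"
  by (auto simp: word_def dom_def)

lemma maps_on_interval:
  "w \<in> maps_on A {0..<int n} \<longleftrightarrow> (\<exists>u. w = word n u \<and> (\<forall>i<n. u i \<in> A))"
proof
  assume w: "w \<in> maps_on A {0..<int n}"
  then have d: "w t \<noteq> None \<longleftrightarrow> 0 \<le> t \<and> t < int n" for t
    unfolding maps_on_def by (metis (mono_tags, lifting) atLeastLessThan_iff domIff mem_Collect_eq)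
  have "w = word n (\<lambda>i. the (w (int i)))"
  proof
    fix t show "w t = word n (\<lambda>i. the (w (int i))) t"
      using d[of t] by (cases "w t") (auto simp: word_def)
  qed
  moreover have "the (w (int i)) \<in> A" if "i < n" for i
    using w d[of "int i"] that unfolding maps_on_def ran_def by auto
  ultimately show "\<exists>u. w = word n u \<and> (\<forall>i<n. u i \<in> A)"
    by (intro exI[of _ "\<lambda>i. the (w (int i))"]) simp
next
  assume "\<exists>u. w = word n u \<and> (\<forall>i<n. u i \<in> A)"
  then obtain u where u: "w = word n u" "\<forall>i<n. u i \<in> A" by blast
  have "ran w \<subseteq> A" unfolding u(1) ran_def word_def using u(2) by (auto split: if_splits)
  then show "w \<in> maps_on A {0..<int n}" unfolding maps_on_def by (simp add: u(1) dom_word)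
qed

lemma glue_inside [simp]: "i < n \<Longrightarrow> glue f n u (int i) = u i"
  by (simp add: glue_def)

lemma glue_cong: "(\<And>i. i < n \<Longrightarrow> u i = v i) \<Longrightarrow> glue f n u = glue f n v"
  unfolding glue_def by (auto simp: fun_eq_iff)

lemma glue_in: "(\<And>t. f t \<in> A) \<Longrightarrow> (\<And>i. i < n \<Longrightarrow> u i \<in> A) \<Longrightarrow> glue f n u t \<in> A"
  by (auto simp: glue_def)

lemma glue_self: "(\<And>i. i < n \<Longrightarrow> f (int i) = u i) \<Longrightarrow> glue f n u = f"
proof
  fix t assume *: "\<And>i. i < n \<Longrightarrow> f (int i) = u i"
  show "glue f n u t = f t" using *[of "nat t"] by (auto simp: glue_def)
qed

lemma appears_in_conf:
  "appears_in w (conf f) \<longleftrightarrow> (\<exists>t. \<forall>p\<in>dom w. w p = Some (f (p + t)))"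
  unfolding appears_in_def conf_def by (auto simp: eq_commute)

lemma subshift_of_conf:
  "conf f \<in> subshift_of A F \<longleftrightarrow> (\<forall>t. f t \<in> A) \<and> (\<forall>w\<in>F. \<not> appears_in w (conf f))"
proof -
  have "conf f \<in> maps_on A UNIV \<longleftrightarrow> (\<forall>t. f t \<in> A)"
    unfolding maps_on_UNIV by (auto simp: conf_def fun_eq_iff)
  then show ?thesis unfolding subshift_of_def by simp
qed

lemma subshift_of_shift:
  assumes "conf f \<in> subshift_of A F" shows "conf (\<lambda>t. f (t + s)) \<in> subshift_of A F"
proof -
  have "appears_in w (conf (\<lambda>t. f (t + s))) \<Longrightarrow> appears_in w (conf f)" for w
    unfolding appears_in_conf by (auto simp: add.assoc)
  then show ?thesis using assms unfolding subshift_of_conf by blast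
qed

locale nonempty_subshift =
  fixes A :: "nat set" and F X :: "(int \<rightharpoonup> nat) set"
  assumes finite_A: "finite A" and X_eq: "X = subshift_of A F" and X_nonempty: "X \<noteq> {}"
begin

lemma X_in: "conf f \<in> X \<Longrightarrow> f t \<in> A"
  unfolding X_eq subshift_of_conf by simp

lemma X_conf: "x \<in> X \<Longrightarrow> \<exists>f. x = conf f"
  unfolding X_eq subshift_of_def using maps_on_UNIV by blast

lemma X_shift: "conf f \<in> X \<Longrightarrow> conf (\<lambda>t. f (t + s)) \<in> X"
  unfolding X_eq by (rule subshift_of_shift)

lemma X_shift_iff: "conf (\<lambda>t. f (t + s)) \<in> X \<longleftrightarrow> conf f \<in> X"
  using X_shift[of f s] X_shift[of "\<lambda>t. f (t + s)" "- s"] by auto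

lemma A_nonempty: "A \<noteq> {}"
  using X_nonempty X_conf X_in by fastforce

lemma language_word:
  "word n u \<in> language A X n \<longleftrightarrow> (\<exists>f. conf f \<in> X \<and> (\<forall>i<n. f (int i) = u i))"
proof
  assume "word n u \<in> language A X n"
  then obtain x where "x \<in> X" "appears_in (word n u) x"
    unfolding language_def language_on_def by blast
  then obtain f where f: "conf f \<in> X" "appears_in (word n u) (conf f)" using X_conf by blast
  then obtain t where t: "\<And>p. 0 \<le> p \<Longrightarrow> p < int n \<Longrightarrow> word n u p = Some (f (p + t))"
    unfolding appears_in_conf dom_word by auto
  have "\<forall>i<n. f (int i + t) = u i"
    using t[of "int _"] by (auto simp: word_def)
  with X_shift[OF f(1), of t] show "\<exists>f. conf f \<in> X \<and> (\<forall>i<n. f (int i) = u i)"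
    by (intro exI[of _ "\<lambda>i. f (i + t)"]) simp
next
  assume "\<exists>f. conf f \<in> X \<and> (\<forall>i<n. f (int i) = u i)"
  then obtain f where f: "conf f \<in> X" "\<And>i. i < n \<Longrightarrow> f (int i) = u i" by blast
  have "appears_in (word n u) (conf f)"
    unfolding appears_in_conf dom_word using f(2)
    by (intro exI[of _ 0]) (auto simp: word_def, metis int_nat_eq nat_less_iff)
  moreover have "word n u \<in> maps_on A {0..<int n}"
    unfolding maps_on_interval using f X_in by (metis (no_types))
  ultimately show "word n u \<in> language A X n"
    unfolding language_def language_on_def using f(1) by blast
qed

lemma language_elim:
  assumes "w \<in> language A X n"
  obtains u f where "w = word n u" "conf f \<in> X" "\<And>i. i < n \<Longrightarrow> f (int i) = u i" "\<And>i. i < n \<Longrightarrow> u i \<in> A"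
proof -
  obtain u where "w = word n u" "\<forall>i<n. u i \<in> A"
    using assms maps_on_interval unfolding language_def language_on_def by blast
  with assms that show ?thesis using language_word by metis
qed

lemma finite_language: "finite (language A X n)"
proof (rule finite_subset)
  show "finite {w. dom w = {0..<int n} \<and> ran w \<subseteq> A}"
    by (rule finite_set_of_finite_maps) (simp_all add: finite_A)
qed (auto simp: language_def language_on_def maps_on_def)

lemma language_nonempty: "language A X n \<noteq> {}"
proof -
  obtain f where "conf f \<in> X" using X_nonempty X_conf by blast
  then have "word n (\<lambda>i. f (int i)) \<in> language A X n" unfolding language_word by blast
  then show ?thesis by blast
qed

definition E :: "nat \<Rightarrow> (nat \<Rightarrow> nat) \<Rightarrow> (int \<rightharpoonup> nat) set" where
  "E n u = extender_set A X (word n u)"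

lemma conf_add_word: "conf f ++ word n u = conf (glue f n u)"
  unfolding conf_def word_def glue_def map_add_def by (auto simp: fun_eq_iff)

lemma E_eq: "E n u = (\<lambda>f. conf f |` (- {0..<int n})) ` {f. (\<forall>t. f t \<in> A) \<and> conf (glue f n u) \<in> X}"
proof (intro set_eqI iffI)
  fix x assume "x \<in> E n u"
  then have x: "x \<in> maps_on A (- {0..<int n})" "x ++ word n u \<in> X"
    unfolding E_def extender_set_def dom_word by auto
  \<comment> \<open>An arbitrary symbol that fills the window, where \<open>glue\<close> hides
    it.\<close>
  obtain a where a: "a \<in> A" using A_nonempty by blast
  define f where "f = (\<lambda>t. case x t of None \<Rightarrow> a | Some b \<Rightarrow> b)"
  have fA: "f t \<in> A" for t
    using x(1) a unfolding f_def maps_on_def by (auto split: option.split simp: ran_def)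
  have xt: "x t \<noteq> None \<longleftrightarrow> t \<notin> {0..<int n}" for t
    using x(1) unfolding maps_on_def by (metis (mono_tags, lifting) Compl_iff domIff mem_Collect_eq)
  have xf: "x = conf f |` (- {0..<int n})"
  proof
    fix t show "x t = (conf f |` (- {0..<int n})) t"
      using xt[of t] by (cases "x t") (auto simp: conf_def f_def restrict_map_def)
  qed
  have "x ++ word n u = conf f ++ word n u"
    unfolding xf by (auto simp: fun_eq_iff map_add_def word_def restrict_map_def)
  with x(2) have "conf (glue f n u) \<in> X" by (simp add: conf_add_word)
  with fA xf show "x \<in> (\<lambda>f. conf f |` (- {0..<int n})) ` {f. (\<forall>t. f t \<in> A) \<and> conf (glue f n u) \<in> X}"
    by blast
next
  fix x assume "x \<in> (\<lambda>f. conf f |` (- {0..<int n})) ` {f. (\<forall>t. f t \<in> A) \<and> conf (glue f n u) \<in> X}"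
  then obtain f where f: "x = conf f |` (- {0..<int n})" "\<And>t. f t \<in> A" "conf (glue f n u) \<in> X" by blast
  have "x ++ word n u = conf f ++ word n u"
    unfolding f(1) by (auto simp: fun_eq_iff map_add_def word_def restrict_map_def)
  then have "x ++ word n u \<in> X" using f(3) by (simp add: conf_add_word)
  moreover have "x \<in> maps_on A (- {0..<int n})"
    unfolding maps_on_def f(1) using f(2) by (auto simp: conf_def ran_def restrict_map_def split: if_splits)
  ultimately show "x \<in> E n u" unfolding E_def extender_set_def dom_word by simp
qed

text \<open>Equality of extender sets becomes mutual exchangeability inside every context. All later
  arguments use this form and avoid partial maps.\<close>

lemma E_eq_iff:
  "E n u = E n v \<longleftrightarrow> (\<forall>f. (\<forall>t. f t \<in> A) \<longrightarrow> (conf (glue f n u) \<in> X \<longleftrightarrow> conf (glue f n v) \<in> X))"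
proof -
  have mem: "conf f |` (- {0..<int n}) \<in> E n u \<longleftrightarrow> conf (glue f n u) \<in> X" if "\<forall>t. f t \<in> A" for f u
  proof
    assume "conf f |` (- {0..<int n}) \<in> E n u"
    then obtain g where g: "conf f |` (- {0..<int n}) = conf g |` (- {0..<int n})" "conf (glue g n u) \<in> X"
      unfolding E_eq by blast
    have "f t = g t" if "t \<notin> {0..<int n}" for t
      using fun_cong[OF g(1), of t] that by (simp add: restrict_map_def conf_def)
    then have "glue f n u = glue g n u" unfolding glue_def by auto
    with g(2) show "conf (glue f n u) \<in> X" by simp
  qed (use that in \<open>auto simp: E_eq\<close>)
  show ?thesis
  proof
    assume "E n u = E n v" then show "\<forall>f. (\<forall>t. f t \<in> A) \<longrightarrow> (conf (glue f n u) \<in> X \<longleftrightarrow> conf (glue f n v) \<in> X)"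
      using mem by metis
  next
    assume "\<forall>f. (\<forall>t. f t \<in> A) \<longrightarrow> (conf (glue f n u) \<in> X \<longleftrightarrow> conf (glue f n v) \<in> X)"
    then show "E n u = E n v" unfolding E_eq by (intro arg_cong[where f = "image _"]) auto
  qed
qed

lemma E_eqD:
  "E n u = E n v \<Longrightarrow> (\<And>t. f t \<in> A) \<Longrightarrow> conf (glue f n u) \<in> X \<longleftrightarrow> conf (glue f n v) \<in> X"
  unfolding E_eq_iff by blast

definition occurs :: "nat \<Rightarrow> (nat \<Rightarrow> nat) \<Rightarrow> bool" where
  "occurs n u \<longleftrightarrow> (\<exists>f. conf f \<in> X \<and> (\<forall>i<n. f (int i) = u i))"

lemma occurs_in: "occurs n u \<Longrightarrow> i < n \<Longrightarrow> u i \<in> A"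
  unfolding occurs_def using X_in by metis

lemma extender_sets_eq: "extender_sets A X n = E n ` {u. occurs n u}"
proof -
  have "language A X n = word n ` {u. occurs n u}"
    using language_word unfolding occurs_def by (auto elim!: language_elim)
  then show ?thesis unfolding extender_sets_def E_def by auto
qed

abbreviation N :: "nat \<Rightarrow> nat" where "N n \<equiv> card (extender_sets A X n)"

lemma finite_extender_sets: "finite (extender_sets A X n)"
  unfolding extender_sets_def using finite_language by simp

lemma N_pos: "N n \<ge> 1"
  using finite_extender_sets[of n] language_nonempty[of n]
  unfolding extender_sets_def by (simp add: Suc_le_eq card_gt_0_iff)

lemma glue_split:
  fixes f :: "int \<Rightarrow> nat" shows
  "glue f (m + n) u = (\<lambda>t. glue (\<lambda>t. glue f m u (t + int m)) n (\<lambda>i. u (m + i)) (t - int m))"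
  "glue f (m + n) u = glue (\<lambda>t. glue (\<lambda>t. f (t + int m)) n (\<lambda>i. u (m + i)) (t - int m)) m u"
proof -
  have "m + nat (t - int m) = nat t" if "int m \<le> t" for t using that by simp
  then show "glue f (m + n) u = (\<lambda>t. glue (\<lambda>t. glue f m u (t + int m)) n (\<lambda>i. u (m + i)) (t - int m))"
    "glue f (m + n) u = glue (\<lambda>t. glue (\<lambda>t. f (t + int m)) n (\<lambda>i. u (m + i)) (t - int m)) m u"
    unfolding glue_def by (auto simp: fun_eq_iff)
qed

text \<open>A word may be exchanged for another one by first exchanging its left and then its right part.\<close>

lemma N_submult: "N (m + n) \<le> N m * N n"
proof -
  \<comment> \<open>The pair of extender sets of the two parts determines that of the whole word.
    The chosen representative need not occur in \<open>X\<close>, which is why \<open>cong\<close>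
    assumes only that its symbols lie in \<open>A\<close>.\<close>
  define g where "g = (\<lambda>(S, T). E (m + n) (SOME u. E m u = S \<and> E n (\<lambda>i. u (m + i)) = T \<and> (\<forall>i<m+n. u i \<in> A)))"
  have cong: "E (m + n) u = E (m + n) v"
    if E: "E m u = E m v" "E n (\<lambda>i. u (m + i)) = E n (\<lambda>i. v (m + i))"
      and u: "\<And>i. i < m + n \<Longrightarrow> u i \<in> A" and v: "\<And>i. i < m + n \<Longrightarrow> v i \<in> A" for u v
    unfolding E_eq_iff
  proof (intro allI impI)
    fix f :: "int \<Rightarrow> nat" assume f: "\<forall>t. f t \<in> A"
    \<comment> \<open>The intermediate word: left part of \<open>u\<close>, right part of
      \<open>v\<close>. \<open>glue_split\<close> presents it as a gluing of either part into the
      other one's context.\<close>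
    define u' where "u' i = (if i < m then u i else v i)" for i
    have "conf (glue f (m + n) u) \<in> X \<longleftrightarrow>
        conf (glue (\<lambda>t. glue f m u (t + int m)) n (\<lambda>i. u (m + i))) \<in> X"
      unfolding glue_split(1) using X_shift_iff[of _ "- int m"] by simp
    also have "\<dots> \<longleftrightarrow> conf (glue (\<lambda>t. glue f m u (t + int m)) n (\<lambda>i. v (m + i))) \<in> X"
      by (rule E_eqD[OF E(2)]) (use f u in \<open>auto intro!: glue_in\<close>)
    also have "glue (\<lambda>t. glue f m u (t + int m)) n (\<lambda>i. v (m + i)) =
        glue (\<lambda>t. glue f m u' (t + int m)) n (\<lambda>i. u' (m + i))"
      unfolding u'_def glue_def by (auto simp: fun_eq_iff)
    also have "conf \<dots> \<in> X \<longleftrightarrow> conf (glue f (m + n) u') \<in> X"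
      unfolding glue_split(1) using X_shift_iff[of _ "- int m"] by simp
    also have "glue f (m + n) u' = glue (\<lambda>t. glue (\<lambda>t. f (t + int m)) n (\<lambda>i. v (m + i)) (t - int m)) m u"
      unfolding glue_split(2) unfolding u'_def glue_def by (auto simp: fun_eq_iff)
    also have "conf \<dots> \<in> X \<longleftrightarrow>
        conf (glue (\<lambda>t. glue (\<lambda>t. f (t + int m)) n (\<lambda>i. v (m + i)) (t - int m)) m v) \<in> X"
      by (rule E_eqD[OF E(1)]) (use f v in \<open>auto intro!: glue_in\<close>)
    also have "\<dots> \<longleftrightarrow> conf (glue f (m + n) v) \<in> X" unfolding glue_split(2) ..
    finally show "conf (glue f (m + n) u) \<in> X \<longleftrightarrow> conf (glue f (m + n) v) \<in> X" .
  qed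
  have "extender_sets A X (m + n) \<subseteq> g ` (extender_sets A X m \<times> extender_sets A X n)"
  proof
    fix Z assume "Z \<in> extender_sets A X (m + n)"
    then obtain u where u: "occurs (m + n) u" "Z = E (m + n) u" unfolding extender_sets_eq by blast
    obtain f where f: "conf f \<in> X" "\<And>i. i < m + n \<Longrightarrow> f (int i) = u i"
      using u(1) unfolding occurs_def by blast
    have uA: "\<And>i. i < m + n \<Longrightarrow> u i \<in> A" using u(1) occurs_in by blast
    have "occurs m u" unfolding occurs_def using f by (intro exI[of _ f]) simp
    moreover have "occurs n (\<lambda>i. u (m + i))"
      unfolding occurs_def using X_shift[OF f(1), of "int m"] f(2)
      by (intro exI[of _ "\<lambda>t. f (t + int m)"]) (auto simp: add.commute simp flip: of_nat_add)
    moreover have "g (E m u, E n (\<lambda>i. u (m + i))) = Z"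
    proof -
      let ?P = "\<lambda>v. E m v = E m u \<and> E n (\<lambda>i. v (m + i)) = E n (\<lambda>i. u (m + i)) \<and> (\<forall>i<m+n. v i \<in> A)"
      have "?P (SOME v. ?P v)" by (rule someI[of ?P u]) (use uA in auto)
      then show ?thesis unfolding g_def u(2) prod.case using uA by (intro cong) auto
    qed
    ultimately show "Z \<in> g ` (extender_sets A X m \<times> extender_sets A X n)"
      unfolding extender_sets_eq by blast
  qed
  then have "N (m + n) \<le> card (extender_sets A X m \<times> extender_sets A X n)"
    using finite_extender_sets by (intro surj_card_le) auto
  then show ?thesis by (simp add: card_cartesian_product)
qed

lemma entropy_limit:
  "(\<lambda>n. log 2 (real (N n)) / real n) \<longlonglongrightarrow> extender_entropy A X"
  and entropy_le: "n \<ge> 1 \<Longrightarrow> extender_entropy A X \<le> log 2 (real (N n)) / real n"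
proof -
  have "\<exists>L. (\<lambda>n. log 2 (real (N n)) / real n) \<longlonglongrightarrow> L \<and> (\<forall>n\<ge>1. L \<le> log 2 (real (N n)) / real n)"
  proof (rule fekete)
    fix m n
    have "real (N (m + n)) \<le> real (N m) * real (N n)" using N_submult[of m n] by (simp flip: of_nat_mult)
    then have "log 2 (real (N (m + n))) \<le> log 2 (real (N m) * real (N n))"
      using N_pos[of "m + n"] by simp
    also have "\<dots> = log 2 (real (N m)) + log 2 (real (N n))"
      using N_pos[of m] N_pos[of n] by (intro log_mult_pos) auto
    finally show "log 2 (real (N (m + n))) \<le> log 2 (real (N m)) + log 2 (real (N n))" .
  next
    fix n show "0 \<le> log 2 (real (N n))" using N_pos[of n] by simp
  qed
  then obtain L where L: "(\<lambda>n. log 2 (real (N n)) / real n) \<longlonglongrightarrow> L"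
    "\<And>n. n\<ge>1 \<Longrightarrow> L \<le> log 2 (real (N n)) / real n" by blast
  have "extender_entropy A X = L" unfolding extender_entropy_def by (rule limI[OF L(1)])
  with L show "(\<lambda>n. log 2 (real (N n)) / real n) \<longlonglongrightarrow> extender_entropy A X"
    "n \<ge> 1 \<Longrightarrow> extender_entropy A X \<le> log 2 (real (N n)) / real n" by auto
qed

lemma entropy_nonneg: "0 \<le> extender_entropy A X"
proof (rule LIMSEQ_le_const[OF entropy_limit], intro exI allI impI)
  fix n show "0 \<le> log 2 (real (N n)) / real n" using N_pos[of n] by simp
qed

end

subsection \<open>Coding words and patterns by numbers\<close>

text \<open>Words of length \<open>n\<close> are coded by the numbers below \<open>a ^ n\<close>, so
  that quantifiers over them are bounded.\<close>

definition digit :: "nat \<Rightarrow> nat \<Rightarrow> nat \<Rightarrow> nat" where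
  "digit a y t = (y div a ^ t) mod a"

lemma computable_digit [comp_intros]:
  assumes "computable y" "computable t" shows "computable (\<lambda>x. digit a (y x) (t x))"
  unfolding digit_def by (intro comp_intros assms)

lemma ex_digits:
  assumes "\<And>t. t < N \<Longrightarrow> f t < a"
  shows "\<exists>y<a ^ N. \<forall>t<N. digit a y t = f t"
  using assms
proof (induction N arbitrary: f)
  case (Suc N)
  have "\<exists>y<a ^ N. \<forall>t<N. digit a y t = f (Suc t)" by (rule Suc.IH) (simp add: Suc.prems)
  then obtain y where y: "y < a ^ N" "\<And>t. t < N \<Longrightarrow> digit a y t = f (Suc t)" by blast
  have f0: "f 0 < a" using Suc.prems by simp
  have "digit a (f 0 + a * y) t = f t" if "t < Suc N" for t
  proof (cases t)
    case 0 then show ?thesis using f0 by (simp add: digit_def)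
  next
    case (Suc s)
    have "(f 0 + a * y) div a ^ Suc s = y div a ^ s"
      using f0 by (simp add: div_mult2_eq)
    then show ?thesis using y(2)[of s] Suc that by (simp add: digit_def)
  qed
  moreover have "f 0 + a * y < a ^ Suc N"
  proof -
    have "f 0 + a * y < a * Suc y" using f0 by simp
    also have "\<dots> \<le> a * a ^ N" using y(1) by (intro mult_le_mono2) simp
    finally show ?thesis by simp
  qed
  ultimately show ?case by blast
qed simp

text \<open>Positive and negative part of the integer coded by \<open>p\<close>; comparisons of
  integers turn into comparisons of sums of natural numbers.\<close>

definition ppos :: "nat \<Rightarrow> nat" where "ppos p = (if even p then p div 2 else 0)"
definition pneg :: "nat \<Rightarrow> nat" where "pneg p = (if even p then 0 else Suc (p div 2))"

lemma int_decode_ppos_pneg: "int_decode p = int (ppos p) - int (pneg p)"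
  by (simp add: int_decode_def sum_decode_def ppos_def pneg_def)

lemma computable_ppos [comp_intros]: "computable f \<Longrightarrow> computable (\<lambda>x. ppos (f x))"
  unfolding ppos_def by (intro comp_intros)

lemma computable_pneg [comp_intros]: "computable f \<Longrightarrow> computable (\<lambda>x. pneg (f x))"
  unfolding pneg_def by (intro comp_intros)

lemma pattern_decode_list_encode:
  "pattern_decode (list_encode (map (\<lambda>(p, b). pr (int_encode p) b) xs)) = map_of xs"
  unfolding pattern_decode_def by (simp add: comp_def case_prod_beta map_idI)

text \<open>In a code, later entries for the same position are shadowed by earlier ones.  Codes without
  conflicting entries exist, so that \<open>fits\<close> below may insist on all entries.\<close>

lemma ex_pattern_code:
  assumes "finite (dom w)"
  shows "\<exists>m. pattern_decode m = w \<and>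
     (\<forall>i<length (list_decode m). w (int_decode (fs (list_decode m ! i))) = Some (sn (list_decode m ! i)))"
proof -
  have "\<exists>xs. map_of xs = w \<and> (\<forall>(p, b)\<in>set xs. w p = Some b)" using assms
  proof (induction rule: finite_Map_induct)
    case (update k v m)
    then obtain xs where "map_of xs = m" "\<forall>(p, b)\<in>set xs. m p = Some b" by blast
    with update(2) have "map_of ((k, v) # xs) = m(k \<mapsto> v)"
      "\<And>p b. (p, b) \<in> set ((k, v) # xs) \<Longrightarrow> (m(k \<mapsto> v)) p = Some b"
      by auto
    then show ?case by blast
  qed (auto intro: exI[of _ "[]"])
  then obtain xs where xs: "map_of xs = w" "\<And>p b. (p, b) \<in> set xs \<Longrightarrow> w p = Some b" by blast
  show ?thesis
  proof (intro exI conjI allI impI)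
    show "pattern_decode (list_encode (map (\<lambda>(p, b). pr (int_encode p) b) xs)) = w"
      by (simp add: pattern_decode_list_encode xs)
  next
    fix i assume "i < length (list_decode (list_encode (map (\<lambda>(p, b). pr (int_encode p) b) xs)))"
    then have i: "i < length xs" by simp
    with xs(2)[of "fst (xs ! i)" "snd (xs ! i)"] nth_mem[OF i]
    show "w (int_decode (fs (list_decode (list_encode (map (\<lambda>(p, b). pr (int_encode p) b) xs)) ! i))) =
       Some (sn (list_decode (list_encode (map (\<lambda>(p, b). pr (int_encode p) b) xs)) ! i))"
      by (simp add: case_prod_beta)
  qed
qed

text \<open>The shift is the integer \<open>fs s - sn s\<close>. The first inequality says that the
  shifted position is nonnegative, so that the truncated subtractions after it are exact.\<close>

definition fits :: "nat \<Rightarrow> nat \<Rightarrow> nat \<Rightarrow> nat \<Rightarrow> nat \<Rightarrow> bool" where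
  "fits a m s n y \<longleftrightarrow> (\<forall>i<m. dropc m i \<noteq> 0 \<longrightarrow>
     pneg (fs (nthc m i)) + sn s \<le> ppos (fs (nthc m i)) + fs s \<and>
     ppos (fs (nthc m i)) + fs s - (pneg (fs (nthc m i)) + sn s) < n \<and>
     digit a y (ppos (fs (nthc m i)) + fs s - (pneg (fs (nthc m i)) + sn s)) = sn (nthc m i))"

lemma decidable_fits:
  assumes "computable m" "computable s" "computable n" "computable y"
  shows "decidable (\<lambda>x. fits a (m x) (s x) (n x) (y x))"
  unfolding fits_def
  by (intro comp_intros assms computable_comp[OF assms(1)] computable_comp[OF assms(2)]
      computable_comp[OF assms(3)] computable_comp[OF assms(4)])

lemma fits_iff:
  "fits a m s n y \<longleftrightarrow> (\<forall>i<length (list_decode m).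
     let p = int_decode (fs (list_decode m ! i)) + (int (fs s) - int (sn s))
     in 0 \<le> p \<and> p < int n \<and> digit a y (nat p) = sn (list_decode m ! i))"
proof -
  have *: "(pneg q + t \<le> ppos q + s \<and> ppos q + s - (pneg q + t) < n \<and>
       digit a y (ppos q + s - (pneg q + t)) = b) \<longleftrightarrow>
     (let p = int_decode q + (int s - int t) in 0 \<le> p \<and> p < int n \<and> digit a y (nat p) = b)" for q s t b
  proof (cases "pneg q + t \<le> ppos q + s")
    case True
    then have "int_decode q + (int s - int t) = int (ppos q + s - (pneg q + t))"
      unfolding int_decode_ppos_pneg by simp
    then show ?thesis using True by (simp only: Let_def nat_int of_nat_0_le_iff of_nat_less_iff simp_thms)
  next
    case False then show ?thesis unfolding int_decode_ppos_pneg by (simp add: Let_def)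
  qed
  show ?thesis
    unfolding fits_def * dropc_eq_0 using length_list_decode_le[of m]
    by (auto simp: nthc_eq not_le)
qed

subsection \<open>Compactness\<close>

text \<open>Diagonal subsequence over an enumeration of the positions: the \<open>n\<close>-th
  thinning makes the symbol at \<open>int_decode n\<close> constant. The conclusion asks for
  agreement at arbitrarily large \<open>L\<close>, since the maps \<open>g L\<close> are going to be
  meaningful only on windows that grow with \<open>L\<close>.\<close>

lemma int_compactness:
  fixes g :: "nat \<Rightarrow> int \<Rightarrow> nat"
  assumes A: "finite A" and g: "\<And>L t. g L t \<in> A"
  shows "\<exists>f. (\<forall>t. f t \<in> A) \<and> (\<forall>T B. finite T \<longrightarrow> (\<exists>L\<ge>B. \<forall>t\<in>T. g L t = f t))"
proof -
  define P where "P n s \<longleftrightarrow> (\<exists>c\<in>A. \<forall>k. g (s k) (int_decode n) = c)" for n and s :: "nat \<Rightarrow> nat"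
  interpret subseqs P
  proof (unfold_locales, unfold o_def)
    fix n and s :: "nat \<Rightarrow> nat" assume s: "strict_mono s"
    have "\<exists>c\<in>A. infinite {k \<in> (UNIV :: nat set). g (s k) (int_decode n) = c}"
      by (rule pigeonhole_infinite_rel) (use A g in auto)
    then obtain c where c: "c \<in> A" "infinite {k. g (s k) (int_decode n) = c}" by auto
    then obtain r :: "nat \<Rightarrow> nat" where "strict_mono r" "\<forall>k. g (s (r k)) (int_decode n) = c"
      using infinite_enumerate[OF c(2)] by auto
    with c(1) show "\<exists>r :: nat \<Rightarrow> nat. strict_mono r \<and> P n (\<lambda>k. s (r k))"
      unfolding P_def by (intro exI[of _ r]) auto
  qed
  have "P n (diagseq \<circ> (+) (Suc n))" for n
    by (rule diagseq_holds) (auto simp: comp_def P_def)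
  then obtain c where c: "\<And>n. c n \<in> A" "\<And>n k. g (diagseq (Suc n + k)) (int_decode n) = c n"
    unfolding comp_def P_def by metis
  show ?thesis
  proof (rule exI[of _ "\<lambda>t. c (int_encode t)"], intro conjI allI impI)
    fix t show "c (int_encode t) \<in> A" by (rule c)
  next
    fix T :: "int set" and B :: nat assume T: "finite T"
    \<comment> \<open>Beyond every code of a position in \<open>T\<close>, so that the diagonal
      sequence has stabilised on all of \<open>T\<close>, and large enough to exceed
      \<open>B\<close>.\<close>
    define m where "m = B + Suc (\<Sum>t\<in>T. int_encode t)"
    have "g (diagseq m) t = c (int_encode t)" if "t \<in> T" for t
    proof -
      have "int_encode t \<le> (\<Sum>t\<in>T. int_encode t)" using T that by (intro member_le_sum) auto
      then have "m = Suc (int_encode t) + (m - Suc (int_encode t))" unfolding m_def by simp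
      then show ?thesis using c(2)[of "int_encode t" "m - Suc (int_encode t)"] by simp
    qed
    moreover have "B \<le> diagseq m" using seq_suble[OF subseq_diagseq, of m] unfolding m_def by linarith
    ultimately show "\<exists>L\<ge>B. \<forall>t\<in>T. g L t = c (int_encode t)" by blast
  qed
qed

subsection \<open>Extender entropies of effective subshifts\<close>

locale effective = nonempty_subshift +
  assumes F_patterns: "F \<subseteq> patterns A" and F_ce: "comp_enum_patterns F"
begin

lemma finite_dom_F: "w \<in> F \<Longrightarrow> finite (dom w)"
  using F_patterns unfolding patterns_def maps_on_def by auto

text \<open>The finite trace of not belonging to \<open>X\<close>: a forbidden pattern lies entirely
  in the window. It depends on finitely many symbols and can be enumerated.\<close>

definition kills :: "nat \<Rightarrow> (nat \<Rightarrow> nat) \<Rightarrow> bool" where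
  "kills n g \<longleftrightarrow> (\<exists>w\<in>F. \<exists>s. \<forall>p\<in>dom w. 0 \<le> p + s \<and> p + s < int n \<and> w p = Some (g (nat (p + s))))"

lemma killsE:
  assumes "kills n g"
  obtains w s where "w \<in> F"
    "\<forall>p\<in>dom w. 0 \<le> p + s \<and> p + s < int n \<and> w p = Some (g (nat (p + s)))"
  using assms unfolding kills_def by blast

lemma kills_cong: "(\<And>i. i < n \<Longrightarrow> g i = h i) \<Longrightarrow> kills n g = kills n h"
proof -
  have "kills n h" if gh: "kills n g" "\<And>i. i < n \<Longrightarrow> g i = h i" for g h
  proof -
    obtain w s where w: "w \<in> F"
      "\<forall>p\<in>dom w. 0 \<le> p + s \<and> p + s < int n \<and> w p = Some (g (nat (p + s)))"
      using gh(1) by (rule killsE)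
    have "\<forall>p\<in>dom w. 0 \<le> p + s \<and> p + s < int n \<and> w p = Some (h (nat (p + s)))"
    proof
      fix p assume "p \<in> dom w"
      note * = bspec[OF w(2) this]
      from * have "g (nat (p + s)) = h (nat (p + s))" by (intro gh(2)) linarith
      with * show "0 \<le> p + s \<and> p + s < int n \<and> w p = Some (h (nat (p + s)))" by simp
    qed
    then show ?thesis using w(1) unfolding kills_def by blast
  qed
  from this[of g h] this[of h g] show "(\<And>i. i < n \<Longrightarrow> g i = h i) \<Longrightarrow> ?thesis" by auto
qed

lemma kills_window:
  assumes "kills n (\<lambda>i. f (int i + s))" shows "conf f \<notin> X"
proof -
  obtain w t where w: "w \<in> F"
    "\<forall>p\<in>dom w. 0 \<le> p + t \<and> p + t < int n \<and> w p = Some (f (int (nat (p + t)) + s))"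
    using assms by (rule killsE)
  have "appears_in w (conf f)" unfolding appears_in_conf
  proof (intro exI[of _ "t + s"] ballI)
    fix p assume "p \<in> dom w"
    from bspec[OF w(2) this] show "w p = Some (f (p + (t + s)))" by (simp add: add.assoc)
  qed
  then show ?thesis using w(1) unfolding X_eq subshift_of_conf by blast
qed

lemma not_in_X_kills:
  assumes "\<And>t. f t \<in> A" "conf f \<notin> X"
  shows "\<exists>M0. \<forall>M\<ge>M0. \<forall>n. kills (2 * M + n) (\<lambda>i. f (int i - int M))"
proof -
  obtain w where w: "w \<in> F" "appears_in w (conf f)" using assms unfolding X_eq subshift_of_conf by blast
  then obtain s where s: "\<And>p. p \<in> dom w \<Longrightarrow> w p = Some (f (p + s))" unfolding appears_in_conf by blast
  \<comment> \<open>The sum over the finite support bounds the distance from the origin of every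
    cell of this occurrence.\<close>
  define M0 where "M0 = Suc (\<Sum>p\<in>dom w. nat \<bar>p + s\<bar>)"
  have M0: "\<bar>p + s\<bar> < int M0" if "p \<in> dom w" for p
  proof -
    have "nat \<bar>p + s\<bar> \<le> (\<Sum>p\<in>dom w. nat \<bar>p + s\<bar>)"
      using that finite_dom_F[OF w(1)] by (intro member_le_sum) auto
    then show ?thesis unfolding M0_def by linarith
  qed
  have "kills (2 * M + n) (\<lambda>i. f (int i - int M))" if "M \<ge> M0" for M n
    unfolding kills_def
  proof (intro bexI[OF _ w(1)] exI[of _ "s + int M"] ballI)
    fix p assume p: "p \<in> dom w"
    have "0 \<le> p + (s + int M)" "p + (s + int M) < int (2 * M + n)" using M0[OF p] that by linarith+
    then show "0 \<le> p + (s + int M) \<and> p + (s + int M) < int (2 * M + n) \<and>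
        w p = Some (f (int (nat (p + (s + int M))) - int M))"
      using s[OF p] by (simp add: algebra_simps)
  qed
  then show ?thesis by blast
qed

text \<open>Compactness makes the occurrence of a word a \<open>pi1\<close> property.\<close>

lemma occurs_iff:
  "occurs n u \<longleftrightarrow> (\<forall>L. \<exists>v. (\<forall>t<2*L+n. v t \<in> A) \<and> (\<forall>t<n. v (L + t) = u t) \<and> \<not> kills (2*L+n) v)"
proof
  assume "occurs n u"
  then obtain f where f: "conf f \<in> X" "\<And>i. i < n \<Longrightarrow> f (int i) = u i" unfolding occurs_def by blast
  show "\<forall>L. \<exists>v. (\<forall>t<2*L+n. v t \<in> A) \<and> (\<forall>t<n. v (L + t) = u t) \<and> \<not> kills (2*L+n) v"
  proof
    fix L show "\<exists>v. (\<forall>t<2*L+n. v t \<in> A) \<and> (\<forall>t<n. v (L + t) = u t) \<and> \<not> kills (2*L+n) v"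
      using f X_in[OF f(1)] kills_window[of "2*L+n" f "- int L"]
      by (intro exI[of _ "\<lambda>i. f (int i + - int L)"]) auto
  qed
next
  assume "\<forall>L. \<exists>v. (\<forall>t<2*L+n. v t \<in> A) \<and> (\<forall>t<n. v (L + t) = u t) \<and> \<not> kills (2*L+n) v"
  from choice[OF this] obtain v where v: "\<And>L t. t < 2*L+n \<Longrightarrow> v L t \<in> A" "\<And>L t. t < n \<Longrightarrow> v L (L + t) = u t"
    "\<And>L. \<not> kills (2*L+n) (v L)" by blast
  obtain a where a: "a \<in> A" using A_nonempty by blast
  \<comment> \<open>The \<open>L\<close>-th word is centred so that \<open>u\<close> starts at 0,
    and is padded by a dummy symbol outside its window.\<close>
  define g where "g L t = (if - int L \<le> t \<and> t < int (L + n) then v L (nat (t + int L)) else a)" for L t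
  have "g L t \<in> A" for L t
    using v(1)[of "nat (t + int L)" L] a unfolding g_def by auto
  from int_compactness[OF finite_A this] obtain f where
    f0: "(\<forall>t. f t \<in> A) \<and> (\<forall>T B. finite T \<longrightarrow> (\<exists>L\<ge>B. \<forall>t\<in>T. g L t = f t))" by (rule exE)
  have fA: "f t \<in> A" for t using f0 by simp
  have f: "\<exists>L\<ge>B. \<forall>t\<in>T. g L t = f t" if "finite T" for T B using f0 that by simp
  have "conf f \<in> X"
  proof (rule ccontr)
    assume "conf f \<notin> X"
    then obtain M where M: "kills (2 * M + n) (\<lambda>i. f (int i - int M))"
      using not_in_X_kills[of f, OF fA] by blast
    \<comment> \<open>With \<open>L \<ge> M\<close> the window of radius \<open>M\<close> lies
      inside the unpadded part of \<open>g L\<close>, so a pattern that kills the limit also kills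
      \<open>v L\<close>.\<close>
    obtain L where L: "L \<ge> M" "\<And>t. - int M \<le> t \<Longrightarrow> t < int (M + n) \<Longrightarrow> g L t = f t"
      using f[of "{- int M..<int (M + n)}" M] by auto
    obtain w s where w: "w \<in> F" "\<forall>p\<in>dom w. 0 \<le> p + s \<and> p + s < int (2 * M + n) \<and>
        w p = Some (f (int (nat (p + s)) - int M))" using M by (rule killsE)
    have "kills (2*L+n) (v L)" unfolding kills_def
    proof (intro bexI[OF _ w(1)] exI[of _ "s - int M + int L"] ballI)
      fix p assume "p \<in> dom w"
      note * = bspec[OF w(2) this]
      have "f (p + s - int M) = v L (nat (p + s - int M + int L))"
        using * L(1) by (subst L(2)[symmetric]) (auto simp: g_def)
      then show "0 \<le> p + (s - int M + int L) \<and> p + (s - int M + int L) < int (2 * L + n) \<and>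
         w p = Some (v L (nat (p + (s - int M + int L))))"
        using * L(1) by (simp add: algebra_simps)
    qed
    with v(3) show False by blast
  qed
  moreover have "f (int i) = u i" if "i < n" for i
  proof -
    obtain L where "g L (int i) = f (int i)" using f[of "{int i}" 0] by auto
    moreover have "nat (int i + int L) = L + i" by simp
    ultimately show ?thesis using v(2)[of i L] that by (simp add: g_def)
  qed
  ultimately show "occurs n u" unfolding occurs_def by blast
qed

text \<open>Digits to this base reach every symbol of \<open>A\<close>, but possibly others as well;
  hence the predicate \<open>inA\<close> below.\<close>

definition base :: nat where "base = Suc (Max A)"

lemma A_less_base: "c \<in> A \<Longrightarrow> c < base"
  unfolding base_def using finite_A by (simp add: less_Suc_eq_le)

abbreviation dg :: "nat \<Rightarrow> nat \<Rightarrow> nat" where "dg y \<equiv> digit base y"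

lemma ex_dg: "(\<And>t. t < n \<Longrightarrow> u t \<in> A) \<Longrightarrow> \<exists>y<base ^ n. \<forall>t<n. dg y t = u t"
  by (rule ex_digits) (use A_less_base in blast)

lemma kills_dg: "kills n (dg y) \<longleftrightarrow> (\<exists>m. pattern_decode m \<in> F \<and> (\<exists>s. fits base m s n y))"
proof
  assume "kills n (dg y)"
  then obtain w s where w: "w \<in> F"
    "\<forall>p\<in>dom w. 0 \<le> p + s \<and> p + s < int n \<and> w p = Some (dg y (nat (p + s)))"
    by (rule killsE)
  obtain m where m: "pattern_decode m = w"
     "\<And>i. i < length (list_decode m) \<Longrightarrow>
        w (int_decode (fs (list_decode m ! i))) = Some (sn (list_decode m ! i))"
    using ex_pattern_code[OF finite_dom_F[OF w(1)]] by blast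
  have s: "int (fs (pr (nat s) (nat (- s)))) - int (sn (pr (nat s) (nat (- s)))) = s" by simp
  have "fits base m (pr (nat s) (nat (- s))) n y"
    unfolding fits_iff s Let_def
  proof (intro allI impI)
    fix i assume i: "i < length (list_decode m)"
    then have "int_decode (fs (list_decode m ! i)) \<in> dom w" using m(2) by blast
    from bspec[OF w(2) this] m(2)[OF i]
    show "0 \<le> int_decode (fs (list_decode m ! i)) + s \<and> int_decode (fs (list_decode m ! i)) + s < int n \<and>
       dg y (nat (int_decode (fs (list_decode m ! i)) + s)) = sn (list_decode m ! i)" by simp
  qed
  with m(1) w(1) show "\<exists>m. pattern_decode m \<in> F \<and> (\<exists>s. fits base m s n y)" by blast
next
  assume "\<exists>m. pattern_decode m \<in> F \<and> (\<exists>s. fits base m s n y)"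
  then obtain m s where m: "pattern_decode m \<in> F" "fits base m s n y" by blast
  show "kills n (dg y)" unfolding kills_def
  proof (intro bexI[OF _ m(1)] exI[of _ "int (fs s) - int (sn s)"] ballI)
    fix p assume "p \<in> dom (pattern_decode m)"
    then obtain b where b: "pattern_decode m p = Some b" by blast
    then have "(p, b) \<in> set (map (map_prod int_decode id \<circ> prod_decode) (list_decode m))"
      unfolding pattern_decode_def by (rule map_of_SomeD)
    then obtain i where i: "i < length (list_decode m)" "p = int_decode (fs (list_decode m ! i))"
      "b = sn (list_decode m ! i)"
      by (auto simp: in_set_conv_nth prod_eq_iff)
    with m(2) b show "0 \<le> p + (int (fs s) - int (sn s)) \<and> p + (int (fs s) - int (sn s)) < int n \<and>
        pattern_decode m p = Some (dg y (nat (p + (int (fs s) - int (sn s)))))"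
      unfolding fits_iff Let_def by simp
  qed
qed

lemma sigma1_kills:
  assumes n: "computable n" and y: "computable y" shows "sigma1 (\<lambda>x. kills (n x) (dg (y x)))"
proof -
  have F: "sigma1 (\<lambda>m. pattern_decode m \<in> F)"
    using sigma1_comp_enum F_ce unfolding comp_enum_patterns_def by fastforce
  show ?thesis unfolding kills_dg
    by (intro sigma1_rules(2,3) sigma1_subst[OF F] comp_intros sigma1_rules(1) decidable_fits
       computable_comp[OF n] computable_comp[OF y])
qed

definition inA :: "nat \<Rightarrow> nat \<Rightarrow> bool" where
  "inA n y \<longleftrightarrow> (\<forall>t<n. dg y t \<in> A)"

lemma decidable_inA:
  assumes "computable n" "computable y" shows "decidable (\<lambda>x. inA (n x) (y x))"
  unfolding inA_def
  by (intro comp_intros decidable_finite finite_A assms computable_comp[OF assms(2)])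

text \<open>There are finitely many words of each length, so the negated inner quantifier of
  \<open>occurs_iff\<close> is a bounded one in front of a Sigma_1 condition, and only the
  quantifier over \<open>L\<close> is unbounded.\<close>

lemma not_occurs_dg: "\<not> occurs n (dg y) \<longleftrightarrow> (\<exists>L. \<forall>z<base ^ (2*L+n).
    \<not> (inA (2*L+n) z \<and> (\<forall>t<n. dg z (L + t) = dg y t)) \<or> kills (2*L+n) (dg z))"
proof -
  have "(\<exists>v. (\<forall>t<2*L+n. v t \<in> A) \<and> (\<forall>t<n. v (L + t) = dg y t) \<and> \<not> kills (2*L+n) v) \<longleftrightarrow>
    (\<exists>z<base ^ (2*L+n). inA (2*L+n) z \<and> (\<forall>t<n. dg z (L + t) = dg y t) \<and> \<not> kills (2*L+n) (dg z))" for L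
  proof
    assume "\<exists>v. (\<forall>t<2*L+n. v t \<in> A) \<and> (\<forall>t<n. v (L + t) = dg y t) \<and> \<not> kills (2*L+n) v"
    then obtain v where v: "\<And>t. t<2*L+n \<Longrightarrow> v t \<in> A" "\<forall>t<n. v (L + t) = dg y t" "\<not> kills (2*L+n) v"
      by blast
    have "\<exists>z<base ^ (2*L+n). \<forall>t<2*L+n. dg z t = v t" by (rule ex_dg) (rule v(1))
    then obtain z where z: "z < base ^ (2*L+n)" "\<And>t. t < 2*L+n \<Longrightarrow> dg z t = v t" by blast
    have "kills (2*L+n) (dg z) = kills (2*L+n) v" by (rule kills_cong) (rule z(2))
    with v(3) have "\<not> kills (2*L+n) (dg z)" by simp
    then show "\<exists>z<base ^ (2*L+n). inA (2*L+n) z \<and> (\<forall>t<n. dg z (L + t) = dg y t) \<and> \<not> kills (2*L+n) (dg z)"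
      using v z unfolding inA_def by (intro exI[of _ z]) auto
  qed (auto simp: inA_def)
  then show ?thesis unfolding occurs_iff by auto
qed

lemma pi1_occurs:
  assumes n: "computable n" and y: "computable y" shows "pi1 (\<lambda>x. occurs (n x) (dg (y x)))"
  unfolding pi1_def not_occurs_dg
  by (intro sigma1_rules(2,4) sigma1_disj sigma1_kills comp_intros sigma1_rules(1) decidable_inA
       computable_comp[OF n] computable_comp[OF y])

text \<open>One-sided separation by a finite context: \<open>y\<close> and \<open>y'\<close> are
  \<open>u\<close> and \<open>v\<close> in the same surroundings. The word \<open>y\<close> can be
  completed (Pi_1) and \<open>y'\<close> cannot because of a pattern already in view (Sigma_1), so
  the existential closure is Sigma_2.\<close>

definition sep :: "nat \<Rightarrow> nat \<Rightarrow> nat \<Rightarrow> bool" where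
  "sep n u v \<longleftrightarrow> (\<exists>M y y'. (inA (2*M+n) y \<and> inA (2*M+n) y' \<and>
     (\<forall>t<n. dg y (M + t) = dg u t \<and> dg y' (M + t) = dg v t) \<and>
     (\<forall>t<2*M+n. t < M \<or> M + n \<le> t \<longrightarrow> dg y t = dg y' t)) \<and>
     occurs (2*M+n) (dg y) \<and> kills (2*M+n) (dg y'))"

lemma sigma2_sep:
  assumes n: "computable n" and u: "computable u" and v: "computable v"
  shows "sigma2 (\<lambda>x. sep (n x) (u x) (v x))"
  unfolding sep_def
  by (intro sigma2_rules(2,3) sigma2_rules(1)[OF pi1_occurs] sigma1_imp_sigma2[OF sigma1_kills]
       sigma2_rules(1)[OF pi1_decidable] comp_intros decidable_inA
       computable_comp[OF n] computable_comp[OF u] computable_comp[OF v])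

text \<open>A completion of \<open>y\<close> supplies the infinite context; the pattern that kills
  \<open>y'\<close> stays in place whatever lies outside the window. Conversely, a context that
  rejects \<open>v\<close> is cut down to a window that contains the forbidden pattern.\<close>

lemma sep_iff:
  assumes u: "inA n u" and v: "inA n v"
  shows "sep n u v \<longleftrightarrow> (\<exists>f. (\<forall>t. f t \<in> A) \<and> conf (glue f n (dg u)) \<in> X \<and> conf (glue f n (dg v)) \<notin> X)"
proof
  assume "sep n u v"
  then obtain M y y' where
    y: "\<And>t. t < n \<Longrightarrow> dg y (M + t) = dg u t" "\<And>t. t < n \<Longrightarrow> dg y' (M + t) = dg v t"
     "\<And>t. t < 2*M+n \<Longrightarrow> t < M \<or> M + n \<le> t \<Longrightarrow> dg y t = dg y' t"
     and oc: "occurs (2*M+n) (dg y)" and k: "kills (2*M+n) (dg y')"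
    unfolding sep_def by blast
  obtain g where g: "conf g \<in> X" "\<And>i. i < 2*M+n \<Longrightarrow> g (int i) = dg y i" using oc unfolding occurs_def by blast
  define f where "f t = g (t + int M)" for t
  have f: "conf f \<in> X" unfolding f_def using X_shift[OF g(1)] .
  have fy: "f (int i - int M) = dg y i" if "i < 2*M+n" for i using g(2)[OF that] by (simp add: f_def)
  have "glue f n (dg u) = f"
    by (rule glue_self) (use fy[of "M + _"] y(1) in auto)
  moreover have "conf (glue f n (dg v)) \<notin> X"
  proof (rule kills_window)
    show "kills (2*M+n) (\<lambda>i. glue f n (dg v) (int i + - int M))"
    proof (rule kills_cong[THEN iffD1, OF _ k])
      fix i assume i: "i < 2*M+n"
      show "dg y' i = glue f n (dg v) (int i + - int M)"
      proof (cases "M \<le> i \<and> i < M + n")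
        case True
        then show ?thesis using y(2)[of "i - M"] by (auto simp: glue_def nat_diff_distrib)
      next
        case False
        then have "glue f n (dg v) (int i + - int M) = f (int i - int M)" by (auto simp: glue_def)
        then show ?thesis using fy[OF i] y(3)[OF i] False by (simp add: not_le not_less)
      qed
    qed
  qed
  ultimately show "\<exists>f. (\<forall>t. f t \<in> A) \<and> conf (glue f n (dg u)) \<in> X \<and> conf (glue f n (dg v)) \<notin> X"
    using f X_in[OF f] by (intro exI[of _ f]) simp
next
  assume "\<exists>f. (\<forall>t. f t \<in> A) \<and> conf (glue f n (dg u)) \<in> X \<and> conf (glue f n (dg v)) \<notin> X"
  then obtain f where f: "\<And>t. f t \<in> A" "conf (glue f n (dg u)) \<in> X" "conf (glue f n (dg v)) \<notin> X" by blast
  have gA: "glue f n (dg u) t \<in> A" "glue f n (dg v) t \<in> A" for t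
    using u v f(1) by (auto simp: inA_def intro!: glue_in)
  obtain M where M: "kills (2*M+n) (\<lambda>i. glue f n (dg v) (int i - int M))"
    using not_in_X_kills[OF gA(2) f(3)] by blast
  obtain y where y: "\<And>i. i < 2*M+n \<Longrightarrow> dg y i = glue f n (dg u) (int i - int M)"
    using ex_dg[of "2*M+n" "\<lambda>i. glue f n (dg u) (int i - int M)"] gA by blast
  obtain y' where y': "\<And>i. i < 2*M+n \<Longrightarrow> dg y' i = glue f n (dg v) (int i - int M)"
    using ex_dg[of "2*M+n" "\<lambda>i. glue f n (dg v) (int i - int M)"] gA by blast
  have "occurs (2*M+n) (dg y)" unfolding occurs_def
    using X_shift[OF f(2), of "- int M"] y by (intro exI[of _ "\<lambda>t. glue f n (dg u) (t + - int M)"]) simp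
  moreover have "kills (2*M+n) (dg y')"
    by (subst kills_cong[of _ _ "\<lambda>i. glue f n (dg v) (int i - int M)"]) (rule y' M, assumption?)+
  moreover have "inA (2*M+n) y" "inA (2*M+n) y'" unfolding inA_def using y y' gA by auto
  moreover have "dg y (M + t) = dg u t" "dg y' (M + t) = dg v t" if "t < n" for t
    using y[of "M + t"] y'[of "M + t"] that by auto
  moreover have "dg y t = dg y' t" if "t < 2*M+n" "t < M \<or> M + n \<le> t" for t
    using y[of t] y'[of t] that by (auto simp: glue_def)
  ultimately show "sep n u v" unfolding sep_def by blast
qed

text \<open>The two directions of separation are put under an existential quantifier over
  \<open>b\<close>, because the closure rules collected for \<open>sigma2\<close> offer quantifiers
  and conjunctions, but no disjunction.\<close>

lemma E_neq_iff:
  assumes "inA n u" "inA n v"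
  shows "E n (dg u) \<noteq> E n (dg v) \<longleftrightarrow>
    (\<exists>b. sep n (if b = (0::nat) then u else v) (if b = 0 then v else u))"
proof -
  have "E n (dg u) \<noteq> E n (dg v) \<longleftrightarrow> sep n u v \<or> sep n v u"
    unfolding E_eq_iff sep_iff[OF assms] sep_iff[OF assms(2,1)] by blast
  then show ?thesis by (auto intro: exI[of _ "0::nat"] exI[of _ "1::nat"] split: if_splits)
qed

text \<open>Integer form of \<open>p / (q + 1) \<le> log 2 j\<close>, where \<open>W\<close> lists
  \<open>j\<close> words with pairwise different extender sets.\<close>

definition many :: "nat \<Rightarrow> nat \<Rightarrow> nat \<Rightarrow> bool" where
  "many n p q \<longleftrightarrow> (\<exists>j W. 2 ^ p \<le> j ^ Suc q \<and>
     (\<forall>i<j. inA n (nthc W i) \<and> occurs n (dg (nthc W i))) \<and>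
     (\<forall>i<j. \<forall>k<i. \<exists>b. sep n (if b = (0::nat) then nthc W i else nthc W k)
         (if b = 0 then nthc W k else nthc W i)))"

lemma sigma2_many: "sigma2 (\<lambda>x. many (fs x) (fs (sn x)) (sn (sn x)))"
  unfolding many_def
  by (intro sigma2_rules(2,3,4) sigma2_sep sigma2_rules(1)[OF pi1_occurs]
       sigma2_rules(1)[OF pi1_decidable] comp_intros decidable_inA)

lemma many_iff: "many n p q \<longleftrightarrow> 2 ^ p \<le> N n ^ Suc q"
proof
  assume "many n p q"
  then obtain j W where j: "2 ^ p \<le> j ^ Suc q"
    and W: "\<And>i. i < j \<Longrightarrow> inA n (nthc W i)" "\<And>i. i < j \<Longrightarrow> occurs n (dg (nthc W i))"
    and s: "\<And>i k. i < j \<Longrightarrow> k < i \<Longrightarrow> \<exists>b. sep n (if b = (0::nat) then nthc W i else nthc W k)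
         (if b = 0 then nthc W k else nthc W i)" unfolding many_def by blast
  have "E n (dg (nthc W i)) \<noteq> E n (dg (nthc W k))" if "i < j" "k < i" for i k
    using E_neq_iff[OF W(1)[of i] W(1)[of k]] s[of i k] that by auto
  then have "inj_on (\<lambda>i. E n (dg (nthc W i))) {..<j}"
    by (intro linorder_inj_onI) force+
  moreover have "(\<lambda>i. E n (dg (nthc W i))) ` {..<j} \<subseteq> extender_sets A X n"
    unfolding extender_sets_eq using W(2) by blast
  ultimately have "j \<le> N n" using card_inj_on_le[OF _ _ finite_extender_sets] by fastforce
  then have "j ^ Suc q \<le> N n ^ Suc q" by (rule power_mono) simp
  with j show "2 ^ p \<le> N n ^ Suc q" by linarith
next
  assume le: "2 ^ p \<le> N n ^ Suc q"
  obtain e where e: "bij_betw e {..<N n} (extender_sets A X n)"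
    using ex_bij_betw_nat_finite[OF finite_extender_sets] by (auto simp: atLeast0LessThan)
  have "\<exists>y. inA n y \<and> occurs n (dg y) \<and> E n (dg y) = e i" if "i < N n" for i
  proof -
    have "e i \<in> extender_sets A X n" using e that by (auto simp: bij_betw_def)
    then obtain u where u: "occurs n u" "e i = E n u" unfolding extender_sets_eq by blast
    obtain y where y: "\<And>t. t < n \<Longrightarrow> dg y t = u t" using ex_dg[of n u] occurs_in[OF u(1)] by blast
    have "occurs n (dg y)" using u(1) y unfolding occurs_def by auto
    moreover have "E n (dg y) = e i" unfolding u(2) E_eq_iff using glue_cong[OF y] by simp
    moreover have "inA n y" unfolding inA_def using y occurs_in[OF u(1)] by simp
    ultimately show ?thesis by blast
  qed
  then obtain y where y: "\<And>i. i < N n \<Longrightarrow> inA n (y i) \<and> occurs n (dg (y i)) \<and> E n (dg (y i)) = e i"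
    by metis
  obtain W where W: "\<And>i. i < N n \<Longrightarrow> nthc W i = y i" using ex_nthc[of "N n" y] by blast
  have neq: "E n (dg (y i)) \<noteq> E n (dg (y k))" if "i < N n" "k < i" for i k
    using y[of i] y[of k] inj_on_eq_iff[OF bij_betw_imp_inj_on[OF e], of i k] that by auto
  have sep: "\<exists>b. sep n (if b = (0::nat) then y i else y k) (if b = 0 then y k else y i)"
    if "i < N n" "k < i" for i k
    by (rule E_neq_iff[THEN iffD1]) (use neq y that in \<open>simp_all add: less_trans[of k i]\<close>)
  show "many n p q" unfolding many_def
  proof (rule exI[of _ "N n"], rule exI[of _ W], intro conjI allI impI)
    fix i k assume ik: "i < N n" "k < i"
    have W': "nthc W i = y i" "nthc W k = y k" using W[of i] W[of k] ik by auto
    show "\<exists>b. sep n (if b = (0::nat) then nthc W i else nthc W k)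
         (if b = 0 then nthc W k else nthc W i)"
      unfolding W' by (rule sep[OF ik])
  qed (use le y W in auto)
qed

lemma many_log: "many n p q \<longleftrightarrow> real p / real (Suc q) \<le> log 2 (real (N n))"
proof -
  have pos: "real (N n) > 0" using N_pos[of n] by linarith
  have "many n p q \<longleftrightarrow> (2::real) ^ p \<le> real (N n) ^ Suc q"
    unfolding many_iff by (metis of_nat_le_iff of_nat_numeral of_nat_power)
  also have "\<dots> \<longleftrightarrow> log 2 (2 ^ p) \<le> log 2 (real (N n) ^ Suc q)"
    using pos by (intro log_le_cancel_iff[symmetric]) auto
  also have "log 2 (2 ^ p) = real p" by (subst log_nat_power) auto
  also have "log 2 (real (N n) ^ Suc q) = real (Suc q) * log 2 (real (N n))"
    using pos by (subst log_nat_power) auto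
  finally show ?thesis by (simp add: field_simps del: of_nat_Suc)
qed

section \<open>The entropy as inf sup inf of a computable sequence of rationals\<close>

lemma entropy_eq_INF:
  "ereal (extender_entropy A X) = (INF k. ereal (log 2 (real (N (Suc k))) / real (Suc k)))"
proof (rule antisym)
  show "ereal (extender_entropy A X) \<le> (INF k. ereal (log 2 (real (N (Suc k))) / real (Suc k)))"
  proof (rule INF_greatest)
    fix k show "ereal (extender_entropy A X) \<le> ereal (log 2 (real (N (Suc k))) / real (Suc k))"
      using entropy_le[of "Suc k"] by (simp del: of_nat_Suc)
  qed
next
  have "(\<lambda>k. ereal (log 2 (real (N (Suc k))) / real (Suc k))) \<longlonglongrightarrow> ereal (extender_entropy A X)"
    using LIMSEQ_Suc[OF entropy_limit] by simp
  then show "(INF k. ereal (log 2 (real (N (Suc k))) / real (Suc k))) \<le> ereal (extender_entropy A X)"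
    by (rule LIMSEQ_le_const) (auto intro: INF_lower)
qed

text \<open>The index \<open>x\<close> codes a fraction \<open>p / (q + 1)\<close> together with a
  candidate for the outer witness of the Sigma_2 statement. A correct candidate contributes the
  fraction divided by \<open>n\<close>; a wrong one is pushed down to 0 by some
  \<open>l\<close>.\<close>

lemma SUP_many:
  fixes R :: "nat \<Rightarrow> nat \<Rightarrow> nat \<Rightarrow> nat \<Rightarrow> bool"
  assumes R: "\<And>p q. many n p q \<longleftrightarrow> (\<exists>k. \<forall>l. R p q k l)" and n: "n \<ge> 1"
  shows "(SUP x. INF l. ereal (if R (fs x) (fs (sn x)) (sn (sn x)) l
             then real (fs x) / (real (Suc (fs (sn x))) * real n) else 0)) =
    ereal (log 2 (real (N n)) / real n)" (is "(SUP x. INF l. ?g x l) = ereal ?H")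
proof (rule antisym)
  have H0: "?H \<ge> 0" using N_pos[of n] by simp
  have npos: "real n > 0" using n by simp
  show "(SUP x. INF l. ?g x l) \<le> ereal ?H"
  proof (rule SUP_least)
    fix x
    show "(INF l. ?g x l) \<le> ereal ?H"
    proof (cases "\<forall>l. R (fs x) (fs (sn x)) (sn (sn x)) l")
      case True
      then have "real (fs x) / real (Suc (fs (sn x))) \<le> log 2 (real (N n))"
        using R many_log by blast
      then have "real (fs x) / real (Suc (fs (sn x))) / real n \<le> ?H" by (rule divide_right_mono) simp
      then have "?g x 0 \<le> ereal ?H" using True by (simp add: mult.commute del: of_nat_Suc)
      then show ?thesis by (rule INF_lower2[OF UNIV_I])
    next
      case False
      then obtain l where "\<not> R (fs x) (fs (sn x)) (sn (sn x)) l" by blast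
      then have "?g x l \<le> ereal ?H" using H0 by simp
      then show ?thesis by (rule INF_lower2[OF UNIV_I])
    qed
  qed
  show "ereal ?H \<le> (SUP x. INF l. ?g x l)"
  proof (rule ereal_le_epsilon2)
    fix e :: real assume e: "0 < e"
    obtain q :: nat where q: "inverse (real (Suc q)) < e" using reals_Archimedean[OF e] by blast
    define h where "h = log 2 (real (N n))"
    have h0: "h \<ge> 0" unfolding h_def using N_pos[of n] by simp
    \<comment> \<open>The best lower approximation with denominator \<open>q + 1\<close>; its error
      is at most \<open>1 / (q + 1)\<close>, which is below \<open>e\<close>.\<close>
    define p where "p = nat \<lfloor>h * real (Suc q)\<rfloor>"
    have fl: "real p = of_int \<lfloor>h * real (Suc q)\<rfloor>" unfolding p_def using h0 by simp
    have p: "real p \<le> h * real (Suc q)" "h * real (Suc q) - 1 \<le> real p" unfolding fl by linarith+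
    have "many n p q" unfolding many_log using p(1) by (simp add: h_def field_simps del: of_nat_Suc)
    then obtain k where k: "\<And>l. R p q k l" using R by blast
    have "h \<le> real p / real (Suc q) + inverse (real (Suc q))" using p(2) by (simp add: field_simps del: of_nat_Suc)
    then have "h \<le> real p / real (Suc q) + e" using q by linarith
    then have "h / real n \<le> (real p / real (Suc q) + e) / real n" using npos by (intro divide_right_mono) auto
    also have "\<dots> = real p / (real (Suc q) * real n) + e / real n" by (simp add: add_divide_distrib)
    also have "e / real n \<le> e" using n e by (simp add: field_simps)
    finally have "ereal ?H \<le> ereal (real p / (real (Suc q) * real n)) + ereal e" by (simp add: h_def)
    also have "ereal (real p / (real (Suc q) * real n)) = (INF l. ?g (pr p (pr q k)) l)"
      using k by simp
    also have "\<dots> \<le> (SUP x. INF l. ?g x l)" by (rule SUP_upper) simp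
    finally show "ereal ?H \<le> (SUP x. INF l. ?g x l) + ereal e" by (simp add: add_right_mono)
  qed
qed

lemma entropy_Pi3: "extender_entropy A X \<in> Pi3"
proof -
  obtain Q where Q: "pi1 Q" "\<And>x. many (fs x) (fs (sn x)) (sn (sn x)) \<longleftrightarrow> (\<exists>k. Q (pr x k))"
    using sigma2_many unfolding ex_class_def by blast
  then obtain S where S: "decidable S" "\<And>z. \<not> Q z \<longleftrightarrow> (\<exists>l. S (pr z l))"
    unfolding pi1_def ex_class_def by blast
  define R where "R n p q k l \<longleftrightarrow> \<not> S (pr (pr (pr n (pr p q)) k) l)" for n p q k l
  have manyR: "many n p q \<longleftrightarrow> (\<exists>k. \<forall>l. R n p q k l)" for n p q
    using Q(2)[of "pr n (pr p q)"] S(2) unfolding R_def by simp blast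
  \<comment> \<open>\<open>int_decode\<close> maps \<open>2 * x\<close> to \<open>x\<close>, whence
    the factor 2. The \<open>- 1\<close> in \<open>D\<close> cancels the \<open>Suc\<close> in the
    definition of computable rational sequences, so that the denominator is
    \<open>(q + 1) * (a + 1)\<close>.\<close>
  define P where "P z = (if R (Suc (fs z)) (fs (fs (sn z))) (fs (sn (fs (sn z)))) (sn (sn (fs (sn z)))) (sn (sn z))
      then 2 * fs (fs (sn z)) else 0)" for z
  define D where "D z = Suc (fs (sn (fs (sn z)))) * Suc (fs z) - 1" for z
  have cP: "computable P"
    unfolding P_def R_def by (intro comp_intros decidable_comp[OF S(1)])
  have cD: "computable D"
    unfolding D_def by (intro comp_intros)
  define \<beta> :: "nat \<Rightarrow> nat \<Rightarrow> nat \<Rightarrow> rat" where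
    "\<beta> a b c = of_int (int_decode (P (pr a (pr b c)))) / of_nat (Suc (D (pr a (pr b c))))" for a b c
  have "computable_rat_seq \<beta>"
    unfolding computable_rat_seq_def \<beta>_def using computable3I[OF cP] computable3I[OF cD] by blast
  moreover have b: "real_of_rat (\<beta> a b c) = (if R (Suc a) (fs b) (fs (sn b)) (sn (sn b)) c
             then real (fs b) / (real (Suc (fs (sn b))) * real (Suc a)) else 0)" for a b c
  proof -
    have i: "int_decode (2 * x) = int x" "int_decode 0 = 0" for x
      by (simp_all add: int_decode_def sum_decode_def)
    have "Suc (D (pr a (pr b c))) = Suc (fs (sn b)) * Suc a" by (simp add: D_def)
    then show ?thesis unfolding \<beta>_def P_def
      by (simp add: i of_rat_divide of_rat_mult of_rat_add del: of_nat_Suc mult_Suc mult_Suc_right)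
  qed
  then have "ereal (extender_entropy A X) = (INF k1. SUP k2. INF k3. ereal (of_rat (\<beta> k1 k2 k3)))"
    unfolding b using SUP_many[OF manyR] by (simp add: entropy_eq_INF)
  ultimately show ?thesis unfolding Pi3_def by blast
qed

end

subsection \<open>Configurations with periodically repeated blocks\<close>

definition gap :: "(int \<Rightarrow> nat) \<Rightarrow> int \<Rightarrow> nat \<Rightarrow> bool" where
  "gap f s g \<longleftrightarrow> 1 \<le> g \<and> f s \<noteq> 0 \<and> (\<forall>t<g. f (s + 1 + int t) = 0) \<and> f (s + int g + 1) \<noteq> 0"

text \<open>The nearest nonzero positions on either side of a zero would bound a gap.\<close>

lemma no_gap_convex:
  assumes "\<And>s g. \<not> gap f s g" "f a \<noteq> 0" "f c \<noteq> 0" "a < b" "b < c"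
  shows "f b \<noteq> 0"
proof
  assume b: "f b = 0"
  define s where "s = Max {x \<in> {a..<b}. f x \<noteq> 0}"
  define e where "e = Min {x \<in> {b<..c}. f x \<noteq> 0}"
  have s: "s \<in> {x \<in> {a..<b}. f x \<noteq> 0}" unfolding s_def
    by (rule Max_in) (use assms in \<open>auto intro!: finite_subset[OF _ finite_atLeastLessThan_int[of a b]]\<close>)
  have e: "e \<in> {x \<in> {b<..c}. f x \<noteq> 0}" unfolding e_def
    by (rule Min_in) (use assms in \<open>auto intro!: finite_subset[OF _ finite_greaterThanAtMost_int[of b c]]\<close>)
  have zero: "f x = 0" if "s < x" "x < e" for x
  proof (rule ccontr)
    assume x: "f x \<noteq> 0"
    consider "x < b" | "x = b" | "b < x" by linarith
    then show False
    proof cases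
      case 1
      have "finite {x \<in> {a..<b}. f x \<noteq> 0}" by (rule finite_subset[OF _ finite_atLeastLessThan_int[of a b]]) auto
      from 1 x that s have "x \<le> s" unfolding s_def by (intro Max_ge \<open>finite _\<close>) auto
      with that show False by simp
    next
      case 3
      have "finite {x \<in> {b<..c}. f x \<noteq> 0}" by (rule finite_subset[OF _ finite_greaterThanAtMost_int[of b c]]) auto
      from 3 x that e have "e \<le> x" unfolding e_def by (intro Min_le \<open>finite _\<close>) auto
      with that show False by simp
    qed (use x b in simp)
  qed
  have "gap f s (nat (e - s - 1))"
    unfolding gap_def using s e zero by auto
  with assms(1) show False by blast
qed

text \<open>Keeps the first matching entry, as \<open>map_of\<close> does; 0 stands for undefined
  and values are raised by one. Running the recursion up to \<open>n\<close> is enough because a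
  list is no longer than its code.\<close>

definition lookup :: "nat \<Rightarrow> nat \<Rightarrow> nat" where
  "lookup n q = rec_nat 0 (\<lambda>i y. if y \<noteq> 0 then y
     else if dropc n i \<noteq> 0 \<and> fs (nthc n i) = q then Suc (sn (nthc n i)) else 0) n"

lemma computable_lookup [comp_intros]:
  assumes "computable n" "computable q" shows "computable (\<lambda>x. lookup (n x) (q x))"
  unfolding lookup_def
  by (intro comp_intros assms computable_comp[OF assms(1)] computable_comp[OF assms(2)])

lemma lookup_eq: "lookup n q = (case pattern_decode n (int_decode q) of None \<Rightarrow> 0 | Some a \<Rightarrow> Suc a)"
proof -
  let ?d = "map_prod int_decode id \<circ> prod_decode"
  let ?r = "rec_nat 0 (\<lambda>i y. if y \<noteq> 0 then y
     else if dropc n i \<noteq> 0 \<and> fs (nthc n i) = q then Suc (sn (nthc n i)) else 0)"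
  have "?r k = (case map_of (map ?d (take k (list_decode n))) (int_decode q) of None \<Rightarrow> 0 | Some a \<Rightarrow> Suc a)" for k
  proof (induction k)
    case (Suc k)
    show ?case
    proof (cases "k < length (list_decode n)")
      case True
      obtain x y where xy: "list_decode n ! k = pr x y" by (rule pair_cases)
      have "dropc n k \<noteq> 0" "nthc n k = pr x y" using True by (simp_all add: dropc_eq_0 nthc_eq xy)
      then show ?thesis using Suc True
        by (auto simp: take_Suc_conv_app_nth xy int_decode_eq map_add_def split: option.splits)
    next
      case False
      then have "dropc n k = 0" by (simp add: dropc_eq_0)
      then show ?thesis using Suc False by simp
    qed
  qed simp
  from this[of n] show ?thesis
    unfolding lookup_def pattern_decode_def using length_list_decode_le[of n] by simp
qed

text \<open>Symbols are tested through \<open>lookup\<close>, since a shadowed entry of the code may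
  carry any number. The bound is \<open>Suc S\<close> because \<open>lookup\<close> adds
  one.\<close>

lemma patterns_decode:
  "pattern_decode n \<in> patterns {..S} \<longleftrightarrow>
     (\<forall>i<n. dropc n i \<noteq> 0 \<longrightarrow> lookup n (fs (nthc n i)) \<le> Suc S)"
proof -
  let ?d = "map_prod int_decode id \<circ> prod_decode"
  have "finite (dom (pattern_decode n))" unfolding pattern_decode_def by (rule finite_dom_map_of)
  then have "pattern_decode n \<in> patterns {..S} \<longleftrightarrow> (\<forall>p\<in>dom (pattern_decode n). the (pattern_decode n p) \<le> S)"
    unfolding patterns_def maps_on_def by (auto simp: ran_def) (metis domI option.sel)
  also have "dom (pattern_decode n) = (\<lambda>i. int_decode (fs (nthc n i))) ` {i. i < n \<and> dropc n i \<noteq> 0}"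
  proof -
    have "{i. i < n \<and> dropc n i \<noteq> 0} = {..<length (list_decode n)}"
      using length_list_decode_le[of n] by (auto simp: dropc_eq_0 not_le)
    moreover have "dom (pattern_decode n) = (\<lambda>x. int_decode (fs x)) ` set (list_decode n)"
      unfolding pattern_decode_def dom_map_of_conv_image_fst by (simp add: image_image)
    moreover have "set (list_decode n) = nthc n ` {..<length (list_decode n)}"
      using nthc_eq[of _ n] by (auto simp: set_conv_nth image_iff)
    ultimately show ?thesis by (simp add: image_image)
  qed
  also have "(\<forall>p\<in>\<dots>. the (pattern_decode n p) \<le> S) \<longleftrightarrow>
      (\<forall>i<n. dropc n i \<noteq> 0 \<longrightarrow> the (pattern_decode n (int_decode (fs (nthc n i)))) \<le> S)" by auto
  also have "\<dots> \<longleftrightarrow> (\<forall>i<n. dropc n i \<noteq> 0 \<longrightarrow> lookup n (fs (nthc n i)) \<le> Suc S)"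
  proof -
    have "the (pattern_decode n (int_decode (fs (nthc n i)))) \<le> S \<longleftrightarrow> lookup n (fs (nthc n i)) \<le> Suc S"
      if "i < n" "dropc n i \<noteq> 0" for i
    proof -
      have "int_decode (fs (nthc n i)) \<in> dom (pattern_decode n)" using that calculation
        by (simp add: \<open>dom (pattern_decode n) = _\<close>)
      then show ?thesis by (auto simp: lookup_eq)
    qed
    then show ?thesis by blast
  qed
  finally show ?thesis .
qed

text \<open>A gap of length \<open>g\<close> announces that the configuration repeats one block of length \<open>p g\<close>,
  separated by such gaps, and that the block is constantly 1 outside the free positions.  The
  length \<open>g\<close> is admissible if it is never refuted.\<close>

locale block_shift =
  fixes S :: nat and p :: "nat \<Rightarrow> nat" and free R :: "nat \<Rightarrow> nat \<Rightarrow> bool"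
  assumes S_pos: "1 \<le> S" and p_pos: "1 \<le> p g"
    and p_le: "(\<And>k. \<not> R g k) \<Longrightarrow> p g \<le> g"
    and comp_p: "computable p"
    and dec_free: "decidable (\<lambda>z. free (fs z) (sn z))"
    and dec_R: "decidable (\<lambda>z. R (fs z) (sn z))"
begin

definition good :: "(int \<Rightarrow> nat) \<Rightarrow> bool" where
  "good f \<longleftrightarrow> (\<forall>t. f t \<le> S) \<and> (\<forall>s g. gap f s g \<longrightarrow>
     (\<forall>k. \<not> R g k) \<and> (\<forall>t. f (t + int (p g + g)) = f t) \<and>
     (\<forall>t<p g. f (s + int g + 1 + int t) \<noteq> 0 \<and> (\<not> free g t \<longrightarrow> f (s + int g + 1 + int t) = 1)))"

text \<open>The index \<open>k\<close> has three roles: stage of a refutation of the gap length,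
  position at which periodicity fails, and offset in the block after the gap. Only the last two have
  to lie in the window of length \<open>N\<close>.\<close>

definition violation :: "nat \<Rightarrow> (nat \<Rightarrow> nat) \<Rightarrow> nat \<Rightarrow> nat \<Rightarrow> nat \<Rightarrow> bool" where
  "violation N h s g k \<longleftrightarrow> 1 \<le> g \<and> s + g + 1 < N \<and> h s \<noteq> 0 \<and> (\<forall>t<g. h (s + 1 + t) = 0) \<and> h (s + g + 1) \<noteq> 0 \<and>
     (R g k \<or>
      k + (p g + g) < N \<and> h (k + (p g + g)) \<noteq> h k \<or>
      k < p g \<and> s + g + 1 + k < N \<and>
        (h (s + g + 1 + k) = 0 \<or> \<not> free g k \<and> h (s + g + 1 + k) \<noteq> 1))"

definition forbidden :: "(int \<rightharpoonup> nat) set" where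
  "forbidden = {w \<in> patterns {..S}. \<exists>N. (\<forall>t<N. w (int t) \<noteq> None) \<and>
     (\<exists>s g k. violation N (\<lambda>t. the (w (int t))) s g k)}"

abbreviation "X \<equiv> subshift_of {..S} forbidden"

lemma violation_cong:
  assumes "\<And>i. i < N \<Longrightarrow> h i = h' i"
  shows "violation N h s g k \<longleftrightarrow> violation N h' s g k"
proof -
  have "violation N h s g k" if v: "violation N h' s g k" and h: "\<And>i. i < N \<Longrightarrow> h i = h' i" for h h'
  proof -
    have "s + g + 1 < N" using v unfolding violation_def by blast
    then have "h s = h' s" "h (s + g + 1) = h' (s + g + 1)" "\<And>t. t < g \<Longrightarrow> h (s + 1 + t) = h' (s + 1 + t)"
      by (auto intro!: h)
    moreover have "k + (p g + g) < N \<Longrightarrow> h (k + (p g + g)) = h' (k + (p g + g)) \<and> h k = h' k"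
      by (auto intro!: h)
    moreover have "s + g + 1 + k < N \<Longrightarrow> h (s + g + 1 + k) = h' (s + g + 1 + k)" by (rule h)
    ultimately show ?thesis using v unfolding violation_def by auto
  qed
  from this[of h' h] this[of h h'] show ?thesis using assms by auto
qed

lemma good_no_violation:
  assumes "good f" shows "\<not> violation N (\<lambda>i. f (int i + d)) s g k"
proof
  assume v: "violation N (\<lambda>i. f (int i + d)) s g k"
  have "gap f (int s + d) g"
    using v unfolding violation_def gap_def by (auto simp: algebra_simps)
  then have *: "\<And>k. \<not> R g k" "\<And>t. f (t + int (p g + g)) = f t"
     "\<And>t. t < p g \<Longrightarrow> f (int s + d + int g + 1 + int t) \<noteq> 0 \<and> (\<not> free g t \<longrightarrow> f (int s + d + int g + 1 + int t) = 1)"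
    using assms unfolding good_def by blast+
  show False using v *(1)[of k] *(2)[of "int k + d"] *(3)[of k]
    unfolding violation_def by (auto simp: algebra_simps)
qed

text \<open>Goodness is a conjunction of local conditions triggered by a gap, and each failure shows
  in a finite window that also contains the gap. Configurations without gaps trigger
  nothing.\<close>

lemma X_iff: "conf f \<in> X \<longleftrightarrow> good f"
proof
  assume "good f"
  then have "f t \<in> {..S}" for t unfolding good_def by auto
  moreover have "\<not> appears_in w (conf f)" if "w \<in> forbidden" for w
  proof
    assume "appears_in w (conf f)"
    then obtain d where d: "\<And>q. q \<in> dom w \<Longrightarrow> w q = Some (f (q + d))" unfolding appears_in_conf by blast
    from that obtain N s g k where w: "\<And>t. t < N \<Longrightarrow> w (int t) \<noteq> None"
      "violation N (\<lambda>t. the (w (int t))) s g k" unfolding forbidden_def by blast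
    have "the (w (int t)) = f (int t + d)" if "t < N" for t
      using d[of "int t"] w(1)[OF that] by (simp add: domIff)
    then have "violation N (\<lambda>t. the (w (int t))) s g k \<longleftrightarrow> violation N (\<lambda>t. f (int t + d)) s g k"
      by (rule violation_cong)
    with w(2) good_no_violation[OF \<open>good f\<close>] show False by blast
  qed
  ultimately show "conf f \<in> X" unfolding subshift_of_conf by blast
next
  assume X: "conf f \<in> X"
  then have fS: "f t \<le> S" for t unfolding subshift_of_conf by auto
  have nov: "\<not> violation N (\<lambda>i. f (int i + d)) s g k" for N d s g k
  proof
    assume v: "violation N (\<lambda>i. f (int i + d)) s g k"
    define w where "w = word N (\<lambda>i. f (int i + d))"
    have wi: "w (int t) = Some (f (int t + d))" if "t < N" for t using that unfolding w_def word_def by simp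
    have "violation N (\<lambda>t. the (w (int t))) s g k \<longleftrightarrow> violation N (\<lambda>i. f (int i + d)) s g k"
      by (rule violation_cong) (simp add: wi)
    moreover have "w \<in> patterns {..S}"
      unfolding patterns_def using maps_on_interval[of w "{..S}" N] fS w_def by blast
    ultimately have "w \<in> forbidden" unfolding forbidden_def using v wi by auto
    moreover have "appears_in w (conf f)" unfolding appears_in_conf w_def dom_word
      by (intro exI[of _ d]) (auto simp: word_def)
    ultimately show False using X unfolding subshift_of_conf by blast
  qed
  show "good f" unfolding good_def
  proof (intro conjI allI impI fS)
    fix s g assume gap: "gap f s g"
    have v: "violation N (\<lambda>i. f (int i + d)) (nat (s - d)) g k" if
      "d \<le> s" "s + int g + 1 < int N + d"
      "R g k \<or> k + (p g + g) < N \<and> f (int k + int (p g + g) + d) \<noteq> f (int k + d) \<or>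
        k < p g \<and> s + int g + 1 + int k < int N + d \<and>
        (f (s + int g + 1 + int k) = 0 \<or> \<not> free g k \<and> f (s + int g + 1 + int k) \<noteq> 1)" for N d k
    proof -
      define r where "r = nat (s - d)"
      have s: "s = int r + d" unfolding r_def using that(1) by simp
      show ?thesis unfolding r_def[symmetric] violation_def using that(2,3) gap
        unfolding s gap_def by (auto simp: algebra_simps)
    qed
    { fix k show "\<not> R g k"
        using v[of s "g + 2" k] nov by force }
    { fix t
      show "f (t + int (p g + g)) = f t"
      proof (rule ccontr)
        assume ne: "f (t + int (p g + g)) \<noteq> f t"
        \<comment> \<open>The window starts at \<open>d\<close> and must contain the gap after
          \<open>s\<close> as well as both \<open>t\<close> and \<open>t + p g + g\<close>, in
          either order of \<open>s\<close> and \<open>t\<close>.\<close>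
        define d where "d = min s t"
        define N where "N = nat (max s t - d) + p g + g + 2"
        have "violation N (\<lambda>i. f (int i + d)) (nat (s - d)) g (nat (t - d))"
        proof (rule v)
          show "d \<le> s" "s + int g + 1 < int N + d" unfolding N_def d_def by auto
          have "nat (t - d) + (p g + g) < N" unfolding N_def d_def by auto
          moreover have "int (nat (t - d)) + d = t" unfolding d_def by simp
          ultimately show "R g (nat (t - d)) \<or> nat (t - d) + (p g + g) < N \<and>
              f (int (nat (t - d)) + int (p g + g) + d) \<noteq> f (int (nat (t - d)) + d) \<or>
            nat (t - d) < p g \<and> s + int g + 1 + int (nat (t - d)) < int N + d \<and>
            (f (s + int g + 1 + int (nat (t - d))) = 0 \<or> \<not> free g (nat (t - d)) \<and> f (s + int g + 1 + int (nat (t - d))) \<noteq> 1)"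
            using ne by (metis add.assoc add.commute)
        qed
        with nov show False by blast
      qed }
    fix t assume t: "t < p g"
    have "s + int g + 1 < int (g + 2 + t) + s" "s + int g + 1 + int t < int (g + 2 + t) + s" by auto
    with v[of s "g + 2 + t" t] t nov[of "g + 2 + t" s "nat (s - s)" g t]
    have *: "\<not> (f (s + int g + 1 + int t) = 0 \<or> \<not> free g t \<and> f (s + int g + 1 + int t) \<noteq> 1)"
      by blast
    from * show "f (s + int g + 1 + int t) \<noteq> 0" by simp
    from * show "\<not> free g t \<Longrightarrow> f (s + int g + 1 + int t) = 1" by simp
  qed
qed

lemma effective: "effective_subshift {..S} X"
proof -
  \<comment> \<open>The position \<open>int t\<close> has code \<open>2 * t\<close>, so that
    \<open>lookup n (2 * t) - 1\<close> is its symbol. The right-hand side is decidable under four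
    number quantifiers.\<close>
  have eq: "pattern_decode n \<in> forbidden \<longleftrightarrow> (\<exists>N s g k.
      (\<forall>i<n. dropc n i \<noteq> 0 \<longrightarrow> lookup n (fs (nthc n i)) \<le> Suc S) \<and>
      (\<forall>t<N. lookup n (2 * t) \<noteq> 0) \<and> violation N (\<lambda>t. lookup n (2 * t) - 1) s g k)" for n
  proof -
    have i: "int_decode (2 * x) = int x" for x
      by (simp add: int_decode_def sum_decode_def)
    have a: "lookup n (2 * t) \<noteq> 0 \<longleftrightarrow> pattern_decode n (int t) \<noteq> None" for t
      unfolding lookup_eq i by (auto split: option.split)
    have b: "violation N (\<lambda>t. lookup n (2 * t) - 1) s g k \<longleftrightarrow> violation N (\<lambda>t. the (pattern_decode n (int t))) s g k"
      if "\<And>t. t < N \<Longrightarrow> pattern_decode n (int t) \<noteq> None" for N s g k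
    proof (rule violation_cong)
      fix t assume "t < N"
      from that[OF this] show "lookup n (2 * t) - 1 = the (pattern_decode n (int t))"
        by (auto simp: lookup_eq i)
    qed
    have "(\<forall>t<N. lookup n (2 * t) \<noteq> 0) \<and> violation N (\<lambda>t. lookup n (2 * t) - 1) s g k \<longleftrightarrow>
        (\<forall>t<N. pattern_decode n (int t) \<noteq> None) \<and> violation N (\<lambda>t. the (pattern_decode n (int t))) s g k"
      for N s g k unfolding a using b by (intro conj_cong) simp_all
    then show ?thesis unfolding forbidden_def patterns_decode mem_Collect_eq by simp
  qed
  have p: "computable (\<lambda>x. p (f x))" if "computable f" for f by (rule computable_comp[OF comp_p that])
  have free: "decidable (\<lambda>x. free (f x) (g x))" if "computable f" "computable g" for f g
    using decidable_comp[OF dec_free, of "\<lambda>x. pr (f x) (g x)"] that by (simp add: comp_intros)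
  have R: "decidable (\<lambda>x. R (f x) (g x))" if "computable f" "computable g" for f g
    using decidable_comp[OF dec_R, of "\<lambda>x. pr (f x) (g x)"] that by (simp add: comp_intros)
  have "sigma1 (\<lambda>n. pattern_decode n \<in> forbidden)"
    unfolding eq violation_def
    by (intro sigma1_rules(2) sigma1_rules(1)) (intro comp_intros p free R)
  then have "comp_enum_patterns forbidden"
    unfolding comp_enum_patterns_def by (rule comp_enum_sigma1)
  then show ?thesis unfolding effective_subshift_def by (intro exI[of _ forbidden]) (auto simp: forbidden_def)
qed

lemma gapless_good: "(\<And>t. f t \<le> S) \<Longrightarrow> (\<And>s g. \<not> gap f s g) \<Longrightarrow> good f"
  unfolding good_def by blast

sublocale nonempty_subshift "{..S}" forbidden X
proof
  have "conf (\<lambda>_. 0) \<in> X" unfolding X_iff by (rule gapless_good) (auto simp: gap_def)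
  then show "X \<noteq> {}" by blast
qed auto

text \<open>One gap determines the whole configuration up to its block and its phase. Only
  nonnegative positions are described, because words are read off there.\<close>

lemma good_periodic:
  assumes "good f" "gap f s g"
  obtains \<rho> B where "\<And>k. \<not> R g k" "\<rho> < p g + g"
    "\<And>y. y < p g \<Longrightarrow> 1 \<le> B y \<and> B y \<le> S \<and> (\<not> free g y \<longrightarrow> B y = 1)"
    "\<And>i. f (int i) = (if (\<rho> + i) mod (p g + g) < p g then B ((\<rho> + i) mod (p g + g)) else 0)"
proof -
  define q where "q = p g + g"
  define u where "u = s + int g + 1"
  have R: "\<And>k. \<not> R g k" and per: "\<And>t. f (t + int q) = f t"
    and B: "\<And>t. t < p g \<Longrightarrow> f (u + int t) \<noteq> 0 \<and> (\<not> free g t \<longrightarrow> f (u + int t) = 1)"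
    using assms unfolding good_def q_def u_def by blast+
  have fS: "f t \<le> S" for t using assms(1) unfolding good_def by blast
  have qpos: "q > 0" unfolding q_def using p_pos[of g] by simp
  have per_mult: "f (t + int q * int k) = f t" for t k
  proof (induction k)
    case (Suc k)
    have "f (t + int q * int (Suc k)) = f ((t + int q * int k) + int q)" by (simp add: algebra_simps)
    then show ?case using per Suc by simp
  qed simp
  have per_int: "f (t + int q * k) = f t" for t k
  proof (cases "k \<ge> 0")
    case True then show ?thesis using per_mult[of t "nat k"] by simp
  next
    case False then show ?thesis using per_mult[of "t + int q * k" "nat (- k)"] by simp
  qed
  \<comment> \<open>A block starts at \<open>u\<close>, so this is the phase of position 0 within
    the period.\<close>
  define \<rho> where "\<rho> = nat ((- u) mod int q)"
  have rho: "int \<rho> = (- u) mod int q" unfolding \<rho>_def using qpos by simp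
  have zero: "f (u + int y) = 0" if y: "p g \<le> y" "y < q" for y
  proof -
    have "f (u + int y) = f (u + int y + int q * (- 1))" by (rule per_int[symmetric])
    also have "u + int y + int q * (- 1) = s + 1 + int (y - p g)"
      using y by (simp add: u_def q_def)
    also have "f \<dots> = 0"
    proof -
      have "y - p g < g" using y unfolding q_def by simp
      then show ?thesis using assms(2) unfolding gap_def by blast
    qed
    finally show ?thesis .
  qed
  have val: "f (int i) = f (u + int ((\<rho> + i) mod q))" for i
  proof -
    have "int ((\<rho> + i) mod q) = (int i - u) mod int q"
      by (simp add: zmod_int rho mod_add_left_eq)
    also have "\<dots> = int i - u + int q * (- ((int i - u) div int q))"
      by (simp add: minus_mult_div_eq_mod[symmetric])
    finally have "u + int ((\<rho> + i) mod q) = int i + int q * (- ((int i - u) div int q))"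
      by simp
    then show ?thesis using per_int[of "int i"] by (simp only:)
  qed
  show ?thesis
  proof (rule that[of \<rho> "\<lambda>y. f (u + int y)"])
    have "int \<rho> < int q" unfolding rho using qpos by (intro pos_mod_bound) simp
    then show "\<rho> < p g + g" unfolding q_def by linarith
    show "f (int i) = (if (\<rho> + i) mod (p g + g) < p g then f (u + int ((\<rho> + i) mod (p g + g))) else 0)" for i
      using val[of i] zero[of "(\<rho> + i) mod q"] qpos unfolding q_def by simp
  qed (use R B fS in \<open>auto simp: Suc_le_eq\<close>)
qed

section \<open>Repeated blocks: many extender sets\<close>

definition repeat :: "nat \<Rightarrow> (nat \<Rightarrow> nat) \<Rightarrow> int \<Rightarrow> nat" where
  "repeat g w t = (let y = nat (t mod int (p g + g)) in if y < p g then w y else 0)"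

lemma repeat_add: "repeat g w (t + int (p g + g) * k) = repeat g w t"
  unfolding repeat_def by simp

lemma repeat_small: "y < p g + g \<Longrightarrow> repeat g w (int y) = (if y < p g then w y else 0)"
  unfolding repeat_def by (simp flip: of_nat_add)

text \<open>The block has no zeros inside, so every gap of the repeated configuration is one of the
  intended separators. Nothing can therefore be misread as a code for a different block
  length.\<close>

lemma gap_repeat:
  assumes w: "\<And>y. y < p g \<Longrightarrow> w y \<noteq> 0" and g: "1 \<le> g" and gap: "gap (repeat g w) s g'"
  shows "g' = g \<and> (\<exists>k. s + int g + 1 = int (p g + g) * k)"
proof -
  let ?q = "p g + g"
  define y where "y = nat (s mod int ?q)"
  define k where "k = s div int ?q"
  have pp: "1 \<le> p g" by (rule p_pos)
  have yq: "y < ?q" using pp pos_mod_bound[of "int ?q" s] unfolding y_def by linarith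
  have s: "s = int y + int ?q * k" unfolding y_def k_def using pp by simp
  have at: "repeat g w (s + int j) = repeat g w (int (y + j))" for j
    using repeat_add[of g w "int (y + j)" k] unfolding s by (simp add: algebra_simps)
  have yp: "y < p g" using gap at[of 0] yq unfolding gap_def by (auto simp: repeat_small split: if_splits)
  have "repeat g w (s + int 1) = 0" using gap unfolding gap_def by (auto dest: spec[of _ 0])
  then have "y + 1 = p g"
    using w[of "y + 1"] yp g repeat_small[of "y + 1" g w] unfolding at by (cases "y + 1 < p g") auto
  then have y: "y = p g - 1" by simp
  have nz: "repeat g w (s + int (g + 1)) \<noteq> 0"
  proof -
    have "repeat g w (s + int (g + 1)) = repeat g w (0 + int ?q * 1)" unfolding at y using pp by simp
    also have "\<dots> = w 0" unfolding repeat_add using repeat_small[of 0 g w] pp by simp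
    finally show ?thesis using w[of 0] pp by simp
  qed
  have z: "repeat g w (s + int (j + 1)) = 0" if "j < g" for j
    unfolding at y using repeat_small[of "p g - 1 + (j + 1)" g w] that pp by simp
  have "g' = g"
  proof (rule ccontr)
    assume "g' \<noteq> g"
    then consider "g' < g" | "g < g'" by linarith
    then show False
    proof cases
      case 1
      then show False using z[of g'] gap unfolding gap_def by (simp add: ac_simps)
    next
      case 2
      then have "repeat g w (s + 1 + int g) = 0" using gap unfolding gap_def by blast
      then show False using nz by (simp add: algebra_simps)
    qed
  qed
  moreover have "s + int g + 1 = int ?q * (k + 1)" unfolding s y using pp by (simp add: algebra_simps of_nat_diff)
  ultimately show ?thesis by blast
qed

definition block_words :: "nat \<Rightarrow> (nat \<Rightarrow> nat) set" where
  "block_words g = PiE {..<p g} (\<lambda>i. if free g i then {1..S} else {1})"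

lemma card_block_words: "card (block_words g) = S ^ card {i. i < p g \<and> free g i}"
proof -
  have "card (block_words g) = (\<Prod>i<p g. card (if free g i then {1..S} else {1 :: nat}))"
    unfolding block_words_def by (rule card_PiE) simp
  also have "\<dots> = (\<Prod>i<p g. if free g i then S else 1)" by (intro prod.cong) auto
  also have "\<dots> = S ^ card {i \<in> {..<p g}. free g i}"
    by (simp add: prod.If_cases Int_def)
  finally show ?thesis by simp
qed

lemma good_repeat:
  assumes R: "\<And>k. \<not> R g k" and w: "w \<in> block_words g"
  shows "good (repeat g w)"
proof -
  have g: "1 \<le> g" using p_le[OF R] p_pos[of g] by simp
  have wv: "1 \<le> w y \<and> w y \<le> S \<and> (\<not> free g y \<longrightarrow> w y = 1)" if "y < p g" for y
    using w that S_pos unfolding block_words_def PiE_iff by (cases "free g y") (auto dest!: bspec[of _ _ y])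
  show ?thesis unfolding good_def
  proof (intro conjI allI impI)
    show "repeat g w t \<le> S" for t unfolding repeat_def Let_def using wv by auto
    fix s g' assume "gap (repeat g w) s g'"
    have "w y \<noteq> 0" if "y < p g" for y using wv[OF that] by simp
    from gap_repeat[OF this g \<open>gap (repeat g w) s g'\<close>]
    obtain k where g': "g' = g" and k: "s + int g + 1 = int (p g + g) * k" by blast
    show "\<not> R g' k" for k unfolding g' by (rule R)
    show "repeat g w (t + int (p g' + g')) = repeat g w t" for t
      unfolding g' using repeat_add[of g w t 1] by simp
    fix t assume t: "t < p g'"
    have "repeat g w (s + int g' + 1 + int t) = w t"
      using repeat_add[of g w "int t" k] repeat_small[of t g w] t unfolding g' k by (simp add: algebra_simps)
    with wv[of t] t show "repeat g w (s + int g' + 1 + int t) \<noteq> 0"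
      "\<not> free g' t \<Longrightarrow> repeat g w (s + int g' + 1 + int t) = 1" unfolding g' by auto
  qed
qed

text \<open>The surroundings of a block contain a copy of it, so that they tell different blocks apart.\<close>

lemma card_block_words_le:
  assumes R: "\<And>k. \<not> R g k" shows "card (block_words g) \<le> N (p g)"
proof (rule card_inj_on_le)
  have pg: "1 \<le> p g" "p g \<le> g" using p_le[OF R] p_pos[of g] by auto
  have self: "glue (repeat g w) (p g) w = repeat g w" for w
    by (rule glue_self) (simp add: repeat_small)
  show "E (p g) ` block_words g \<subseteq> extender_sets {..S} X (p g)"
  proof (clarify)
    fix w assume w: "w \<in> block_words g"
    have "occurs (p g) w" unfolding occurs_def X_iff
      using good_repeat[OF R w] by (intro exI[of _ "repeat g w"]) (simp add: repeat_small)
    then show "E (p g) w \<in> extender_sets {..S} X (p g)" unfolding extender_sets_eq by blast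
  qed
  show "inj_on (E (p g)) (block_words g)"
  proof (rule inj_onI)
    fix w w' assume w: "w \<in> block_words g" "w' \<in> block_words g" and eq: "E (p g) w = E (p g) w'"
    let ?f = "repeat g w"
    let ?f' = "glue ?f (p g) w'"
    have good: "good ?f" by (rule good_repeat[OF R w(1)])
    have wnz: "w y \<noteq> 0" if "y < p g" for y
      using w(1) that unfolding block_words_def PiE_iff by (auto dest!: bspec[of _ _ y] split: if_splits)
    have "conf (glue ?f (p g) w) \<in> X" unfolding self X_iff by (rule good)
    then have good': "good ?f'" using E_eqD[OF eq, of ?f] good unfolding X_iff good_def by blast
    \<comment> \<open>The last cell of the second copy of the block. The gap after it lies outside
      the window where \<open>w\<close> is replaced, so it survives the replacement and its period
      forces the window to equal the second copy.\<close>
    define s where "s = int (p g + g + p g - 1)"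
    have out: "?f' (s + int j) = ?f (int (p g - 1 + j))" for j
    proof -
      have "?f' (s + int j) = ?f (int (p g - 1 + j) + int (p g + g) * 1)"
        using pg unfolding s_def glue_def by (auto simp: algebra_simps of_nat_diff)
      then show ?thesis unfolding repeat_add .
    qed
    have "gap ?f' s g" unfolding gap_def
    proof (intro conjI allI impI)
      show "?f' s \<noteq> 0" using out[of 0] wnz[of "p g - 1"] repeat_small[of "p g - 1" g w] pg by simp
      show "?f' (s + 1 + int t) = 0" if "t < g" for t
        using out[of "Suc t"] repeat_small[of "p g - 1 + Suc t" g w] that pg by (simp add: add.assoc)
      have "?f' (s + int (g + 1)) = ?f (0 + int (p g + g) * 1)" unfolding out using pg by simp
      also have "\<dots> = w 0" unfolding repeat_add using repeat_small[of 0 g w] pg by simp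
      finally show "?f' (s + int g + 1) \<noteq> 0" using wnz[of 0] pg by (simp add: ac_simps)
    qed (use pg in simp)
    then have per: "?f' (t + int (p g + g)) = ?f' t" for t
      using good' unfolding good_def by blast
    have "w y = w' y" if y: "y < p g" for y
    proof -
      have "w' y = ?f' (int y + int (p g + g))" unfolding per using y by simp
      also have "\<dots> = ?f (int y + int (p g + g) * 1)" using pg by (simp add: glue_def)
      also have "\<dots> = w y" unfolding repeat_add using y by (simp add: repeat_small)
      finally show ?thesis by simp
    qed
    then show "w = w'"
      using w unfolding block_words_def by (intro PiE_ext[of w "{..<p g}" _ w']) auto
  qed
qed (rule finite_extender_sets)

section \<open>Words that never see a gap: few extender sets\<close>

definition gap_words :: "nat \<Rightarrow> (nat \<Rightarrow> nat) set" where
  "gap_words n = {u \<in> extensional {..<n}. \<exists>f s g. good f \<and> gap f s g \<and> (\<forall>i<n. f (int i) = u i)}"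

text \<open>If no good completion has a gap, then a completion is good exactly when it has no gap at
  all, and this depends only on where the zeros are.\<close>

lemma gapless_E:
  assumes "occurs n u" "occurs n v"
    and u: "\<And>f s g. good f \<Longrightarrow> (\<forall>i<n. f (int i) = u i) \<Longrightarrow> \<not> gap f s g"
    and v: "\<And>f s g. good f \<Longrightarrow> (\<forall>i<n. f (int i) = v i) \<Longrightarrow> \<not> gap f s g"
    and supp: "\<And>i. i < n \<Longrightarrow> u i = 0 \<longleftrightarrow> v i = 0"
  shows "E n u = E n v"
  unfolding E_eq_iff X_iff
proof (intro allI impI)
  fix f :: "int \<Rightarrow> nat" assume f: "\<forall>t. f t \<in> {..S}"
  have iff: "good (glue f n u) \<longleftrightarrow> (\<forall>s g. \<not> gap (glue f n u) s g)"
    if oc: "occurs n u" and u: "\<And>f s g. good f \<Longrightarrow> (\<forall>i<n. f (int i) = u i) \<Longrightarrow> \<not> gap f s g" for u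
  proof
    assume "\<forall>s g. \<not> gap (glue f n u) s g"
    moreover have "glue f n u t \<le> S" for t
      using glue_in[of f "{..S}" n u t] f occurs_in[OF oc] by auto
    ultimately show "good (glue f n u)" by (intro gapless_good) auto
  qed (use u in auto)
  have "glue f n u t = 0 \<longleftrightarrow> glue f n v t = 0" for t
    using supp[of "nat t"] by (auto simp: glue_def)
  then have "gap (glue f n u) s g \<longleftrightarrow> gap (glue f n v) s g" for s g unfolding gap_def by simp
  moreover have "good (glue f n u) \<longleftrightarrow> (\<forall>s g. \<not> gap (glue f n u) s g)"
    by (rule iff[OF assms(1)]) (rule u)
  moreover have "good (glue f n v) \<longleftrightarrow> (\<forall>s g. \<not> gap (glue f n v) s g)"
    by (rule iff[OF assms(2)]) (rule v)
  ultimately show "good (glue f n u) \<longleftrightarrow> good (glue f n v)" by simp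
qed

text \<open>By convexity the nonzero part of a word without gaps is an interval with one of at most
  \<open>(n + 1) ^ 2\<close> pairs of endpoints, and by \<open>gapless_E\<close> the endpoints
  determine the extender set. All remaining words are counted one by one.\<close>

lemma N_le_gap_words:
  assumes "finite (gap_words n)" shows "N n \<le> (n + 1) ^ 2 + card (gap_words n)"
proof -
  define gl where "gl u \<longleftrightarrow> occurs n u \<and> (\<forall>f s g. good f \<longrightarrow> (\<forall>i<n. f (int i) = u i) \<longrightarrow> \<not> gap f s g)" for u
  \<comment> \<open>Any representative with the given interval will do, since all of them share one
    extender set.\<close>
  define \<Psi> where "\<Psi> = (\<lambda>(a, b). E n (SOME u. gl u \<and> (\<forall>i<n. u i \<noteq> 0 \<longleftrightarrow> a \<le> i \<and> i < b)))"
  have "extender_sets {..S} X n \<subseteq> \<Psi> ` ({..n} \<times> {..n}) \<union> E n ` gap_words n"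
  proof
    fix Z assume "Z \<in> extender_sets {..S} X n"
    then obtain u where u: "occurs n u" "Z = E n u" unfolding extender_sets_eq by blast
    show "Z \<in> \<Psi> ` ({..n} \<times> {..n}) \<union> E n ` gap_words n"
    proof (cases "gl u")
      case True
      obtain f where f: "good f" "\<And>i. i < n \<Longrightarrow> f (int i) = u i"
        using u(1) unfolding occurs_def X_iff by blast
      then have nogap: "\<not> gap f s g" for s g using True unfolding gl_def by blast
      have convex: "u j \<noteq> 0" if "i < j" "j < k" "k < n" "u i \<noteq> 0" "u k \<noteq> 0" for i j k
        using no_gap_convex[of f "int i" "int k" "int j", OF nogap] that f(2)[of i] f(2)[of j] f(2)[of k] by simp
      have "\<exists>a b. a \<le> n \<and> b \<le> n \<and> (\<forall>i<n. u i \<noteq> 0 \<longleftrightarrow> a \<le> i \<and> i < b)"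
      proof (cases "\<exists>i<n. u i \<noteq> 0")
        case False then show ?thesis by (intro exI[of _ 0]) auto
      next
        case True
        let ?M = "{i. i < n \<and> u i \<noteq> 0}"
        have fin: "finite ?M" and ne: "?M \<noteq> {}" using True by auto
        have mi: "Min ?M \<in> ?M" and ma: "Max ?M \<in> ?M" using Min_in[OF fin ne] Max_in[OF fin ne] by auto
        have "u i \<noteq> 0 \<longleftrightarrow> Min ?M \<le> i \<and> i < Suc (Max ?M)" if "i < n" for i
        proof
          assume "u i \<noteq> 0" then show "Min ?M \<le> i \<and> i < Suc (Max ?M)"
            using that Min_le[OF fin, of i] Max_ge[OF fin, of i] by (simp add: less_Suc_eq_le)
        next
          assume "Min ?M \<le> i \<and> i < Suc (Max ?M)"
          then consider "i = Min ?M" | "i = Max ?M" | "Min ?M < i" "i < Max ?M" by linarith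
          then show "u i \<noteq> 0" using mi ma convex[of "Min ?M" i "Max ?M"] by cases auto
        qed
        moreover have "Min ?M \<le> n" "Suc (Max ?M) \<le> n" using mi ma by (auto simp: Suc_le_eq)
        ultimately show ?thesis by blast
      qed
      then obtain a b where ab: "a \<le> n" "b \<le> n" "\<forall>i<n. u i \<noteq> 0 \<longleftrightarrow> a \<le> i \<and> i < b" by blast
      let ?P = "\<lambda>v. gl v \<and> (\<forall>i<n. v i \<noteq> 0 \<longleftrightarrow> a \<le> i \<and> i < b)"
      define v where "v = (SOME v. ?P v)"
      have "?P v" unfolding v_def by (rule someI[of ?P u]) (use True ab in auto)
      then have v: "gl v" "\<And>i. i < n \<Longrightarrow> v i \<noteq> 0 \<longleftrightarrow> a \<le> i \<and> i < b" by auto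
      have "E n u = E n v"
      proof (rule gapless_E)
        show "u i = 0 \<longleftrightarrow> v i = 0" if "i < n" for i using ab(3) v(2)[OF that] that by blast
      qed (use True v(1) in \<open>unfold gl_def, blast+\<close>)
      then have "E n u = E n (SOME v. ?P v)" unfolding v_def .
      then have "Z = \<Psi> (a, b)" unfolding \<Psi>_def u(2) by simp
      then show ?thesis using ab(1,2) by blast
    next
      case False
      then obtain f s g where fsg: "good f" "\<forall>i<n. f (int i) = u i" "gap f s g"
        using u(1) unfolding gl_def by blast
      have "restrict u {..<n} \<in> gap_words n" unfolding gap_words_def using fsg by auto
      moreover have "E n u = E n (restrict u {..<n})"
        unfolding E_eq_iff using glue_cong[of n u "restrict u {..<n}"] by simp
      ultimately show ?thesis unfolding u(2) by blast
    qed
  qed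
  then have "N n \<le> card (\<Psi> ` ({..n} \<times> {..n}) \<union> E n ` gap_words n)"
    using assms by (intro card_mono) auto
  also have "\<dots> \<le> card (\<Psi> ` ({..n} \<times> {..n})) + card (E n ` gap_words n)" by (rule card_Un_le)
  also have "card (\<Psi> ` ({..n} \<times> {..n})) \<le> card ({..n} \<times> {..n})" by (intro card_image_le) auto
  also have "card (E n ` gap_words n) \<le> card (gap_words n)" using assms by (intro card_image_le)
  finally show ?thesis by (simp add: card_cartesian_product power2_eq_square)
qed

end

subsection \<open>Bit reversal\<close>

text \<open>Reads the lowest \<open>m\<close> bits of \<open>t\<close> in reverse order, as in the
  van der Corput sequence: the set \<open>bitrev m t < c\<close> has exactly \<open>c\<close>
  elements in each 2^m consecutive integers.\<close>

primrec bitrev :: "nat \<Rightarrow> nat \<Rightarrow> nat" where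
  "bitrev 0 t = 0"
| "bitrev (Suc m) t = 2 * bitrev m t + t div 2 ^ m mod 2"

lemma computable_bitrev [comp_intros]:
  assumes "computable f" "computable g" shows "computable (\<lambda>x. bitrev (f x) (g x))"
proof -
  have "bitrev m t = rec_nat 0 (\<lambda>i y. 2 * y + t div 2 ^ i mod 2) m" for m t
    by (induction m) auto
  then show ?thesis by (simp only:) (intro comp_intros assms computable_comp[OF assms(2)])
qed

lemma bitrev_less: "bitrev m t < 2 ^ m"
  by (induction m) auto

lemma bitrev_eq_iff: "bitrev m t = bitrev m s \<longleftrightarrow> t mod 2 ^ m = s mod 2 ^ m"
proof (induction m)
  case (Suc m)
  have split: "x mod 2 ^ Suc m = 2 ^ m * (x div 2 ^ m mod 2) + x mod 2 ^ m" for x :: nat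
    by (metis mod_mult2_eq power_Suc2)
  have "bitrev (Suc m) t = bitrev (Suc m) s \<longleftrightarrow> bitrev m t = bitrev m s \<and> t div 2 ^ m mod 2 = s div 2 ^ m mod 2"
  proof -
    have "2 * x + y = 2 * x' + y' \<longleftrightarrow> x = x' \<and> y = y'" if "y < 2" "y' < 2" for x y x' y' :: nat
      using that by arith
    then show ?thesis by simp
  qed
  also have "\<dots> \<longleftrightarrow> t mod 2 ^ m = s mod 2 ^ m \<and> t div 2 ^ m mod 2 = s div 2 ^ m mod 2"
    using Suc by simp
  also have "\<dots> \<longleftrightarrow> t mod 2 ^ Suc m = s mod 2 ^ Suc m"
  proof
    assume eq: "t mod 2 ^ Suc m = s mod 2 ^ Suc m"
    have *: "x mod 2 ^ Suc m mod 2 ^ m = x mod 2 ^ m" "x mod 2 ^ Suc m div 2 ^ m = x div 2 ^ m mod 2" for x :: nat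
      unfolding split by simp_all
    show "t mod 2 ^ m = s mod 2 ^ m \<and> t div 2 ^ m mod 2 = s div 2 ^ m mod 2"
      using *[of t] *[of s] eq by simp
  qed (simp only: split)
  finally show ?case .
qed simp

text \<open>The source of the nesting: the leading bits of the level-\<open>l\<close> reversal form
  the level-\<open>i\<close> reversal, so \<open>bitrev l t < c\<close> implies
  \<open>bitrev i t \<le> c div 2 ^ (l - i)\<close>.\<close>

lemma bitrev_div: "i \<le> l \<Longrightarrow> bitrev l t div 2 ^ (l - i) = bitrev i t"
proof (induction l)
  case (Suc l)
  show ?case
  proof (cases "i = Suc l")
    case False
    then have "bitrev (Suc l) t div 2 ^ (Suc l - i) = bitrev (Suc l) t div 2 div 2 ^ (l - i)"
      using Suc.prems by (simp add: Suc_diff_le div_mult2_eq)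
    also have "bitrev (Suc l) t div 2 = bitrev l t" by simp
    finally show ?thesis using Suc False by simp
  qed simp
qed simp

lemma inj_on_mod_interval: "inj_on (\<lambda>t. (a + t) mod q) {b..<b + q}" for a b q :: nat
proof (rule linorder_inj_onI)
  fix s t assume st: "s < t" "s \<in> {b..<b + q}" "t \<in> {b..<b + q}"
  show "(a + s) mod q \<noteq> (a + t) mod q"
  proof
    assume "(a + s) mod q = (a + t) mod q"
    then have "q dvd (a + t) - (a + s)" using st(1) by (metis mod_eq_dvd_iff_nat nat_add_left_cancel_le less_imp_le)
    then have "q dvd t - s" by simp
    then show False using st by (auto dest!: dvd_imp_le)
  qed
qed auto

text \<open>In 2^i consecutive integers every residue, hence every reversed value, occurs once. The
  offset \<open>a\<close> is there because a window may begin anywhere in a block.\<close>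

lemma card_bitrev:
  assumes "c \<le> 2 ^ i" shows "card {t. t < 2 ^ i * M \<and> bitrev i (a + t) < c} = M * c"
proof (induction M)
  case (Suc M)
  let ?b = "2 ^ i * M"
  let ?I = "{?b..<?b + 2 ^ i}"
  let ?f = "\<lambda>t. bitrev i (a + t)"
  have inj: "inj_on ?f ?I"
    using inj_on_mod_interval[of a "2 ^ i" ?b] unfolding inj_on_def bitrev_eq_iff by blast
  have "?f ` ?I \<subseteq> {..<2 ^ i}" using bitrev_less by auto
  moreover have "card (?f ` ?I) = card {..<(2::nat) ^ i}" using card_image[OF inj] by simp
  ultimately have im: "?f ` ?I = {..<2 ^ i}" by (intro card_subset_eq) auto
  have "?f ` {t \<in> ?I. ?f t < c} = {..<c}"
  proof
    show "{..<c} \<subseteq> ?f ` {t \<in> ?I. ?f t < c}"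
    proof
      fix y assume "y \<in> {..<c}"
      then have "y \<in> ?f ` ?I" "y < c" unfolding im using assms by auto
      then show "y \<in> ?f ` {t \<in> ?I. ?f t < c}" by blast
    qed
  qed auto
  moreover have "card (?f ` {t \<in> ?I. ?f t < c}) = card {t \<in> ?I. ?f t < c}"
    by (intro card_image inj_on_subset[OF inj]) blast
  ultimately have "card {t \<in> ?I. ?f t < c} = c" by (metis card_lessThan)
  moreover have "{t. t < 2 ^ i * Suc M \<and> ?f t < c} = {t. t < ?b \<and> ?f t < c} \<union> {t \<in> ?I. ?f t < c}"
    by auto
  moreover have "{t. t < ?b \<and> ?f t < c} \<inter> {t \<in> ?I. ?f t < c} = {}" by auto
  ultimately show ?case using Suc by (simp add: card_Un_disjoint)
qed simp

lemma card_bitrev_le: "card {t. t < 2 ^ i * M \<and> bitrev i (a + t) \<le> c} \<le> M * Suc c"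
proof -
  \<comment> \<open>A bound \<open>c\<close> beyond the range of \<open>bitrev\<close> is capped to
    satisfy the assumption of \<open>card_bitrev\<close>.\<close>
  have eq: "{t. t < 2 ^ i * M \<and> bitrev i (a + t) \<le> c} = {t. t < 2 ^ i * M \<and> bitrev i (a + t) < min (Suc c) (2 ^ i)}"
    using bitrev_less by (auto simp: less_Suc_eq_le)
  have "card {t. t < 2 ^ i * M \<and> bitrev i (a + t) \<le> c} = M * min (Suc c) (2 ^ i)"
    unfolding eq by (rule card_bitrev) simp
  also have "\<dots> \<le> M * Suc c" by (rule mult_le_mono2) simp
  finally show ?thesis .
qed

text \<open>The exponent is quadratic so that consecutive lengths differ by an unbounded factor
  (\<open>plen_pred\<close>), while \<open>2 ^ i\<close> still divides the length
  (\<open>plen_split\<close>).\<close>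

definition plen :: "nat \<Rightarrow> nat" where "plen i = 2 ^ (i * i)"

lemma plen_mono: "i \<le> j \<Longrightarrow> plen i \<le> plen j"
  unfolding plen_def by (intro power_increasing mult_le_mono) auto

lemma plen_pos: "1 \<le> plen i"
  unfolding plen_def by simp

lemma plen_split: "plen i = 2 ^ i * 2 ^ (i * i - i)"
proof -
  have "i * i = i + (i * i - i)" by (cases i) auto
  then show ?thesis unfolding plen_def by (metis power_add)
qed

lemma plen_ge: "i \<ge> 1 \<Longrightarrow> 2 ^ i \<le> plen i"
  unfolding plen_def by (intro power_increasing) auto

lemma plen_pred: "plen i * 2 ^ Suc i \<le> plen (Suc i)"
  unfolding plen_def power_add[symmetric] by (intro power_increasing) auto

lemma strict_mono_plen: "strict_mono plen"
  unfolding strict_mono_Suc_iff plen_def by (intro allI power_strict_increasing) auto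

text \<open>Trailing zeros make the code as large as desired without changing the listed witnesses;
  a claim thus has gap lengths that are not below the block length.\<close>

lemma ex_nthc_ge: "\<exists>J\<ge>B. \<forall>i<n. nthc J i = f i"
proof (intro exI conjI allI impI)
  let ?xs = "map f [0..<n] @ replicate B 0"
  show "B \<le> list_encode ?xs" using length_list_decode_le[of "list_encode ?xs"] by simp
  show "nthc (list_encode ?xs) i = f i" if "i < n" for i
    using that by (subst nthc_eq) (auto simp: nth_append)
qed

subsection \<open>Realising a real number as an extender entropy\<close>

text \<open>A gap length codes a level \<open>l\<close>, a numerator \<open>c\<close> and a list \<open>J\<close>.  The free positions of the
  block have density \<open>c / 2 ^ l\<close>, and the code is refuted unless \<open>K * c / 2 ^ l\<close> is a lower bound of
  the numbers \<open>\<beta> i (J ! i) k\<close> for all \<open>i \<le> l\<close> and all \<open>k\<close>.\<close>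

abbreviation lev :: "nat \<Rightarrow> nat" where "lev g \<equiv> fs g"
abbreviation num :: "nat \<Rightarrow> nat" where "num g \<equiv> fs (sn g)"
abbreviation wit :: "nat \<Rightarrow> nat \<Rightarrow> nat" where "wit g i \<equiv> nthc (sn (sn g)) i"

locale realisation =
  fixes P Q :: "nat \<Rightarrow> nat \<Rightarrow> nat \<Rightarrow> nat" and K :: nat and \<alpha> :: real
    and b :: "nat \<Rightarrow> nat \<Rightarrow> nat \<Rightarrow> real"
  assumes compP: "computable3 P" and compQ: "computable3 Q"
    and b_def: "b i j k = of_int (int_decode (P i j k)) / of_nat (Suc (Q i j k))"
    and \<alpha>_eq: "ereal \<alpha> = (INF i. SUP j. INF k. ereal (b i j k))"
    and \<alpha>_nonneg: "0 \<le> \<alpha>" and K: "\<alpha> \<le> real K" "1 \<le> K"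
begin

text \<open>The claimed inequality multiplied out, so that only natural numbers are compared. The
  first disjunct refutes gaps that are shorter than their block.\<close>

definition refuted :: "nat \<Rightarrow> nat \<Rightarrow> bool" where
  "refuted g k \<longleftrightarrow> g < plen (lev g) \<or>
     (\<exists>i<Suc (lev g). ppos (P i (wit g i) k) * 2 ^ lev g <
        num g * K * Suc (Q i (wit g i) k) + pneg (P i (wit g i) k) * 2 ^ lev g)"

lemma not_refuted_iff:
  "\<not> refuted g k \<longleftrightarrow> plen (lev g) \<le> g \<and> (\<forall>i\<le>lev g. real (num g * K) / 2 ^ lev g \<le> b i (wit g i) k)"
proof -
  have "ppos x * 2 ^ l < c * Suc q + pneg x * 2 ^ l \<longleftrightarrow> \<not> real c / 2 ^ l \<le> of_int (int_decode x) / of_nat (Suc q)"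
    for x q c l
  proof -
    have "ppos x * 2 ^ l < c * Suc q + pneg x * 2 ^ l \<longleftrightarrow>
        real (ppos x * 2 ^ l) < real (c * Suc q + pneg x * 2 ^ l)" by (rule of_nat_less_iff[symmetric])
    also have "\<dots> \<longleftrightarrow> (real (ppos x) - real (pneg x)) * 2 ^ l < real c * real (Suc q)"
      by (simp add: algebra_simps)
    also have "real (ppos x) - real (pneg x) = of_int (int_decode x)"
      unfolding int_decode_ppos_pneg by simp
    also have "of_int (int_decode x) * 2 ^ l < real c * real (Suc q) \<longleftrightarrow>
        \<not> real c / 2 ^ l \<le> of_int (int_decode x) / of_nat (Suc q)"
      by (simp add: field_simps not_le del: of_nat_Suc)
    finally show ?thesis .
  qed
  then show ?thesis unfolding refuted_def b_def by (auto simp: less_Suc_eq_le not_less simp del: of_nat_mult of_nat_Suc)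
qed

text \<open>The 2^K nonzero symbols give \<open>K\<close> bits to each free position, and 0 is kept
  for the gaps.\<close>

sublocale block_shift "2 ^ K" "\<lambda>g. plen (lev g)" "\<lambda>g t. bitrev (lev g) t < num g" refuted
proof
  show "plen (lev g) \<le> g" if "\<And>k. \<not> refuted g k" for g
    using that[of 0] unfolding not_refuted_iff by blast
  show "computable (\<lambda>g. plen (lev g))" unfolding plen_def by (intro comp_intros)
  show "decidable (\<lambda>z. bitrev (lev (fs z)) (sn z) < num (fs z))" by (intro comp_intros)
  show "decidable (\<lambda>z. refuted (fs z) (sn z))"
    unfolding refuted_def plen_def by (intro comp_intros computable3_comp[OF compP] computable3_comp[OF compQ])
qed (use plen_pos in \<open>simp_all del: One_nat_def\<close>)

abbreviation h :: real where "h \<equiv> extender_entropy {..2 ^ K} X"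

lemma plen_limit: "(\<lambda>i. log 2 (real (N (plen i))) / real (plen i)) \<longlonglongrightarrow> h"
  using LIMSEQ_subseq_LIMSEQ[OF entropy_limit strict_mono_plen] by (simp add: comp_def)

text \<open>For each level \<open>i\<close> the best claim strictly below \<open>\<alpha>\<close> is
  true and has witnesses, and its blocks alone supply enough extender sets. The case
  \<open>\<alpha> = 0\<close> is separate because no claim lies strictly below 0.\<close>

lemma entropy_ge:
  assumes "0 < \<epsilon>" shows "\<alpha> - \<epsilon> \<le> h"
proof (cases "\<alpha> = 0")
  case True then show ?thesis using assms entropy_nonneg by simp
next
  case False
  then have apos: "\<alpha> > 0" using \<alpha>_nonneg by simp
  have Kpos: "real K > 0" using K by simp
  obtain i0 where i0: "real K / 2 ^ i0 < \<epsilon>"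
    using real_arch_pow_inv[of "\<epsilon> / real K" "1 / 2"] assms Kpos
    by (auto simp: field_simps power_one_over)
  show ?thesis
  proof (rule LIMSEQ_le_const[OF plen_limit], intro exI allI impI)
    fix i assume i: "i0 \<le> i"
    have "real K / 2 ^ i \<le> real K / 2 ^ i0" using i Kpos by (intro divide_left_mono power_increasing) auto
    with i0 have Ki: "real K / 2 ^ i < \<epsilon>" by simp
    \<comment> \<open>The largest integer strictly below \<open>\<alpha> * 2 ^ i / K\<close>; one
      step of the grid costs \<open>K / 2 ^ i\<close>.\<close>
    define c where "c = nat (\<lceil>\<alpha> * 2 ^ i / real K\<rceil> - 1)"
    have "0 < \<alpha> * 2 ^ i / real K" using apos Kpos by simp
    then have rc: "real c = of_int \<lceil>\<alpha> * 2 ^ i / real K\<rceil> - 1" unfolding c_def by simp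
    have c: "real c < \<alpha> * 2 ^ i / real K" "\<alpha> * 2 ^ i / real K - 1 \<le> real c"
      unfolding rc by linarith+
    have c1: "real (c * K) / 2 ^ i < \<alpha>" using c(1) Kpos by (simp add: field_simps)
    have c2: "\<alpha> - \<epsilon> \<le> real (c * K) / 2 ^ i"
    proof -
      have "\<alpha> * 2 ^ i \<le> real (c * K) + real K" using c(2) Kpos by (simp add: field_simps)
      then have "\<alpha> \<le> (real (c * K) + real K) / 2 ^ i" by (simp add: pos_le_divide_eq)
      then have "\<alpha> \<le> real (c * K) / 2 ^ i + real K / 2 ^ i" by (simp only: add_divide_distrib)
      then show ?thesis using Ki by linarith
    qed
    have c3: "c \<le> 2 ^ i"
    proof -
      have "\<alpha> * 2 ^ i / real K \<le> 2 ^ i" using K Kpos by (simp add: field_simps)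
      also have "2 ^ i = real (2 ^ i)" by simp
      finally have "real c \<le> real (2 ^ i)" using c(1) by linarith
      then show ?thesis by (simp only: of_nat_le_iff)
    qed
    \<comment> \<open>Strictness matters here: the supremum over \<open>j\<close> need not be
      attained, but some \<open>j\<close> exceeds any number strictly below it.\<close>
    have "\<exists>j. \<forall>k. real (c * K) / 2 ^ i \<le> b i' j k" for i'
    proof -
      have "ereal (real (c * K) / 2 ^ i) < ereal \<alpha>" using c1 by simp
      also have "\<dots> \<le> (SUP j. INF k. ereal (b i' j k))" unfolding \<alpha>_eq by (rule INF_lower) simp
      finally obtain j where j: "ereal (real (c * K) / 2 ^ i) < (INF k. ereal (b i' j k))"
        unfolding less_SUP_iff by blast
      have "ereal (real (c * K) / 2 ^ i) \<le> ereal (b i' j k)" for k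
        using j INF_lower[of k UNIV "\<lambda>k. ereal (b i' j k)"] by (metis UNIV_I less_imp_le order_trans)
      then show ?thesis by auto
    qed
    then obtain j where j: "\<And>i' k. real (c * K) / 2 ^ i \<le> b i' (j i') k" by metis
    \<comment> \<open>\<open>J\<close>, and with it the gap length \<open>g\<close>, is made at
      least \<open>plen i\<close>, as \<open>refuted\<close> demands.\<close>
    obtain J where J: "plen i \<le> J" "\<And>i'. i' < Suc i \<Longrightarrow> nthc J i' = j i'"
      using ex_nthc_ge[of "plen i" "Suc i" j] by blast
    define g where "g = pr i (pr c J)"
    have "J \<le> g" unfolding g_def by (meson le_prod_encode_2 order_trans)
    then have R: "\<not> refuted g k" for k
      unfolding not_refuted_iff using J j by (simp add: g_def less_Suc_eq_le)
    define M :: nat where "M = 2 ^ (i * i - i)"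
    have pM: "plen i = 2 ^ i * M" unfolding M_def by (rule plen_split)
    have "card (block_words g) = (2 ^ K) ^ (M * c)"
      unfolding card_block_words using card_bitrev[OF c3, of M 0] by (simp add: g_def pM)
    then have "2 ^ (K * (M * c)) \<le> N (plen i)"
      using card_block_words_le[OF R] by (simp add: g_def power_mult)
    then have "real (2 ^ (K * (M * c))) \<le> real (N (plen i))" by (simp only: of_nat_le_iff)
    then have "log 2 (2 ^ (K * (M * c))) \<le> log 2 (real (N (plen i)))" by (intro log_mono) auto
    then have "real (K * (M * c)) \<le> log 2 (real (N (plen i)))" by (subst (asm) log_nat_power) auto
    then have "real (K * (M * c)) / real (plen i) \<le> log 2 (real (N (plen i))) / real (plen i)"
      by (rule divide_right_mono) simp
    moreover have "real (K * (M * c)) / real (plen i) = real (c * K) / 2 ^ i"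
      unfolding pM by (simp add: M_def)
    ultimately show "\<alpha> - \<epsilon> \<le> log 2 (real (N (plen i))) / real (plen i)" using c2 by linarith
  qed
qed

section \<open>Upper bound: words of configurations with gaps\<close>

definition long_words :: "nat \<Rightarrow> nat \<Rightarrow> (nat \<Rightarrow> nat) set" where
  "long_words i C = (\<Union>\<sigma><2 ^ i. (\<lambda>(a, b, v). restrict (\<lambda>t. if a \<le> t \<and> t < b then v t else 0) {..<plen i}) `
     ({..plen i} \<times> {..plen i} \<times>
      PiE {..<plen i} (\<lambda>t. if bitrev i (\<sigma> + t) \<le> C then {1..2 ^ K} else {1 :: nat})))"

text \<open>A word is given by period, phase and block. Periods stop at
  \<open>plen (i - 1) + plen i + 1\<close> because longer gaps look alike in a window of length
  \<open>plen i\<close>.\<close>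

definition short_words :: "nat \<Rightarrow> (nat \<Rightarrow> nat) set" where
  "short_words i = (\<lambda>(q, \<rho>, v). restrict (\<lambda>t. if (\<rho> + t) mod q < plen (i - 1) then v ((\<rho> + t) mod q) else 0) {..<plen i}) `
     ({..plen (i - 1) + plen i + 1} \<times> {..plen (i - 1) + plen i + 1} \<times> PiE {..<plen (i - 1)} (\<lambda>_. {..2 ^ K}))"

lemma finite_long_words: "finite (long_words i C)"
  unfolding long_words_def by (intro finite_UN_I finite_imageI finite_cartesian_product finite_PiE) auto

lemma finite_short_words: "finite (short_words i)"
  unfolding short_words_def by (intro finite_imageI finite_cartesian_product finite_PiE) auto

lemma card_short_words: "card (short_words i) \<le> (plen (i - 1) + plen i + 2) ^ 2 * (2 ^ K + 1) ^ plen (i - 1)"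
proof -
  have "card (short_words i) \<le> card ({..plen (i - 1) + plen i + 1} \<times> {..plen (i - 1) + plen i + 1} \<times>
      PiE {..<plen (i - 1)} (\<lambda>_. {..2 ^ K :: nat}))"
    unfolding short_words_def by (intro card_image_le finite_cartesian_product finite_PiE) auto
  also have "\<dots> = (plen (i - 1) + plen i + 2) ^ 2 * (2 ^ K + 1) ^ plen (i - 1)"
    by (simp add: card_cartesian_product card_PiE power2_eq_square algebra_simps)
  finally show ?thesis .
qed

lemma card_long_words:
  "card (long_words i C) \<le> 2 ^ i * (plen i + 1) ^ 2 * 2 ^ (K * (2 ^ (i * i - i) * Suc C))"
proof -
  let ?V = "\<lambda>\<sigma>. PiE {..<plen i} (\<lambda>t. if bitrev i (\<sigma> + t) \<le> C then {1..2 ^ K} else {1 :: nat})"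
  let ?B = "(plen i + 1) ^ 2 * 2 ^ (K * (2 ^ (i * i - i) * Suc C))"
  let ?T = "\<lambda>\<sigma>. (\<lambda>(a, b, v). restrict (\<lambda>t. if a \<le> t \<and> t < b then v t else 0) {..<plen i}) `
     ({..plen i} \<times> {..plen i} \<times> ?V \<sigma>)"
  have T: "card (?T \<sigma>) \<le> ?B" for \<sigma>
  proof -
    have "card (?V \<sigma>) = (\<Prod>t<plen i. if bitrev i (\<sigma> + t) \<le> C then 2 ^ K else 1)"
      by (subst card_PiE) (auto intro!: prod.cong)
    also have "\<dots> = (2 ^ K) ^ card {t \<in> {..<plen i}. bitrev i (\<sigma> + t) \<le> C}"
      by (simp add: prod.If_cases Int_def)
    also have "\<dots> = 2 ^ (K * card {t. t < plen i \<and> bitrev i (\<sigma> + t) \<le> C})"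
      by (simp add: power_mult)
    also have "\<dots> \<le> 2 ^ (K * (2 ^ (i * i - i) * Suc C))"
      unfolding plen_split by (intro power_increasing mult_le_mono2 card_bitrev_le) auto
    finally have V: "card (?V \<sigma>) \<le> 2 ^ (K * (2 ^ (i * i - i) * Suc C))" .
    have "card (?T \<sigma>) \<le> card ({..plen i} \<times> {..plen i} \<times> ?V \<sigma>)"
      by (intro card_image_le finite_cartesian_product finite_PiE) auto
    also have "\<dots> = (plen i + 1) ^ 2 * card (?V \<sigma>)"
      by (simp add: card_cartesian_product power2_eq_square algebra_simps)
    also have "\<dots> \<le> ?B" using V by (rule mult_le_mono2)
    finally show ?thesis .
  qed
  have "card (long_words i C) \<le> (\<Sum>\<sigma><2 ^ i. card (?T \<sigma>))"
    unfolding long_words_def by (rule card_UN_le) simp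
  also have "\<dots> \<le> (\<Sum>\<sigma><(2::nat) ^ i. ?B)" by (rule sum_mono) (rule T)
  finally show ?thesis by (simp add: mult.assoc)
qed

text \<open>For levels at least \<open>i\<close>, block and gap are no shorter than the window, so
  it shows one piece of one block, given by its ends \<open>a\<close>, \<open>b\<close>, its phase
  modulo 2^i and its symbols; those are 1 outside the level-\<open>i\<close> set given by
  \<open>C\<close>. For lower levels the block fits into \<open>plen (i - 1)\<close> symbols and is
  listed in full.\<close>

lemma gap_words_subset:
  assumes i: "1 \<le> i"
    and C: "\<And>g. (\<And>k. \<not> refuted g k) \<Longrightarrow> i \<le> lev g \<Longrightarrow> num g div 2 ^ (lev g - i) \<le> C"
  shows "gap_words (plen i) \<subseteq> long_words i C \<union> short_words i"
proof
  define n where "n = plen i"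
  define P where "P = plen (i - 1)"
  fix u assume "u \<in> gap_words (plen i)"
  then obtain f s g where ext: "u \<in> extensional {..<n}" and f: "good f" "gap f s g"
    and fu: "\<And>t. t < n \<Longrightarrow> f (int t) = u t" unfolding gap_words_def n_def by blast
  define p where "p = plen (lev g)"
  define q where "q = p + g"
  obtain \<rho> B where R: "\<And>k. \<not> refuted g k" and \<rho>: "\<rho> < q"
    and B: "\<And>y. y < p \<Longrightarrow> 1 \<le> B y \<and> B y \<le> 2 ^ K \<and> (\<not> bitrev (lev g) y < num g \<longrightarrow> B y = 1)"
    and f_eq: "\<And>t. f (int t) = (if (\<rho> + t) mod q < p then B ((\<rho> + t) mod q) else 0)"
    using good_periodic[OF f] unfolding p_def q_def by metis
  have pg: "p \<le> g" using p_le[OF R] unfolding p_def .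
  have u: "u t = (if (\<rho> + t) mod q < p then B ((\<rho> + t) mod q) else 0)" if "t < n" for t
    using fu[OF that] f_eq by simp
  have mod1: "(\<rho> + t) mod q = \<rho> + t" if "\<rho> + t < q" for t using that by simp
  have mod2: "(\<rho> + t) mod q = \<rho> + t - q" if "q \<le> \<rho> + t" "t < q" for t
    using that \<rho> by (simp add: mod_if)
  have restr: "u = restrict w {..<n}" if "\<And>t. t < n \<Longrightarrow> u t = w t" for w
    using ext that by (intro extensionalityI[of _ "{..<n}"]) auto
  show "u \<in> long_words i C \<union> short_words i"
  proof (cases "i \<le> lev g")
    case True
    have np: "n \<le> p" unfolding n_def p_def using True by (rule plen_mono)
    \<comment> \<open>By \<open>bitrev_div\<close> a free position of the actual level belongs to
      the level-\<open>i\<close> set; hence all else is 1.\<close>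
    have Bone: "B y = 1" if "y < p" "\<not> bitrev i y \<le> C" for y
    proof -
      have "\<not> bitrev (lev g) y < num g"
      proof
        assume "bitrev (lev g) y < num g"
        then have "bitrev (lev g) y div 2 ^ (lev g - i) \<le> num g div 2 ^ (lev g - i)"
          by (intro div_le_mono) simp
        then show False using C[OF R True] bitrev_div[OF True, of y] that(2) by simp
      qed
      then show ?thesis using B[OF that(1)] by blast
    qed
    have intro: "u \<in> long_words i C" if "a \<le> n" "b \<le> n" "\<sigma> < 2 ^ i"
      "\<And>t. t < n \<Longrightarrow> u t = (if a \<le> t \<and> t < b then v t else 0)"
      "\<And>t. t < n \<Longrightarrow> 1 \<le> v t \<and> v t \<le> 2 ^ K \<and> (\<not> bitrev i (\<sigma> + t) \<le> C \<longrightarrow> v t = 1)" for a b \<sigma> v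
    proof -
      have "u = (\<lambda>(a, b, v). restrict (\<lambda>t. if a \<le> t \<and> t < b then v t else 0) {..<plen i}) (a, b, restrict v {..<plen i})"
        unfolding prod.case n_def[symmetric] by (rule restr) (use that(4) in auto)
      moreover have "restrict v {..<plen i} \<in> PiE {..<plen i} (\<lambda>t. if bitrev i (\<sigma> + t) \<le> C then {1..2 ^ K} else {1 :: nat})"
        using that(5) unfolding n_def by auto
      ultimately show ?thesis unfolding long_words_def using that(1-3) unfolding n_def by blast
    qed
    have "u \<in> long_words i C"
    proof (cases "\<rho> < p")
      case rp: True
      show ?thesis
      proof (rule intro[of 0 "min n (p - \<rho>)" "\<rho> mod 2 ^ i" "\<lambda>t. if \<rho> + t < p then B (\<rho> + t) else 1"])
        fix t assume t: "t < n"
        have "\<rho> + t < q" using rp t np pg unfolding q_def by linarith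
        then show "u t = (if 0 \<le> t \<and> t < min n (p - \<rho>) then if \<rho> + t < p then B (\<rho> + t) else 1 else 0)"
          using u[OF t] mod1 t by auto
        have "bitrev i (\<rho> mod 2 ^ i + t) = bitrev i (\<rho> + t)" unfolding bitrev_eq_iff by (rule mod_add_left_eq)
        then show "1 \<le> (if \<rho> + t < p then B (\<rho> + t) else 1) \<and> (if \<rho> + t < p then B (\<rho> + t) else 1) \<le> 2 ^ K \<and>
           (\<not> bitrev i (\<rho> mod 2 ^ i + t) \<le> C \<longrightarrow> (if \<rho> + t < p then B (\<rho> + t) else 1) = 1)"
          using B[of "\<rho> + t"] Bone[of "\<rho> + t"] by auto
      qed auto
    next
      case rp: False
      \<comment> \<open>The window starts in a gap and \<open>a\<close> zeros precede the next
        block. The phase at its start is \<open>- a\<close> modulo 2^i, written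
        \<open>a * (2 ^ i - 1)\<close> to stay in the natural numbers.\<close>
      define a where "a = q - \<rho>"
      have a: "1 \<le> a" "q = \<rho> + a" "a \<le> g" using \<rho> rp unfolding a_def q_def by auto
      show ?thesis
      proof (rule intro[of "min n a" n "a * (2 ^ i - 1) mod 2 ^ i" "\<lambda>t. if a \<le> t then B (t - a) else 1"])
        fix t assume t: "t < n"
        have tq: "t < q" using t np unfolding q_def by linarith
        show "u t = (if min n a \<le> t \<and> t < n then if a \<le> t then B (t - a) else 1 else 0)"
        proof (cases "a \<le> t")
          case True
          then have "(\<rho> + t) mod q = t - a" using mod2[of t] tq a by simp
          moreover have "t - a < p" using t np by linarith
          ultimately show ?thesis using u[OF t] True t by simp
        next
          case False
          then have "(\<rho> + t) mod q = \<rho> + t" using a by (intro mod1) simp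
          then show ?thesis using u[OF t] False t rp by simp
        qed
        have "bitrev i (a * (2 ^ i - 1) mod 2 ^ i + t) = bitrev i (t - a)" if "a \<le> t"
        proof -
          have "a * (2 ^ i - 1) + t = (t - a) + a * 2 ^ i" using that by (simp add: diff_mult_distrib2)
          then have "(a * (2 ^ i - 1) mod 2 ^ i + t) mod 2 ^ i = (t - a) mod 2 ^ i"
            by (simp add: mod_add_left_eq)
          then show ?thesis unfolding bitrev_eq_iff .
        qed
        then show "1 \<le> (if a \<le> t then B (t - a) else 1) \<and> (if a \<le> t then B (t - a) else 1) \<le> 2 ^ K \<and>
           (\<not> bitrev i (a * (2 ^ i - 1) mod 2 ^ i + t) \<le> C \<longrightarrow> (if a \<le> t then B (t - a) else 1) = 1)"
          using B[of "t - a"] Bone[of "t - a"] t np by auto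
      qed auto
    qed
    then show ?thesis by blast
  next
    case False
    have pP: "p \<le> P" unfolding p_def P_def using False by (intro plen_mono) simp
    define Z where "Z y = (if y < p then B y else 0)" for y
    have ZK: "Z y \<le> 2 ^ K" for y unfolding Z_def using B by auto
    have uZ: "u t = Z ((\<rho> + t) mod q)" if "t < n" for t using u[OF that] by (simp add: Z_def)
    have intro: "u \<in> short_words i" if "q' \<le> P + n + 1" "\<rho>' \<le> P + n + 1"
      "\<And>t. t < n \<Longrightarrow> u t = (if (\<rho>' + t) mod q' < P then Z ((\<rho>' + t) mod q') else 0)" for q' \<rho>'
    proof -
      have "u = (\<lambda>(q, \<rho>, v). restrict (\<lambda>t. if (\<rho> + t) mod q < plen (i - 1) then v ((\<rho> + t) mod q) else 0) {..<plen i})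
         (q', \<rho>', restrict Z {..<plen (i - 1)})"
        unfolding prod.case n_def[symmetric] P_def[symmetric] by (rule restr) (use that(3) in auto)
      moreover have "restrict Z {..<plen (i - 1)} \<in> PiE {..<plen (i - 1)} (\<lambda>_. {..2 ^ K})"
        using ZK by auto
      ultimately show ?thesis unfolding short_words_def using that(1,2) unfolding n_def P_def by blast
    qed
    have ZP: "Z y = (if y < P then Z y else 0)" for y using pP by (auto simp: Z_def)
    have "u \<in> short_words i"
    proof (cases "g < n")
      case True
      show ?thesis
      proof (rule intro[of q \<rho>])
        show "u t = (if (\<rho> + t) mod q < P then Z ((\<rho> + t) mod q) else 0)" if "t < n" for t
          using uZ[OF that] ZP by (rule trans)
      qed (use True pP \<rho> in \<open>auto simp: q_def\<close>)
    next
      case gn: False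
      \<comment> \<open>The gap is at least as long as the window, so at most one copy is visible,
        and the unbounded true period can be replaced by \<open>P + n + 1\<close>.\<close>
      show ?thesis
      proof (cases "\<rho> < p")
        case rp: True
        show ?thesis
        proof (rule intro[of "P + n + 1" \<rho>])
          fix t assume t: "t < n"
          have m1: "(\<rho> + t) mod q = \<rho> + t" using rp t gn by (intro mod1) (simp add: q_def)
          have m2: "(\<rho> + t) mod (P + n + 1) = \<rho> + t" using rp t pP by simp
          show "u t = (if (\<rho> + t) mod (P + n + 1) < P then Z ((\<rho> + t) mod (P + n + 1)) else 0)"
            unfolding uZ[OF t] m1 m2 by (rule ZP)
        qed (use rp pP in auto)
      next
        case rp: False
        define a where "a = q - \<rho>"
        have a: "1 \<le> a" "q = \<rho> + a" using \<rho> unfolding a_def by auto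
        \<comment> \<open>If the next block starts beyond the window, its distance is immaterial and
          is cut to \<open>n\<close>, which keeps the new phase above \<open>P\<close> and inside
          the new period.\<close>
        define m where "m = min n a"
        show ?thesis
        proof (rule intro[of "P + n + 1" "P + n + 1 - m"])
          fix t assume t: "t < n"
          show "u t = (if (P + n + 1 - m + t) mod (P + n + 1) < P then Z ((P + n + 1 - m + t) mod (P + n + 1)) else 0)"
          proof (cases "a \<le> t")
            case True
            then have ma: "m = a" unfolding m_def using t by simp
            have "t < q" using t gn unfolding q_def by linarith
            then have m1: "(\<rho> + t) mod q = t - a" using mod2[of t] True a by simp
            have "P + n + 1 - m + t = (t - a) + (P + n + 1)" using True t unfolding ma by simp
            then have "(P + n + 1 - m + t) mod (P + n + 1) = (t - a) mod (P + n + 1)" by (simp only: mod_add_self2)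
            then have m2: "(P + n + 1 - m + t) mod (P + n + 1) = t - a" using t by simp
            show ?thesis unfolding uZ[OF t] m1 m2 by (rule ZP)
          next
            case False
            then have "(\<rho> + t) mod q = \<rho> + t" using a by (intro mod1) simp
            moreover have "t < m" using False t unfolding m_def by simp
            then have "P + n + 1 - m + t < P + n + 1" unfolding m_def by linarith
            then have "(P + n + 1 - m + t) mod (P + n + 1) = P + n + 1 - m + t" by (rule mod_less)
            moreover have "P < P + n + 1 - m + t" unfolding m_def by simp
            ultimately show ?thesis using uZ[OF t] rp by (simp add: Z_def)
          qed
        qed auto
      qed
    qed
    then show ?thesis by blast
  qed
qed

lemma N_le:
  assumes i: "1 \<le> i"
    and C: "\<And>g. (\<And>k. \<not> refuted g k) \<Longrightarrow> i \<le> lev g \<Longrightarrow> num g div 2 ^ (lev g - i) \<le> C"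
  shows "N (plen i) \<le> (plen i + 1) ^ 2 +
     (2 ^ i * (plen i + 1) ^ 2 * 2 ^ (K * (2 ^ (i * i - i) * Suc C)) +
      (plen (i - 1) + plen i + 2) ^ 2 * (2 ^ K + 1) ^ plen (i - 1))"
proof -
  have fin: "finite (long_words i C \<union> short_words i)" using finite_long_words finite_short_words by simp
  have sub: "gap_words (plen i) \<subseteq> long_words i C \<union> short_words i" by (rule gap_words_subset[OF i C])
  have "N (plen i) \<le> (plen i + 1) ^ 2 + card (gap_words (plen i))"
    by (rule N_le_gap_words) (rule finite_subset[OF sub fin])
  also have "card (gap_words (plen i)) \<le> card (long_words i C \<union> short_words i)" by (rule card_mono[OF fin sub])
  also have "\<dots> \<le> card (long_words i C) + card (short_words i)" by (rule card_Un_le)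
  also have "card (long_words i C) \<le> 2 ^ i * (plen i + 1) ^ 2 * 2 ^ (K * (2 ^ (i * i - i) * Suc C))"
    by (rule card_long_words)
  also have "card (short_words i) \<le> (plen (i - 1) + plen i + 2) ^ 2 * (2 ^ K + 1) ^ plen (i - 1)"
    by (rule card_short_words)
  finally show ?thesis by simp
qed

text \<open>The limit is also an infimum, so one length \<open>n = plen i\<close> gives an upper
  bound. Rounding the numerator costs \<open>K / 2 ^ i\<close>, short blocks cost
  \<open>(K + 1) / 2 ^ i\<close>, and the polynomial factors go into the logarithm.\<close>

lemma entropy_le_bound:
  assumes i: "1 \<le> i" and \<delta>: "0 \<le> \<delta>"
    and C: "\<And>g. (\<And>k. \<not> refuted g k) \<Longrightarrow> i \<le> lev g \<Longrightarrow> real (num g * K) / 2 ^ lev g \<le> \<delta>"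
  shows "h \<le> \<delta> + (2 * real K + 1) / 2 ^ i + log 2 (3 * (2 * real (plen i) + 2) ^ 3) / real (plen i)"
proof -
  have Kpos: "real K > 0" using K by simp
  define c where "c = nat \<lfloor>\<delta> * 2 ^ i / real K\<rfloor>"
  have rc: "real c = of_int \<lfloor>\<delta> * 2 ^ i / real K\<rfloor>" unfolding c_def using \<delta> Kpos by simp
  have c: "real c \<le> \<delta> * 2 ^ i / real K" unfolding rc by linarith
  have Cc: "num g div 2 ^ (lev g - i) \<le> c" if "\<And>k. \<not> refuted g k" "i \<le> lev g" for g
  proof -
    have "real (num g div 2 ^ (lev g - i)) \<le> real (num g) / 2 ^ (lev g - i)"
      using of_nat_div_le_of_nat[of "num g" "2 ^ (lev g - i)"] by simp
    also have "\<dots> = real (num g) / 2 ^ lev g * 2 ^ i"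
      using that(2) by (simp add: power_diff)
    also have "real (num g) / 2 ^ lev g \<le> \<delta> / real K"
      using C[OF that] Kpos by (simp add: field_simps)
    finally have "real (num g div 2 ^ (lev g - i)) \<le> \<delta> * 2 ^ i / real K" by simp
    then show ?thesis unfolding c_def by (simp add: le_nat_floor)
  qed
  define n where "n = plen i"
  define P where "P = plen (i - 1)"
  define M :: nat where "M = 2 ^ (i * i - i)"
  have nM: "n = 2 ^ i * M" unfolding n_def M_def by (rule plen_split)
  have n: "1 \<le> n" "2 ^ i \<le> n" "P \<le> n" unfolding n_def P_def using plen_pos plen_ge[OF i] plen_mono by auto
  have Pn: "P * 2 ^ i \<le> n" unfolding P_def n_def using plen_pred[of "i - 1"] i by simp
  \<comment> \<open>The sum of the exponents of the long and the short words, so that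
    \<open>2 ^ y\<close> dominates both; the remaining factors are bounded by a cube of
    \<open>2 * n + 2\<close>.\<close>
  define y where "y = K * (M * Suc c) + (K + 1) * P"
  have two: "2 ^ K + 1 \<le> (2::nat) ^ (K + 1)" by simp
  have "N n \<le> (n + 1) ^ 2 + (2 ^ i * (n + 1) ^ 2 * 2 ^ (K * (M * Suc c)) + (P + n + 2) ^ 2 * (2 ^ K + 1) ^ P)"
    unfolding n_def P_def M_def by (rule N_le[OF i Cc])
  also have "\<dots> \<le> 3 * (2 * n + 2) ^ 3 * 2 ^ y"
  proof -
    have cube: "x ^ 2 * z \<le> (2 * n + 2) ^ 3" if "x \<le> 2 * n + 2" "z \<le> 2 * n + 2" for x z
    proof -
      have "x ^ 2 * z \<le> (2 * n + 2) ^ 2 * (2 * n + 2)" using that by (intro mult_le_mono power_mono) auto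
      then show ?thesis by (simp add: power2_eq_square power3_eq_cube)
    qed
    have "(n + 1) ^ 2 * 1 * 1 \<le> (2 * n + 2) ^ 3 * 2 ^ y"
      by (intro mult_le_mono cube) auto
    moreover have "(n + 1) ^ 2 * 2 ^ i * 2 ^ (K * (M * Suc c)) \<le> (2 * n + 2) ^ 3 * 2 ^ y"
      using n by (intro mult_le_mono cube power_increasing) (auto simp: y_def)
    moreover have "(P + n + 2) ^ 2 * 1 * (2 ^ K + 1) ^ P \<le> (2 * n + 2) ^ 3 * 2 ^ y"
    proof (intro mult_le_mono cube)
      have "(2 ^ K + 1) ^ P \<le> ((2::nat) ^ (K + 1)) ^ P" by (intro power_mono two) simp
      also have "\<dots> = 2 ^ ((K + 1) * P)" by (simp only: power_mult)
      also have "\<dots> \<le> 2 ^ y" by (intro power_increasing) (auto simp: y_def)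
      finally show "(2 ^ K + 1) ^ P \<le> (2::nat) ^ y" .
    qed (use n in auto)
    ultimately show ?thesis by (simp add: mult.commute mult.left_commute)
  qed
  finally have "real (N n) \<le> real (3 * (2 * n + 2) ^ 3 * 2 ^ y)" by (simp only: of_nat_le_iff)
  also have "\<dots> = 3 * (2 * real n + 2) ^ 3 * 2 ^ y" by (simp add: add.commute)
  finally have "log 2 (real (N n)) \<le> log 2 (3 * (2 * real n + 2) ^ 3 * 2 ^ y)"
    using N_pos[of n] by (intro log_mono) auto
  also have "\<dots> = log 2 (3 * (2 * real n + 2) ^ 3) + real y"
    by (subst log_mult_pos) (auto simp: log_nat_power)
  finally have "log 2 (real (N n)) / real n \<le> log 2 (3 * (2 * real n + 2) ^ 3) / real n + real y / real n"
    unfolding add_divide_distrib[symmetric] by (rule divide_right_mono) simp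
  moreover have "real y / real n \<le> \<delta> + (2 * real K + 1) / 2 ^ i"
  proof -
    have "real (K * (M * Suc c)) \<le> \<delta> * real n + real K * real M"
    proof -
      have "real K * real c \<le> \<delta> * 2 ^ i" using c Kpos by (simp add: field_simps)
      then have "real M * (real K * real c) \<le> real M * (\<delta> * 2 ^ i)" by (rule mult_left_mono) simp
      then show ?thesis unfolding nM by (simp add: algebra_simps)
    qed
    moreover have "real P * 2 ^ i \<le> real n" using Pn by (metis of_nat_le_iff of_nat_mult of_nat_numeral of_nat_power)
    then have "real ((K + 1) * P) \<le> (real K + 1) * (real n / 2 ^ i)"
      unfolding of_nat_mult by (intro mult_mono) (auto simp: field_simps)
    moreover have "real M = real n / 2 ^ i" unfolding nM by simp
    ultimately have "real y \<le> \<delta> * real n + real K * (real n / 2 ^ i) + (real K + 1) * (real n / 2 ^ i)"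
      unfolding y_def of_nat_add by simp
    also have "\<dots> = (\<delta> + (2 * real K + 1) / 2 ^ i) * real n" by (simp add: field_simps)
    finally show ?thesis using n(1) by (simp add: field_simps)
  qed
  moreover have "h \<le> log 2 (real (N n)) / real n" by (rule entropy_le[OF n(1)])
  ultimately show ?thesis unfolding n_def by linarith
qed

text \<open>One index \<open>i0\<close> whose supremum is below \<open>\<alpha> + \<epsilon>\<close>
  suffices: every unrefuted code of level at least \<open>i0\<close> must also name a witness for
  \<open>i0\<close>, so its claim is at most \<open>\<alpha> + \<epsilon>\<close>.\<close>

lemma entropy_upper:
  assumes "0 < \<epsilon>" shows "h \<le> \<alpha> + \<epsilon>"
proof -
  have "(INF i. SUP j. INF k. ereal (b i j k)) < ereal (\<alpha> + \<epsilon>)"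
    unfolding \<alpha>_eq[symmetric] using assms by simp
  then obtain i0 where i0: "(SUP j. INF k. ereal (b i0 j k)) < ereal (\<alpha> + \<epsilon>)"
    unfolding INF_less_iff by blast
  have bound: "real (num g * K) / 2 ^ lev g \<le> \<alpha> + \<epsilon>" if R: "\<And>k. \<not> refuted g k" and "i0 \<le> lev g" for g
  proof -
    have "ereal (real (num g * K) / 2 ^ lev g) \<le> ereal (b i0 (wit g i0) k)" for k
      using R[of k] that(2) unfolding not_refuted_iff by auto
    then have "ereal (real (num g * K) / 2 ^ lev g) \<le> (INF k. ereal (b i0 (wit g i0) k))"
      by (rule INF_greatest)
    also have "\<dots> \<le> (SUP j. INF k. ereal (b i0 j k))" by (rule SUP_upper) simp
    also have "\<dots> \<le> ereal (\<alpha> + \<epsilon>)" using i0 by simp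
    finally show ?thesis by simp
  qed
  define r where "r i = \<alpha> + \<epsilon> + (2 * real K + 1) / 2 ^ i + log 2 (3 * (2 * real (plen i) + 2) ^ 3) / real (plen i)" for i
  have "(\<lambda>n. log 2 (3 * (2 * real n + 2) ^ 3) / real n) \<longlonglongrightarrow> 0" by real_asymp
  from LIMSEQ_subseq_LIMSEQ[OF this strict_mono_plen]
  have "(\<lambda>i. log 2 (3 * (2 * real (plen i) + 2) ^ 3) / real (plen i)) \<longlonglongrightarrow> 0" by (simp add: comp_def)
  moreover have "(\<lambda>i::nat. (2 * real K + 1) / 2 ^ i) \<longlonglongrightarrow> 0" by real_asymp
  ultimately have "r \<longlonglongrightarrow> \<alpha> + \<epsilon> + 0 + 0" unfolding r_def by (intro tendsto_add tendsto_const)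
  then have "r \<longlonglongrightarrow> \<alpha> + \<epsilon>" by simp
  then show ?thesis
  proof (rule LIMSEQ_le_const, intro exI allI impI)
    fix i assume "max 1 i0 \<le> i"
    then have i: "1 \<le> i" "i0 \<le> i" by auto
    show "h \<le> r i" unfolding r_def
    proof (rule entropy_le_bound[OF i(1)])
      fix g assume "\<And>k. \<not> refuted g k" "i \<le> lev g"
      then show "real (num g * K) / 2 ^ lev g \<le> \<alpha> + \<epsilon>" using i(2) by (intro bound) auto
    qed (use assms \<alpha>_nonneg in simp)
  qed
qed

lemma entropy_eq: "h = \<alpha>"
proof (rule antisym)
  show "h \<le> \<alpha>" by (rule field_le_epsilon) (rule entropy_upper)
  show "\<alpha> \<le> h"
  proof (rule field_le_epsilon)
    fix e :: real assume "0 < e"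
    from entropy_ge[OF this] show "\<alpha> \<le> h + e" by linarith
  qed
qed

end

text \<open>Nonemptiness is required because an empty subshift has no extender sets, and the
  logarithm of 0 has no meaning as an entropy.\<close>

theorem theoremA:
  "{extender_entropy A X | A X. finite A \<and> effective_subshift A X \<and> X \<noteq> {}} = Pi3 \<inter> {0..}"
proof (intro equalityI subsetI)
  fix \<alpha> assume "\<alpha> \<in> {extender_entropy A X | A X. finite A \<and> effective_subshift A X \<and> X \<noteq> {}}"
  then obtain A X where \<alpha>: "\<alpha> = extender_entropy A X" and A: "finite A" "effective_subshift A X" "X \<noteq> {}"
    by blast
  then obtain F where F: "F \<subseteq> patterns A" "comp_enum_patterns F" "X = subshift_of A F"
    unfolding effective_subshift_def by blast
  interpret effective A F X by unfold_locales (use A F in auto)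
  show "\<alpha> \<in> Pi3 \<inter> {0..}" unfolding \<alpha> using entropy_Pi3 entropy_nonneg by simp
next
  fix \<alpha> :: real assume "\<alpha> \<in> Pi3 \<inter> {0..}"
  then obtain \<beta> P Q where \<alpha>: "0 \<le> \<alpha>" "ereal \<alpha> = (INF k1. SUP k2. INF k3. ereal (of_rat (\<beta> k1 k2 k3)))"
    and PQ: "computable3 P" "computable3 Q"
      "\<And>a b c. \<beta> a b c = of_int (int_decode (P a b c)) / of_nat (Suc (Q a b c))"
    unfolding Pi3_def computable_rat_seq_def by auto
  \<comment> \<open>The number of bits per free position must be positive and at least
    \<open>\<alpha>\<close>, since densities do not exceed 1.\<close>
  interpret realisation P Q "nat \<lceil>\<alpha>\<rceil> + 1" \<alpha> "\<lambda>i j k. of_rat (\<beta> i j k)"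
  proof
    show "real_of_rat (\<beta> i j k) = of_int (int_decode (P i j k)) / of_nat (Suc (Q i j k))" for i j k
      unfolding PQ(3) by (simp add: of_rat_divide del: of_nat_Suc)
    show "\<alpha> \<le> real (nat \<lceil>\<alpha>\<rceil> + 1)" using \<alpha>(1) by linarith
  qed (use \<alpha> PQ in auto)
  show "\<alpha> \<in> {extender_entropy A X | A X. finite A \<and> effective_subshift A X \<and> X \<noteq> {}}"
    using entropy_eq effective X_nonempty
    by (intro CollectI exI[of _ "{..2 ^ (nat \<lceil>\<alpha>\<rceil> + 1)}"] exI[of _ X] conjI) simp_all
qed

end
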